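(* The weak Galerkin finite element formulation: find $u_h=\{u_0,u_b\}\in V_{0,h}$ and $w_h=\{w_0,w_b\}\in V_h$ such that $$\begin{cases}((w_h,\phi_h))-(\nabla_w u_h,\nabla_w\phi_h)=0 & \text{for all }\phi_h=\{\phi_0,\phi_b\}\in V_h,\\ (\nabla_w w_h,\nabla_w\psi_h)=(f,\psi_0) & \text{for all }\psi_h=\{\psi_0,\psi_b\}\in V_{0,h},\end{cases}$$ has one and only one solution $[u_h;w_h]\in V_{0,h}\times V_h$.
   Context: $\Omega\subset\mathbb R^2$ is a polygonal domain, $f\in L^2(\Omega)$, and $\mathcal T_h$ is a shape-regular, quasi-uniform triangulation of $\Omega$ with mesh size $h$; $h_K$ is the size of $K\in\mathcal T_h$, $K_0$ its interior, $\mathcal E_h$ the set of all edges, $\mathbf n$ the unit outward normal on $\partial K$. $(\cdot,\cdot)_D$ and $\langle\cdot,\cdot\rangle_{\partial D}$ are $L^2$ inner products; the subscript $D$ is omitted when $D=\Omega$. Fix an integer $j\ge0$. $V_h$ is the set of pairs $v=\{v_0,v_b\}$ with $v_0|_{K_0}\in P_j(K_0)$ for each $K\in\mathcal T_h$ and $v_b|_e\in P_j(e)$ for each $e\in\mathcal E_h$ ($P_j$: polynomials of degree $\le j$; no continuity between $v_0$ and $v_b$ is required; $v_b$ is single-valued on each edge). $V_{0,h}=\{v\in V_h: v_b=0\text{ on all edges in }\partial\Omega\}$. $RT_j(K)=(P_j(K))^2+\mathbf xP_j(K)$ and $\Sigma_h=\{\mathbf q\in(L^2(\Omega))^2:\mathbf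 q|_K\in RT_j(K),\ K\in\mathcal T_h\}$. The discrete weak gradient $\nabla_wv_h\in\Sigma_h$ of $v_h=\{v_0,v_b\}\in V_h$ is defined on each $K$ by $(\nabla_wv_h,\mathbf q)_K=-(v_0,\nabla\cdot\mathbf q)_K+\langle v_b,\mathbf q\cdot\mathbf n\rangle_{\partial K}$ for all $\mathbf q\in RT_j(K)$. Inner product on $V_h$: $((v_h,\phi_h))=\sum_{K\in\mathcal T_h}(v_0,\phi_0)_K+\sum_{K\in\mathcal T_h}h_K\langle v_0-v_b,\phi_0-\phi_b\rangle_{\partial K}$. *)

theory Defs
  imports "HOL-Analysis.Analysis"
begin

section \<open>Domains and meshes\<close>

text \<open>The condition \<open>\<Omega> = interior (closure \<Omega>)\<close> excludes slits and punctures, i.e. \<open>\<Omega>\<close> does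
  not lie on both sides of a part of its boundary. Multiply connected and non-convex domains are
  included.\<close>

definition polygonal_domain :: "(real^2) set \<Rightarrow> bool" where
  "polygonal_domain \<Omega> \<longleftrightarrow>
     \<Omega> \<noteq> {} \<and> open \<Omega> \<and> connected \<Omega> \<and> bounded \<Omega> \<and> \<Omega> = interior (closure \<Omega>) \<and>
     (\<exists>S. finite S \<and> frontier \<Omega> = (\<Union>(a, b)\<in>S. closed_segment a b))"

text \<open>Mesh elements are closed nondegenerate triangles; the library's \<^const>\<open>triangulation\<close> supplies
  finiteness and conformity (any two elements meet in a common face, possibly empty).\<close>

definition triangulation_of :: "(real^2) set set \<Rightarrow> (real^2) set \<Rightarrow> bool" where
  "triangulation_of T \<Omega> \<longleftrightarrow> triangulation T \<and> (\<forall>K\<in>T. 2 simplex K) \<and> \<Union>T = closure \<Omega>"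

text \<open>The size \<open>h\<^sub>K\<close> of an element is \<^term>\<open>diameter K\<close>.\<close>

definition mesh_size :: "(real^2) set set \<Rightarrow> real" where
  "mesh_size T = Max (diameter ` T)"

definition shape_regular :: "real \<Rightarrow> (real^2) set set \<Rightarrow> bool" where
  "shape_regular \<sigma> T \<longleftrightarrow> (\<forall>K\<in>T. \<exists>x. cball x (\<sigma> * diameter K) \<subseteq> K)"

definition quasi_uniform :: "real \<Rightarrow> (real^2) set set \<Rightarrow> bool" where
  "quasi_uniform \<tau> T \<longleftrightarrow> (\<forall>K\<in>T. \<tau> * mesh_size T \<le> diameter K)"

definition edges :: "(real^2) set set \<Rightarrow> (real^2) set set" where
  "edges T = {e. \<exists>K\<in>T. e edge_of K}"

text \<open>\<open>e\<close> is contained in \<open>K\<close>, so the inequality applied to pairs of points of \<open>e\<close> in both orders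
  forces the vector to be orthogonal to \<open>e\<close>.\<close>

definition outward_normal :: "(real^2) set \<Rightarrow> (real^2) set \<Rightarrow> real^2" where
  "outward_normal K e = (THE n. norm n = 1 \<and> (\<forall>x\<in>e. \<forall>y\<in>K. n \<bullet> (y - x) \<le> 0))"


section \<open>\<open>L\<^sup>2\<close> spaces and inner products\<close>

definition L2 :: "(real^2) set \<Rightarrow> (real^2 \<Rightarrow> 'a::euclidean_space) set" where
  "L2 D = {f. f \<in> borel_measurable (lebesgue_on D) \<and> integrable (lebesgue_on D) (\<lambda>x. (norm (f x))\<^sup>2)}"

definition L2_inner :: "(real^2) set \<Rightarrow> (real^2 \<Rightarrow> 'a::euclidean_space) \<Rightarrow> (real^2 \<Rightarrow> 'a) \<Rightarrow> real" where
  "L2_inner D f g = (LINT x:D|lebesgue. f x \<bullet> g x)"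

text \<open>The arc length integral over a segment given as a point set. The endpoints are determined up
  to order, and the value does not depend on the order.\<close>

definition edge_integral :: "(real^2) set \<Rightarrow> (real^2 \<Rightarrow> real) \<Rightarrow> real" where
  "edge_integral e g =
     (let (a, b) = (SOME (a, b). e = closed_segment a b)
      in dist a b * (LINT t:{0..1}|lebesgue. g (linepath a b t)))"

text \<open>Functions on the boundary of \<open>K\<close> are indexed by the edges, since at a vertex they have in
  general different values on the two adjacent edges.\<close>

definition bd_inner ::
    "(real^2) set \<Rightarrow> ((real^2) set \<Rightarrow> real^2 \<Rightarrow> real) \<Rightarrow> ((real^2) set \<Rightarrow> real^2 \<Rightarrow> real) \<Rightarrow> real" where
  "bd_inner K f g = (\<Sum>e | e edge_of K. edge_integral e (\<lambda>x. f e x * g e x))"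


section \<open>Polynomial spaces\<close>

text \<open>Functions whose restriction to \<open>D\<close> is a polynomial of total degree at most \<open>j\<close>. On a segment
  these restrictions are exactly the polynomials of degree at most \<open>j\<close> in the arc length
  parameter.\<close>

definition P :: "nat \<Rightarrow> (real^2) set \<Rightarrow> (real^2 \<Rightarrow> real) set" where
  "P j D = {p. \<exists>c :: nat \<Rightarrow> nat \<Rightarrow> real. \<forall>x\<in>D.
     p x = (\<Sum>a\<le>j. \<Sum>b\<le>j - a. c a b * (x $ 1) ^ a * (x $ 2) ^ b)}"

definition RT :: "nat \<Rightarrow> (real^2) set \<Rightarrow> (real^2 \<Rightarrow> real^2) set" where
  "RT j D = {q. \<exists>p r. (\<forall>i. (\<lambda>x. p x $ i) \<in> P j D) \<and> r \<in> P j D \<and>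
     (\<forall>x\<in>D. q x = p x + r x *\<^sub>R x)}"

definition divergence :: "(real^2 \<Rightarrow> real^2) \<Rightarrow> real^2 \<Rightarrow> real" where
  "divergence q x = trace (jacobian q (at x))"


section \<open>Weak Galerkin spaces\<close>

text \<open>A pair \<open>{v\<^sub>0, v\<^sub>b}\<close>. The second component takes the edge as an argument, because edges share
  vertices.\<close>

type_synonym weak_fun = "(real^2 \<Rightarrow> real) \<times> ((real^2) set \<Rightarrow> real^2 \<Rightarrow> real)"

text \<open>\<open>v\<^sub>0\<close> is given only on the element interiors, and \<open>v\<^sub>b\<close> only on the edges. Both are extended by
  zero, so that each element of the space has exactly one representative; the same convention is
  used for \<open>\<Sigma>\<^sub>h\<close>.\<close>

definition V_space :: "nat \<Rightarrow> (real^2) set set \<Rightarrow> weak_fun set" where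
  "V_space j T = {(v0, vb).
     (\<forall>K\<in>T. v0 \<in> P j (interior K)) \<and> (\<forall>e\<in>edges T. vb e \<in> P j e) \<and>
     (\<forall>x. x \<notin> (\<Union>K\<in>T. interior K) \<longrightarrow> v0 x = 0) \<and>
     (\<forall>e x. e \<notin> edges T \<or> x \<notin> e \<longrightarrow> vb e x = 0)}"

definition V0_space :: "nat \<Rightarrow> (real^2) set \<Rightarrow> (real^2) set set \<Rightarrow> weak_fun set" where
  "V0_space j \<Omega> T = {v \<in> V_space j T.
     \<forall>e\<in>edges T. e \<subseteq> frontier \<Omega> \<longrightarrow> (\<forall>x\<in>e. snd v e x = 0)}"

definition Sigma_space :: "nat \<Rightarrow> (real^2) set \<Rightarrow> (real^2) set set \<Rightarrow> (real^2 \<Rightarrow> real^2) set" where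
  "Sigma_space j \<Omega> T = {q \<in> L2 \<Omega>.
     (\<forall>K\<in>T. q \<in> RT j (interior K)) \<and> (\<forall>x. x \<notin> (\<Union>K\<in>T. interior K) \<longrightarrow> q x = 0)}"

definition weak_grad ::
    "nat \<Rightarrow> (real^2) set \<Rightarrow> (real^2) set set \<Rightarrow> weak_fun \<Rightarrow> real^2 \<Rightarrow> real^2" where
  "weak_grad j \<Omega> T v = (THE g. g \<in> Sigma_space j \<Omega> T \<and>
     (\<forall>K\<in>T. \<forall>q\<in>RT j K.
        L2_inner K g q =
          - L2_inner K (fst v) (divergence q)
          + bd_inner K (snd v) (\<lambda>e x. q x \<bullet> outward_normal K e)))"

text \<open>The boundary values of \<open>v\<^sub>0\<close> seen from inside \<open>K\<close>.\<close>

definition inner_trace :: "(real^2) set \<Rightarrow> (real^2 \<Rightarrow> real) \<Rightarrow> real^2 \<Rightarrow> real" where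
  "inner_trace K v0 x = Lim (at x within interior K) v0"

definition V_inner :: "(real^2) set set \<Rightarrow> weak_fun \<Rightarrow> weak_fun \<Rightarrow> real" where
  "V_inner T v \<phi> =
     (\<Sum>K\<in>T. L2_inner K (fst v) (fst \<phi>)) +
     (\<Sum>K\<in>T. diameter K *
        bd_inner K (\<lambda>e x. inner_trace K (fst v) x - snd v e x)
                   (\<lambda>e x. inner_trace K (fst \<phi>) x - snd \<phi> e x))"

end

theory Submission
  imports Defs "HOL-Library.Function_Algebras"
begin

text \<open>The formulation is a linear system on the finite-dimensional space \<open>V\<^sub>0\<^sub>h \<times> V\<^sub>h\<close> with as many equations
as unknowns. Existence and uniqueness therefore both follow once the bilinear form

  \<open>form (u, w) (\<psi>, \<phi>) = ((w, \<phi>)) - (\<nabla>\<^sub>w u, \<nabla>\<^sub>w \<phi>) + (\<nabla>\<^sub>w w, \<nabla>\<^sub>w \<psi>)\<close>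

is nondegenerate (\<open>nondegenerate_form_represents_functional\<close>). On the diagonal the two gradient terms
cancel and \<open>((w, w)) = 0\<close> remains, so that \<open>w = 0\<close>, because \<open>((\<cdot>, \<cdot>))\<close> is definite
(\<open>V_inner_definite\<close>). Testing with \<open>\<phi> = u\<close> then gives \<open>\<nabla>\<^sub>w u = 0\<close>, and everything rests on the
injectivity of the weak gradient on \<open>V\<^sub>0\<^sub>h\<close> (\<open>weak_grad_zero_imp_zero\<close>).

Locally, \<open>\<nabla>\<^sub>w v = 0\<close> on a triangle \<open>K\<close> forces \<open>v\<^sub>0\<close> and \<open>v\<^sub>b\<close> to be one and the same constant
(\<open>zero_weak_grad_rhs_imp_constant\<close>). The usual argument uses the unisolvence of the Raviart-Thomas
degrees of freedom; here it suffices to test with the explicit fields \<open>q = p (x - a)\<close>, where \<open>a\<close> is a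
vertex of \<open>K\<close> and \<open>p\<close> a polynomial of degree at most \<open>j\<close>. Such a field is tangential to the two edges
at \<open>a\<close>, and on the opposite edge \<open>e\<close> its normal component is \<open>p\<close> times the height \<open>h\<close> over \<open>e\<close>. The
divergence theorem for these fields is the fundamental theorem of calculus along the rays from \<open>a\<close>
(\<open>cone_divergence_theorem\<close>), and it turns \<open>\<nabla>\<^sub>w v = 0\<close> into

  \<open>(p, (x - a) \<cdot> \<nabla>v\<^sub>0)\<^sub>K = h \<langle>v\<^sub>0 - v\<^sub>b, p\<rangle>\<^sub>e\<close>.

Take \<open>p = \<lambda>\<^sub>a (a \<cdot> \<nabla>v\<^sub>0)\<close> with the barycentric coordinate \<open>\<lambda>\<^sub>a\<close>, which vanishes on \<open>e\<close>, and add the three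
equations. Since \<open>\<Sum> \<lambda>\<^sub>a (x - a) = 0\<close>, the sum of the integrands is \<open>- \<Sum> \<lambda>\<^sub>a ((x - a) \<cdot> \<nabla>v\<^sub>0)\<^sup>2\<close>, so that
\<open>\<nabla>v\<^sub>0 = 0\<close>. The choice \<open>p = v\<^sub>0 - v\<^sub>b\<close> then gives \<open>v\<^sub>b = v\<^sub>0\<close> on \<open>e\<close>.

Globally, let \<open>c\<^sub>K\<close> be the constant on \<open>K\<close>. Testing with the field \<open>q = x\<close> and multiplying by \<open>c\<^sub>K\<close>
yields \<open>2 c\<^sub>K\<^sup>2 |K| = \<langle>v\<^sub>b\<^sup>2, x \<cdot> n\<rangle>\<close> on the boundary of \<open>K\<close>. In the sum over all \<open>K\<close> the edges inside \<open>\<Omega>\<close>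
cancel, since they are shared by exactly two triangles with opposite normals
(\<open>interior_edge_two_triangles\<close>), and the edges on the boundary contribute nothing, since \<open>v\<^sub>b = 0\<close>
there. Hence all \<open>c\<^sub>K\<close> vanish.

The existence of the weak gradient itself is the same linear algebra, applied on each triangle to the
\<open>L\<^sup>2\<close> inner product on the Raviart-Thomas space.\<close>

section \<open>Linear systems given by nondegenerate forms\<close>

text \<open>With the pointwise operations, spaces of functions and of pairs of functions such as \<open>V\<^sub>h\<close> become
subspaces of a real vector space, and the general notions of span and linear map apply to them.\<close>

instantiation "fun" :: (type, real_vector) real_vector
begin

definition scaleR_fun_def: "c *\<^sub>R f = (\<lambda>x. c *\<^sub>R f x)"

instance
  by standard (auto simp: scaleR_fun_def fun_eq_iff scaleR_add_right scaleR_add_left)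

end

lemma scaleR_fun_apply [simp]: "(c *\<^sub>R f) x = c *\<^sub>R f x"
  by (simp add: scaleR_fun_def)

lemma sum_fun_apply: "(\<Sum>i\<in>I. f i) x = (\<Sum>i\<in>I. f i x)"
  by (induction I rule: infinite_finite_induct) auto

text \<open>Integrals are additive only on integrable functions, so the functionals below are linear only relative
to a subspace.\<close>

definition linear_on :: "'a::real_vector set \<Rightarrow> ('a \<Rightarrow> real) \<Rightarrow> bool" where
  "linear_on S l \<longleftrightarrow> (\<forall>x\<in>S. \<forall>y\<in>S. l (x + y) = l x + l y) \<and> (\<forall>c. \<forall>x\<in>S. l (c *\<^sub>R x) = c * l x)"

lemma linear_onI:
  assumes "\<And>x y. x \<in> S \<Longrightarrow> y \<in> S \<Longrightarrow> l (x + y) = l x + l y"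
    and "\<And>c x. x \<in> S \<Longrightarrow> l (c *\<^sub>R x) = c * l x"
  shows "linear_on S l"
  using assms by (auto simp: linear_on_def)

lemma linear_on_subset: "linear_on S l \<Longrightarrow> R \<subseteq> S \<Longrightarrow> linear_on R l"
  unfolding linear_on_def by (meson subsetD)

lemma linear_on_diff:
  assumes "linear_on S l" "subspace S" "x \<in> S" "y \<in> S"
  shows "l (x - y) = l x - l y"
proof -
  have "(-1) *\<^sub>R y \<in> S" using assms by (intro subspace_scale)
  then have "l (x + (-1) *\<^sub>R y) = l x + l ((-1) *\<^sub>R y)" "l ((-1) *\<^sub>R y) = (-1) * l y"
    using assms unfolding linear_on_def by blast+
  then show ?thesis by simp
qed

lemma linear_on_zero: "linear_on S l \<Longrightarrow> subspace S \<Longrightarrow> l 0 = 0"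
  using linear_on_diff[of S l 0 0] by (simp add: subspace_0)

lemma linear_on_sum:
  assumes l: "linear_on S l" and S: "subspace S" and "\<And>i. i \<in> I \<Longrightarrow> x i \<in> S"
  shows "l (\<Sum>i\<in>I. c i *\<^sub>R x i) = (\<Sum>i\<in>I. c i * l (x i))"
  using assms(3)
proof (induction I rule: infinite_finite_induct)
  case (insert i I)
  have "l (c i *\<^sub>R x i + (\<Sum>i\<in>I. c i *\<^sub>R x i)) = l (c i *\<^sub>R x i) + l (\<Sum>i\<in>I. c i *\<^sub>R x i)"
    using l insert.prems S by (simp add: linear_on_def subspace_sum subspace_scale)
  also have "l (c i *\<^sub>R x i) = c i * l (x i)"
    using l insert.prems by (simp add: linear_on_def)
  finally show ?case using insert by simp
qed (auto simp: linear_on_zero[OF l S])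

text \<open>Induction on the number of functionals. On the kernel of \<open>m i\<close> the hypothesis holds with \<open>m i\<close> removed.
The error of the combination found there vanishes on the kernel of \<open>m i\<close>, hence it is a multiple of
\<open>m i\<close>.\<close>

lemma linear_functional_in_span_if_vanishes_on_common_kernel:
  assumes "finite I" and "subspace S" and "\<And>i. i \<in> I \<Longrightarrow> linear_on S (m i)" and "linear_on S l"
    and "\<And>x. x \<in> S \<Longrightarrow> (\<And>i. i \<in> I \<Longrightarrow> m i x = 0) \<Longrightarrow> l x = 0"
  shows "\<exists>c. \<forall>x\<in>S. l x = (\<Sum>i\<in>I. c i * m i x)"
  using assms
proof (induction I arbitrary: S rule: finite_induct)
  case empty
  then show ?case by auto
next
  case (insert i I)
  define R where "R = {x\<in>S. m i x = 0}"
  have mi: "linear_on S (m i)" using insert.prems(2) by auto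
  have R: "subspace R"
    using insert.prems(1) mi linear_on_zero[OF mi insert.prems(1)]
    unfolding R_def subspace_def by (auto simp: linear_on_def)
  have RS: "R \<subseteq> S" by (auto simp: R_def)
  have "\<exists>c. \<forall>x\<in>R. l x = (\<Sum>i\<in>I. c i * m i x)"
  proof (rule insert.IH[OF R])
    show "linear_on R (m k)" if "k \<in> I" for k
      using insert.prems(2)[of k] that linear_on_subset[OF _ RS] by auto
    show "linear_on R l" using insert.prems(3) linear_on_subset[OF _ RS] by blast
    show "l x = 0" if "x \<in> R" "\<And>k. k \<in> I \<Longrightarrow> m k x = 0" for x
      using insert.prems(4)[of x] that by (auto simp: R_def)
  qed
  then obtain c where c: "\<And>x. x \<in> R \<Longrightarrow> l x = (\<Sum>i\<in>I. c i * m i x)" by blast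
  show ?case
  proof (cases "R = S")
    case True
    have "l x = (\<Sum>k\<in>insert i I. (c(i := 0)) k * m k x)" if "x \<in> S" for x
    proof -
      have "(\<Sum>k\<in>I. (c(i := 0)) k * m k x) = (\<Sum>k\<in>I. c k * m k x)"
        using insert.hyps by (intro sum.cong) auto
      then show ?thesis using c[of x] that True insert.hyps by simp
    qed
    then show ?thesis by blast
  next
    case False
    then obtain z where z: "z \<in> S" "m i z \<noteq> 0" by (auto simp: R_def)
    \<comment> \<open>the coefficient of \<open>m i\<close> that makes the representation correct at \<open>z\<close>\<close>
    define d where "d = (l z - (\<Sum>k\<in>I. c k * m k z)) / m i z"
    have "l x = (\<Sum>k\<in>insert i I. (c(i := d)) k * m k x)" if x: "x \<in> S" for x
    proof -
      define r where "r = m i x / m i z"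
      have lin: "g (x - r *\<^sub>R z) = g x - r * g z" if "linear_on S g" for g
      proof -
        have "r *\<^sub>R z \<in> S" using z insert.prems(1) by (intro subspace_scale)
        moreover have "g (r *\<^sub>R z) = r * g z" using that z unfolding linear_on_def by blast
        ultimately show ?thesis using linear_on_diff[OF that insert.prems(1) x] by simp
      qed
      have "x - r *\<^sub>R z \<in> R"
        using lin[OF mi] z x insert.prems(1) by (auto simp: R_def r_def subspace_diff subspace_scale)
      from c[OF this] have "l x - r * l z = (\<Sum>k\<in>I. c k * (m k x - r * m k z))"
        using lin[OF insert.prems(3)] lin[OF insert.prems(2)] by simp
      also have "\<dots> = (\<Sum>k\<in>I. c k * m k x) - r * (\<Sum>k\<in>I. c k * m k z)"
        by (simp add: algebra_simps sum_subtractf sum_distrib_left)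
      finally have "l x = (\<Sum>k\<in>I. c k * m k x) + r * (l z - (\<Sum>k\<in>I. c k * m k z))"
        by (simp add: algebra_simps)
      also have "r * (l z - (\<Sum>k\<in>I. c k * m k z)) = d * m i x"
        by (simp add: r_def d_def)
      finally have "l x = (\<Sum>k\<in>I. c k * m k x) + d * m i x" .
      moreover have "(\<Sum>k\<in>I. (c(i := d)) k * m k x) = (\<Sum>k\<in>I. c k * m k x)"
        using insert.hyps by (intro sum.cong) auto
      ultimately show ?thesis using insert.hyps by simp
    qed
    then show ?thesis by blast
  qed
qed

text \<open>Nondegeneracy says that the functionals \<open>form x\<close>, with \<open>x\<close> from a basis, have common kernel \<open>0\<close>. So \<open>l\<close>
is a combination of them, and linearity in the first argument turns the combination into \<open>form x\<close> for a
single \<open>x\<close>.\<close>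

lemma nondegenerate_form_represents_functional:
  fixes form :: "'a::real_vector \<Rightarrow> 'a \<Rightarrow> real"
  assumes X: "subspace X" and B: "finite B" "X \<subseteq> span B"
    and left: "\<And>y. y \<in> X \<Longrightarrow> linear_on X (\<lambda>x. form x y)"
    and right: "\<And>x. x \<in> X \<Longrightarrow> linear_on X (form x)"
    and nondeg: "\<And>y. y \<in> X \<Longrightarrow> (\<And>x. x \<in> X \<Longrightarrow> form x y = 0) \<Longrightarrow> y = 0"
    and l: "linear_on X l"
  shows "\<exists>x\<in>X. \<forall>y\<in>X. form x y = l y"
proof -
  obtain A where A: "A \<subseteq> X" "independent A" "X \<subseteq> span A"
    using real_vector.maximal_independent_subset by blast
  have finA: "finite A"
    using real_vector.independent_span_bound[OF B(1) A(2)] A(1) B(2) by blast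
  have spanA: "span A = X"
    using A span_minimal[OF A(1) X] by blast
  have "\<exists>c. \<forall>y\<in>X. l y = (\<Sum>x\<in>A. c x * form x y)"
  proof (rule linear_functional_in_span_if_vanishes_on_common_kernel[OF finA X _ l])
    show "linear_on X (form x)" if "x \<in> A" for x using right that A by blast
    show "l y = 0" if y: "y \<in> X" and ker: "\<And>x. x \<in> A \<Longrightarrow> form x y = 0" for y
    proof -
      have "form x y = 0" if "x \<in> X" for x
      proof -
        obtain c where "x = (\<Sum>a\<in>A. c a *\<^sub>R a)"
          using \<open>x \<in> X\<close> spanA span_finite[OF finA] by auto
        then show ?thesis
          using linear_on_sum[OF left[OF y] X, of A "\<lambda>a. a" c] A(1) ker by auto
      qed
      then have "y = 0" using nondeg y by blast
      then show ?thesis using linear_on_zero[OF l X] by simp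
    qed
  qed
  then obtain c where c: "\<And>y. y \<in> X \<Longrightarrow> l y = (\<Sum>x\<in>A. c x * form x y)" by blast
  have x: "(\<Sum>x\<in>A. c x *\<^sub>R x) \<in> X"
    using A X by (intro subspace_sum subspace_scale) auto
  have "form (\<Sum>x\<in>A. c x *\<^sub>R x) y = l y" if "y \<in> X" for y
    using linear_on_sum[OF left[OF that] X, of A "\<lambda>a. a" c] A(1) c[OF that] by auto
  with x show ?thesis by blast
qed

section \<open>Polynomials in two variables and Raviart-Thomas fields\<close>

abbreviation polys :: "nat \<Rightarrow> (real^2 \<Rightarrow> real) set" where
  "polys j \<equiv> P j UNIV"

definition monom2 :: "nat \<Rightarrow> nat \<Rightarrow> real^2 \<Rightarrow> real" where
  "monom2 a b x = (x $ 1) ^ a * (x $ 2) ^ b"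

definition monomials :: "nat \<Rightarrow> (real^2 \<Rightarrow> real) set" where
  "monomials j = (\<lambda>(a, b). monom2 a b) ` {(a, b). a + b \<le> j}"

lemma finite_monomials: "finite (monomials j)"
proof -
  have "{(a, b). a + b \<le> j} \<subseteq> {..j} \<times> {..j}" by auto
  then show ?thesis unfolding monomials_def by (meson finite_SigmaI finite_atMost finite_imageI finite_subset)
qed

text \<open>Membership in \<^term>\<open>P j D\<close> only concerns the values on \<open>D\<close>; calculus and algebra are done with a
polynomial on the whole plane that has these values.\<close>

lemma P_eq_polys: "P j D = {p. \<exists>p'\<in>polys j. \<forall>x\<in>D. p x = p' x}"
proof (intro set_eqI iffI)
  fix p assume "p \<in> P j D"
  then obtain c where "\<forall>x\<in>D. p x = (\<Sum>a\<le>j. \<Sum>b\<le>j - a. c a b * (x $ 1) ^ a * (x $ 2) ^ b)"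
    unfolding P_def by blast
  moreover have "(\<lambda>x. \<Sum>a\<le>j. \<Sum>b\<le>j - a. c a b * (x $ 1) ^ a * (x $ 2) ^ b) \<in> polys j"
    unfolding P_def by blast
  ultimately show "p \<in> {p. \<exists>p'\<in>polys j. \<forall>x\<in>D. p x = p' x}"
    by (intro CollectI bexI) auto
next
  fix p assume "p \<in> {p. \<exists>p'\<in>polys j. \<forall>x\<in>D. p x = p' x}"
  then obtain p' where "p' \<in> polys j" "\<forall>x\<in>D. p x = p' x" by blast
  then show "p \<in> P j D" unfolding P_def by force
qed

lemma P_subset: "p \<in> P j D \<Longrightarrow> S \<subseteq> D \<Longrightarrow> p \<in> P j S"
  unfolding P_eq_polys[where j=j and D=D] P_eq_polys[where j=j and D=S] by blast

lemma P_globalE: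
  assumes "p \<in> P j D"
  obtains p' where "p' \<in> polys j" "\<And>x. x \<in> D \<Longrightarrow> p x = p' x"
  using assms unfolding P_eq_polys[where j=j and D=D] by blast

lemma subspace_P: "subspace (P j D)"
  unfolding subspace_def
proof (intro conjI ballI allI)
  show "0 \<in> P j D"
    unfolding P_def by (auto intro!: exI[of _ "\<lambda>_ _. 0"])
next
  fix p q assume "p \<in> P j D" "q \<in> P j D"
  then obtain c d where c: "\<And>x. x \<in> D \<Longrightarrow> p x = (\<Sum>a\<le>j. \<Sum>b\<le>j - a. c a b * (x $ 1) ^ a * (x $ 2) ^ b)"
    and d: "\<And>x. x \<in> D \<Longrightarrow> q x = (\<Sum>a\<le>j. \<Sum>b\<le>j - a. d a b * (x $ 1) ^ a * (x $ 2) ^ b)"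
    unfolding P_def by blast
  show "p + q \<in> P j D"
    unfolding P_def
    by (intro CollectI exI[of _ "\<lambda>a b. c a b + d a b"]) (simp add: c d sum.distrib algebra_simps)
next
  fix p and r :: real assume "p \<in> P j D"
  then obtain c where c: "\<And>x. x \<in> D \<Longrightarrow> p x = (\<Sum>a\<le>j. \<Sum>b\<le>j - a. c a b * (x $ 1) ^ a * (x $ 2) ^ b)"
    unfolding P_def by blast
  show "r *\<^sub>R p \<in> P j D"
    unfolding P_def
    by (intro CollectI exI[of _ "\<lambda>a b. r * c a b"]) (simp add: c sum_distrib_left algebra_simps)
qed

lemma monom2_in_polys:
  assumes "a + b \<le> j"
  shows "monom2 a b \<in> polys j"
proof -
  have "monom2 a b x = (\<Sum>a'\<le>j. \<Sum>b'\<le>j - a'. (if a' = a \<and> b' = b then 1 else 0) * (x $ 1) ^ a' * (x $ 2) ^ b')" for x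
  proof -
    have "(\<Sum>a'\<le>j. \<Sum>b'\<le>j - a'. (if a' = a \<and> b' = b then 1 else 0) * (x $ 1) ^ a' * (x $ 2) ^ b')
        = (\<Sum>a'\<le>j. if a' = a then (\<Sum>b'\<le>j - a. if b' = b then (x $ 1) ^ a * (x $ 2) ^ b else 0) else 0)"
      by (intro sum.cong refl) (auto intro!: sum.cong simp: if_distrib[of "\<lambda>c. c * _"] cong: if_cong)
    also have "\<dots> = monom2 a b x"
      using assms by (simp add: monom2_def)
    finally show ?thesis by simp
  qed
  then show ?thesis
    unfolding P_def by (intro CollectI exI[of _ "\<lambda>a' b'. if a' = a \<and> b' = b then 1 else 0"]) simp
qed

lemma polys_eq_span: "polys j = span (monomials j)"
proof
  show "polys j \<subseteq> span (monomials j)"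
  proof
    fix p assume "p \<in> polys j"
    then obtain c where c: "\<And>x. p x = (\<Sum>a\<le>j. \<Sum>b\<le>j - a. c a b * (x $ 1) ^ a * (x $ 2) ^ b)"
      unfolding P_def by blast
    have "p = (\<Sum>a\<le>j. \<Sum>b\<le>j - a. c a b *\<^sub>R monom2 a b)"
      by (rule ext) (simp add: c sum_fun_apply monom2_def mult.assoc)
    also have "\<dots> \<in> span (monomials j)"
      by (intro span_sum span_scale span_base) (auto simp: monomials_def)
    finally show "p \<in> span (monomials j)" .
  qed
  show "span (monomials j) \<subseteq> polys j"
    by (rule span_minimal) (auto simp: monomials_def subspace_P intro: monom2_in_polys)
qed

lemma polys_induct [consumes 1, case_names monom2 zero add scale]:
  assumes "p \<in> polys j"
    and "\<And>a b. a + b \<le> j \<Longrightarrow> Q (monom2 a b)"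
    and "Q 0"
    and "\<And>p q. Q p \<Longrightarrow> Q q \<Longrightarrow> Q (p + q)"
    and "\<And>c p. Q p \<Longrightarrow> Q (c *\<^sub>R p)"
  shows "Q p"
proof -
  have "polys j \<subseteq> Collect Q"
    unfolding polys_eq_span
    by (rule span_minimal) (use assms(2-) in \<open>auto simp: monomials_def subspace_def\<close>)
  then show ?thesis using assms(1) by blast
qed

lemma polys_add:
  assumes "p \<in> polys j" "q \<in> polys j"
  shows "(\<lambda>x. p x + q x) \<in> polys j"
  using subspace_add[OF subspace_P assms] by (simp add: plus_fun_def)

lemma polys_scale: "p \<in> polys j \<Longrightarrow> (\<lambda>x. c * p x) \<in> polys j"
  using subspace_scale[OF subspace_P, of p] unfolding scaleR_fun_def by simp

lemma polys_zero: "(\<lambda>x. 0) \<in> polys j"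
  using subspace_0[OF subspace_P] by (simp add: zero_fun_def)

lemma polys_mono: "p \<in> polys i \<Longrightarrow> i \<le> j \<Longrightarrow> p \<in> polys j"
  unfolding polys_eq_span by (rule subsetD[OF span_mono]) (auto simp: monomials_def)

lemma polys_const: "(\<lambda>x. c) \<in> polys j"
  using polys_scale[OF monom2_in_polys[of 0 0 j], of c] by (simp add: monom2_def)

lemma polys_0_const: "p \<in> polys 0 \<Longrightarrow> \<exists>c. p = (\<lambda>x. c)"
  by (auto simp: P_def)

lemma polys_mult_coord:
  assumes "p \<in> polys j"
  shows "(\<lambda>x. x $ i * p x) \<in> polys (Suc j)"
  using assms
proof (induction rule: polys_induct)
  case (monom2 a b)
  have "(\<lambda>x. x $ 1 * monom2 a b x) = monom2 (Suc a) b" "(\<lambda>x. x $ 2 * monom2 a b x) = monom2 a (Suc b)"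
    by (auto simp: monom2_def fun_eq_iff)
  then show ?case using monom2 exhaust_2[of i] monom2_in_polys[of "Suc a" b "Suc j"] monom2_in_polys[of a "Suc b" "Suc j"]
    by auto
next
  case zero
  then show ?case by (simp add: polys_zero)
next
  case (add p q)
  then show ?case using polys_add[OF add] by (simp add: distrib_left)
next
  case (scale c p)
  then show ?case using polys_scale[of "\<lambda>x. x $ i * p x" "Suc j" c] by (simp add: mult.left_commute)
qed

lemma polys_mult_affine:
  assumes "p \<in> polys j"
  shows "(\<lambda>x. (\<alpha> + \<beta> * x $ 1 + \<gamma> * x $ 2) * p x) \<in> polys (Suc j)"
proof -
  have "(\<lambda>x. \<alpha> * p x + \<beta> * (x $ 1 * p x) + \<gamma> * (x $ 2 * p x)) \<in> polys (Suc j)"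
    using assms by (intro polys_add polys_scale polys_mult_coord) (auto intro: polys_mono)
  then show ?thesis by (simp add: algebra_simps)
qed

lemma polys_continuous: "p \<in> polys j \<Longrightarrow> continuous_on S p"
proof (induction rule: polys_induct)
  case (monom2 a b)
  then show ?case unfolding monom2_def by (intro continuous_intros)
next
  case (add p q)
  then show ?case by (simp add: plus_fun_def continuous_on_add)
next
  case (scale c p)
  then show ?case by (simp add: scaleR_fun_def continuous_on_mult_left)
qed (simp add: zero_fun_def)

lemma inner_2: "(x::real^2) \<bullet> y = x $ 1 * y $ 1 + x $ 2 * y $ 2"
  by (simp add: inner_vec_def sum_2)

lemma polys_gradient:
  assumes "p \<in> polys (Suc j)"
  shows "\<exists>G. (\<forall>i. (\<lambda>x. G x $ i) \<in> polys j) \<and> (\<forall>x. (p has_derivative (\<lambda>h. h \<bullet> G x)) (at x))"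
  using assms
proof (induction rule: polys_induct)
  case (monom2 a b)
  define G :: "real^2 \<Rightarrow> real^2" where
    "G x = vector [of_nat a * (x $ 1 ^ (a - 1) * x $ 2 ^ b), of_nat b * (x $ 1 ^ a * x $ 2 ^ (b - 1))]" for x
  have "(\<lambda>x. of_nat a * monom2 (a - 1) b x) \<in> polys j"
    using monom2 by (cases "a = 0") (auto simp: polys_zero intro!: polys_scale monom2_in_polys)
  moreover have "(\<lambda>x. of_nat b * monom2 a (b - 1) x) \<in> polys j"
    using monom2 by (cases "b = 0") (auto simp: polys_zero intro!: polys_scale monom2_in_polys)
  ultimately have "(\<lambda>x. G x $ i) \<in> polys j" for i
    using exhaust_2[of i] by (auto simp: G_def monom2_def)
  moreover have "(monom2 a b has_derivative (\<lambda>h. h \<bullet> G x)) (at x)" for x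
    unfolding monom2_def
    by (rule derivative_eq_intros has_derivative_ident refl
          bounded_linear.has_derivative[OF bounded_linear_vec_nth] | simp)+
       (simp add: fun_eq_iff inner_2 G_def algebra_simps)
  ultimately show ?case by blast
next
  case zero
  show ?case
    by (rule exI[of _ "\<lambda>x. 0"]) (auto simp: polys_zero zero_fun_def)
next
  case (add p q)
  then obtain G H where "\<And>i. (\<lambda>x. G x $ i) \<in> polys j" "\<And>x. (p has_derivative (\<lambda>h. h \<bullet> G x)) (at x)"
    "\<And>i. (\<lambda>x. H x $ i) \<in> polys j" "\<And>x. (q has_derivative (\<lambda>h. h \<bullet> H x)) (at x)" by blast
  then show ?case
    by (intro exI[of _ "\<lambda>x. G x + H x"])
       (auto simp: plus_fun_def inner_add_right intro!: polys_add has_derivative_add)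
next
  case (scale c p)
  then obtain G where G: "\<And>i. (\<lambda>x. G x $ i) \<in> polys j" "\<And>x. (p has_derivative (\<lambda>h. h \<bullet> G x)) (at x)"
    by blast
  have "((\<lambda>x. c * p x) has_derivative (\<lambda>h. c * (h \<bullet> G x))) (at x)" for x
    using G(2) by (rule has_derivative_mult_right)
  with G(1) show ?case
    by (intro exI[of _ "\<lambda>x. c *\<^sub>R G x"])
       (auto simp: scaleR_fun_def intro!: polys_scale)
qed

text \<open>The fields that radiate from a point \<open>a\<close>. When \<open>a\<close> is a vertex of a triangle, they are tangential to
the two edges at \<open>a\<close>.\<close>

lemma polys_cone_field_in_RT:
  assumes "p \<in> polys j"
  shows "(\<lambda>x. p x *\<^sub>R (x - a)) \<in> RT j D"
proof -
  have "(\<lambda>x. (- p x *\<^sub>R a) $ i) \<in> polys j" for i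
    using polys_scale[OF assms, of "- a $ i"] by (simp add: mult.commute)
  then have "\<forall>i. (\<lambda>x. (- p x *\<^sub>R a) $ i) \<in> P j D" "p \<in> P j D"
    using assms P_subset[OF _ subset_UNIV] by blast+
  moreover have "p x *\<^sub>R (x - a) = - p x *\<^sub>R a + p x *\<^sub>R x" for x
    by (simp add: algebra_simps)
  ultimately show ?thesis unfolding RT_def
    by (intro CollectI exI[of _ "\<lambda>x. - p x *\<^sub>R a"] exI[of _ p]) auto
qed

lemma RT_cong: "q \<in> RT j D \<Longrightarrow> (\<And>x. x \<in> D \<Longrightarrow> q x = r x) \<Longrightarrow> r \<in> RT j D"
  unfolding RT_def by (smt (verit, best) mem_Collect_eq)

lemma RT_subset: "q \<in> RT j D \<Longrightarrow> S \<subseteq> D \<Longrightarrow> q \<in> RT j S"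
  unfolding RT_def using P_subset by (smt (verit, best) mem_Collect_eq subsetD)

lemma RT_global:
  assumes "q \<in> RT j D"
  obtains p r where "\<And>i. (\<lambda>x. p x $ i) \<in> polys j" "r \<in> polys j" "\<And>x. x \<in> D \<Longrightarrow> q x = p x + r x *\<^sub>R x"
proof -
  obtain p0 r0 where 0: "\<And>i. (\<lambda>x. p0 x $ i) \<in> P j D" "r0 \<in> P j D" "\<And>x. x \<in> D \<Longrightarrow> q x = p0 x + r0 x *\<^sub>R x"
    using assms unfolding RT_def by blast
  have "\<exists>p'. p' \<in> polys j \<and> (\<forall>x\<in>D. p0 x $ i = p' x)" for i
    by (rule P_globalE[OF 0(1)[of i]]) auto
  then obtain p' where p': "\<And>i. p' i \<in> polys j" "\<And>i x. x \<in> D \<Longrightarrow> p0 x $ i = p' i x" by metis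
  obtain r where r: "r \<in> polys j" "\<And>x. x \<in> D \<Longrightarrow> r0 x = r x"
    by (rule P_globalE[OF 0(2)]) auto
  show ?thesis
  proof (rule that)
    show "(\<lambda>x. (\<chi> i. p' i x) $ k) \<in> polys j" for k using p'(1)[of k] by simp
    show "r \<in> polys j" by (rule r)
    show "q x = (\<chi> i. p' i x) + r x *\<^sub>R x" if "x \<in> D" for x
      using 0(3)[OF that] p'(2)[OF that] r(2)[OF that] by (simp add: vec_eq_iff)
  qed
qed

lemma subspace_RT: "subspace (RT j D)"
  unfolding subspace_def
proof (intro conjI ballI allI)
  show "0 \<in> RT j D"
    using polys_cone_field_in_RT[OF polys_zero, where j=j and D=D] by (simp add: zero_fun_def)
next
  fix q q' assume "q \<in> RT j D" "q' \<in> RT j D"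
  then obtain p r p' r' where h: "\<And>i. (\<lambda>x. p x $ i) \<in> P j D" "r \<in> P j D" "\<And>x. x \<in> D \<Longrightarrow> q x = p x + r x *\<^sub>R x"
    "\<And>i. (\<lambda>x. p' x $ i) \<in> P j D" "r' \<in> P j D" "\<And>x. x \<in> D \<Longrightarrow> q' x = p' x + r' x *\<^sub>R x"
    unfolding RT_def by blast
  have "(\<lambda>x. (p x + p' x) $ i) \<in> P j D" for i
    using subspace_add[OF subspace_P h(1)[of i] h(4)[of i]] by (simp add: plus_fun_def)
  moreover have "r + r' \<in> P j D" using h subspace_add[OF subspace_P] by blast
  moreover have "\<forall>x\<in>D. (q + q') x = (p x + p' x) + (r + r') x *\<^sub>R x"
    using h by (simp add: algebra_simps)
  ultimately show "q + q' \<in> RT j D" unfolding RT_def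
    by (intro CollectI exI[of _ "\<lambda>x. p x + p' x"] exI[of _ "r + r'"] conjI allI)
next
  fix q c assume "q \<in> RT j D"
  then obtain p r where h: "\<And>i. (\<lambda>x. p x $ i) \<in> P j D" "r \<in> P j D" "\<And>x. x \<in> D \<Longrightarrow> q x = p x + r x *\<^sub>R x"
    unfolding RT_def by blast
  have "(\<lambda>x. (c *\<^sub>R p x) $ i) \<in> P j D" for i
    using subspace_scale[OF subspace_P h(1)[of i]] by (simp add: scaleR_fun_def)
  moreover have "c *\<^sub>R r \<in> P j D" using h subspace_scale[OF subspace_P] by blast
  moreover have "\<forall>x\<in>D. (c *\<^sub>R q) x = c *\<^sub>R p x + (c *\<^sub>R r) x *\<^sub>R x"
    using h by (simp add: algebra_simps)
  ultimately show "c *\<^sub>R q \<in> RT j D" unfolding RT_def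
    by (intro CollectI exI[of _ "\<lambda>x. c *\<^sub>R p x"] exI[of _ "c *\<^sub>R r"] conjI allI)
qed

lemma RT_components:
  assumes "q \<in> RT j D"
  obtains Q where "\<And>i. (\<lambda>x. Q x $ i) \<in> polys (Suc j)" "\<And>x. x \<in> D \<Longrightarrow> q x = Q x"
proof -
  obtain p r where h: "\<And>i. (\<lambda>x. p x $ i) \<in> polys j" "r \<in> polys j" "\<And>x. x \<in> D \<Longrightarrow> q x = p x + r x *\<^sub>R x"
    using RT_global[OF assms] by blast
  have "(\<lambda>x. (p x + r x *\<^sub>R x) $ i) \<in> polys (Suc j)" for i
    using polys_add[OF polys_mono[OF h(1)[of i] le_SucI[OF order_refl]] polys_mult_coord[OF h(2), of i]]
    by (simp add: mult.commute)
  then show ?thesis using h(3) that[of "\<lambda>x. p x + r x *\<^sub>R x"] by blast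
qed

lemma continuous_on_polys_vec:
  fixes Q :: "real^2 \<Rightarrow> real^2"
  assumes "\<And>i. (\<lambda>x. Q x $ i) \<in> polys j"
  shows "continuous_on S Q"
  using continuous_on_vec_lambda[of S "\<lambda>i x. Q x $ i"] polys_continuous[OF assms] by simp

lemma divergence_eq:
  assumes "(q has_derivative D) (at x)"
  shows "divergence q x = D (axis 1 1) $ 1 + D (axis 2 1) $ 2"
  unfolding divergence_def jacobian_def frechet_derivative_at[OF assms, symmetric]
  by (simp add: trace_def sum_2 matrix_def)

lemma divergence_cong:
  assumes "open S" "x \<in> S" "\<And>y. y \<in> S \<Longrightarrow> q y = r y" "r differentiable (at x)"
  shows "divergence q x = divergence r x" "q differentiable (at x)"
proof -
  obtain D where D: "(r has_derivative D) (at x)" using assms(4) by (auto simp: differentiable_def)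
  then have "(q has_derivative D) (at x)"
    using has_derivative_transform_within_open[OF D assms(1,2)] assms(3) by metis
  with D show "divergence q x = divergence r x" "q differentiable (at x)"
    by (auto simp: divergence_eq differentiable_def)
qed

lemma divergence_add:
  assumes "q differentiable (at x)" "r differentiable (at x)"
  shows "divergence (q + r) x = divergence q x + divergence r x"
proof -
  obtain D E where D: "(q has_derivative D) (at x)" "(r has_derivative E) (at x)"
    using assms by (auto simp: differentiable_def)
  from has_derivative_add[OF this] have "(q + r has_derivative (\<lambda>h. D h + E h)) (at x)"
    by (simp add: plus_fun_def)
  from divergence_eq[OF this] D show ?thesis by (simp add: divergence_eq)
qed

lemma divergence_scale:
  assumes "q differentiable (at x)"
  shows "divergence (c *\<^sub>R q) x = c * divergence q x"
proof -
  obtain D where D: "(q has_derivative D) (at x)"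
    using assms by (auto simp: differentiable_def)
  from has_derivative_scaleR_right[OF this, of c] have "(c *\<^sub>R q has_derivative (\<lambda>h. c *\<^sub>R D h)) (at x)"
    by (simp add: scaleR_fun_def)
  from divergence_eq[OF this] D show ?thesis by (simp add: divergence_eq algebra_simps)
qed

text \<open>A field in \<^term>\<open>RT j D\<close> is arbitrary outside \<open>D\<close>, so its divergence is meaningful only in the
interior.\<close>

lemma RT_divergence:
  assumes "q \<in> RT j D"
  shows "\<And>x. x \<in> interior D \<Longrightarrow> q differentiable (at x)"
    and "\<exists>d\<in>polys j. \<forall>x\<in>interior D. divergence q x = d x"
proof -
  obtain Q where Q: "\<And>i. (\<lambda>x. Q x $ i) \<in> polys (Suc j)" "\<And>x. x \<in> D \<Longrightarrow> q x = Q x"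
    using RT_components[OF assms] by blast
  obtain G where G: "\<And>k i. (\<lambda>x. G k x $ i) \<in> polys j"
     "\<And>k x. ((\<lambda>x. Q x $ k) has_derivative (\<lambda>h. h \<bullet> G k x)) (at x)"
    using polys_gradient[OF Q(1)] by metis
  have der: "(Q has_derivative (\<lambda>h. \<chi> k. h \<bullet> G k x)) (at x)" for x
    unfolding has_derivative_componentwise_within[of Q]
    using G(2)[of _ x] by (auto simp: Basis_vec_def inner_axis)
  then have diff: "Q differentiable (at x)" for x by (auto simp: differentiable_def)
  show "q differentiable (at x)" if "x \<in> interior D" for x
    using divergence_cong(2)[OF open_interior that _ diff] Q(2) interior_subset by blast
  have "divergence q x = G 1 x $ 1 + G 2 x $ 2" if "x \<in> interior D" for x
  proof -
    have "divergence q x = divergence Q x"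
      using divergence_cong(1)[OF open_interior that _ diff] Q(2) interior_subset by blast
    then show ?thesis by (simp add: divergence_eq[OF der] inner_axis')
  qed
  then show "\<exists>d\<in>polys j. \<forall>x\<in>interior D. divergence q x = d x"
    by (intro bexI[OF _ polys_add[OF G(1)[of 1 1] G(1)[of 2 2]]]) simp
qed

lemma divergence_cone_field:
  assumes "(p has_derivative (\<lambda>h. h \<bullet> G)) (at x)"
  shows "divergence (\<lambda>x. p x *\<^sub>R (x - a)) x = 2 * p x + (x - a) \<bullet> G"
proof -
  have "((\<lambda>x. p x *\<^sub>R (x - a)) has_derivative (\<lambda>h. p x *\<^sub>R h + (h \<bullet> G) *\<^sub>R (x - a))) (at x)"
    using assms by (auto intro!: derivative_eq_intros)
  from divergence_eq[OF this] show ?thesis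
    by (simp add: inner_axis' inner_2 axis_def algebra_simps)
qed

section \<open>Polar coordinates on a triangle\<close>

text \<open>Twice the signed area of the triangle with corners \<open>0\<close>, \<open>u\<close>, \<open>v\<close>.\<close>

definition cross2 :: "real^2 \<Rightarrow> real^2 \<Rightarrow> real" where
  "cross2 u v = u $ 1 * v $ 2 - u $ 2 * v $ 1"

lemma cross2_collinear:
  assumes "\<not> collinear {a, b, c}"
  shows "cross2 (b - a) (c - a) \<noteq> 0"
proof
  assume 0: "cross2 (b - a) (c - a) = 0"
  define u v where "u = c - a" and "v = b - a"
  have ne: "u \<noteq> 0" using assms collinear_3_expand[of a b c] by (auto simp: u_def)
  define k where "k = (u \<bullet> v) / (u \<bullet> u)"
  have uu: "u \<bullet> u \<noteq> 0" using ne by simp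
  have "v $ 1 * (u \<bullet> u) = (u \<bullet> v) * u $ 1" "v $ 2 * (u \<bullet> u) = (u \<bullet> v) * u $ 2"
    using 0 unfolding u_def[symmetric] v_def[symmetric] cross2_def inner_2 by algebra+
  then have "v $ 1 = k * u $ 1" "v $ 2 = k * u $ 2"
    using uu by (auto simp: k_def field_simps)
  then have "v = k *\<^sub>R u" by (simp add: vec_eq_iff forall_2)
  then have "b = (1 - k) *\<^sub>R a + (1 - (1 - k)) *\<^sub>R c" by (simp add: u_def v_def algebra_simps)
  then show False using assms collinear_3_expand[of a b c] by blast
qed

lemma set_integrable_continuous_compact:
  fixes F :: "'a::euclidean_space \<Rightarrow> 'b::euclidean_space"
  assumes "compact K" "continuous_on K F"
  shows "set_integrable lebesgue K F"
  using borel_integrable_compact[OF assms] unfolding set_integrable_def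
  by (simp add: integrable_completion)

text \<open>Fubini's theorem, in the order in which the inner integral runs along the rays from the vertex in
\<open>interior_triangle\<close>.\<close>

lemma integral_unit_square:
  fixes F :: "real^2 \<Rightarrow> real"
  assumes F: "continuous_on UNIV F"
  shows "integral (cbox 0 1) F = integral {0..1} (\<lambda>t. integral {0..1} (\<lambda>s. F (vector [s, t])))"
proof -
  let ?g = "\<lambda>p::real \<times> real. vector [snd p, fst p] :: real^2"
  let ?h = "\<lambda>y::real^2. (y $ 2, y $ 1)"
  have img: "?g ` cbox u v = cbox (?g u) (?g v)" for u v
  proof (intro set_eqI iffI)
    fix y assume "y \<in> cbox (?g u) (?g v)"
    then show "y \<in> ?g ` cbox u v"
      by (intro image_eqI[of _ _ "?h y"])
         (auto simp: mem_box_cart forall_2 vec_eq_iff cbox_Pair_eq[of "fst u" "snd u" "fst v" "snd v", simplified])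
  qed (auto simp: mem_box_cart forall_2 cbox_Pair_eq[of "fst u" "snd u" "fst v" "snd v", simplified])
  have himg: "?h ` cbox u v = cbox (?h u) (?h v)" for u v
  proof (intro set_eqI iffI)
    fix y assume y: "y \<in> cbox (?h u) (?h v)"
    obtain r s where rs: "y = (r, s)" by (cases y)
    show "y \<in> ?h ` cbox u v"
      using y unfolding rs
      by (intro image_eqI[of _ _ "vector [s, r]"])
         (auto simp: mem_box_cart forall_2 cbox_Pair_eq)
  qed (auto simp: mem_box_cart forall_2 cbox_Pair_eq)
  have cont: "continuous (at x) ?g" for x
  proof -
    have 1: "continuous_on UNIV (\<lambda>p::real \<times> real. \<chi> i::2. if i = 1 then snd p else fst p)"
    proof (intro continuous_on_vec_lambda)
      show "continuous_on UNIV (\<lambda>p::real \<times> real. if i = 1 then snd p else fst p)" for i :: 2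
        by (cases "i = 1") (auto intro!: continuous_on_fst continuous_on_snd continuous_on_id)
    qed
    have 2: "?g = (\<lambda>p. \<chi> i. if i = 1 then snd p else fst p)"
      by (auto simp: fun_eq_iff vec_eq_iff forall_2)
    have "continuous_on UNIV ?g" by (rule ssubst[of _ _ "continuous_on UNIV", OF 2 1])
    then show ?thesis using continuous_on_eq_continuous_at[OF open_UNIV, of ?g] by blast
  qed
  have "measure lborel (cbox (?g u) (?g v)) = 1 * measure lborel (cbox u v)" for u v
  proof -
    have c: "measure lborel (cbox u v) = measure lborel (cbox (fst u) (fst v)) * measure lborel (cbox (snd u) (snd v))"
      using content_Pair[of "fst u" "snd u" "fst v" "snd v"] by simp
    show ?thesis
    proof (cases "cbox u v = {}")
      case True
      then have "cbox (?g u) (?g v) = {}" using img[of u v] by simp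
      then show ?thesis using True by simp
    next
      case False
      then have "cbox (?g u) (?g v) \<noteq> {}" unfolding img[of u v, symmetric] by blast
      moreover from this have "fst u \<le> fst v" "snd u \<le> snd v"
        by (auto simp: interval_ne_empty_cart forall_2)
      ultimately show ?thesis unfolding c
        by (simp add: content_cbox_if_cart UNIV_2)
    qed
  qed
  then have "((\<lambda>x. F (?g x)) has_integral (1 / 1) *\<^sub>R integral (cbox 0 1) F) (?h ` cbox 0 1)"
    by (intro has_integral_twiddle cont)
       (auto simp: img himg vec_eq_iff forall_2 intro!: integrable_integral integrable_continuous continuous_on_subset[OF F])
  then have *: "integral (cbox (0, 0) (1, 1)) (\<lambda>x. F (?g x)) = integral (cbox 0 1) F"
    by (simp add: himg integral_unique)
  have "continuous_on (cbox (0, 0) (1, 1)) (\<lambda>x. F (?g x))"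
    by (rule continuous_on_compose2[OF F]) (use cont in \<open>auto simp: continuous_at_imp_continuous_on\<close>)
  from integral_prod_continuous[OF this] * show ?thesis by simp
qed

text \<open>Polar coordinates about the vertex \<open>a\<close>: \<open>y $ 1\<close> is the position on the ray from \<open>a\<close> to the opposite
edge, and \<open>y $ 2\<close> is the position of the end of that ray on the edge. The open square avoids the
singularity at \<open>a\<close>.\<close>

lemma interior_triangle:
  fixes a b c :: "real^2"
  assumes "\<not> collinear {a, b, c}"
  shows "interior (convex hull {a, b, c}) =
     (\<lambda>y::real^2. a + y $ 1 *\<^sub>R ((1 - y $ 2) *\<^sub>R (b - a) + y $ 2 *\<^sub>R (c - a))) ` box 0 1"
proof -
  have I: "interior (convex hull {a, b, c}) =
         {v. \<exists>x y z. 0 < x \<and> 0 < y \<and> 0 < z \<and> x + y + z = 1 \<and> x *\<^sub>R a + y *\<^sub>R b + z *\<^sub>R c = v}"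
    by (rule interior_convex_hull_3_minimal[OF assms]) simp
  show ?thesis
  proof (intro set_eqI iffI)
    fix v assume "v \<in> interior (convex hull {a, b, c})"
    then obtain x y z where h: "0 < x" "0 < y" "0 < z" "x + y + z = 1" "v = x *\<^sub>R a + y *\<^sub>R b + z *\<^sub>R c"
      unfolding I by blast
    have x: "x = 1 - (y + z)" using h by simp
    have "v = a + (y + z) *\<^sub>R ((1 - z / (y + z)) *\<^sub>R (b - a) + (z / (y + z)) *\<^sub>R (c - a))"
    proof -
      have "(y + z) * (1 - z / (y + z)) = y" "(y + z) * (z / (y + z)) = z"
        using h by (auto simp: field_simps)
      then have "a + (y + z) *\<^sub>R ((1 - z / (y + z)) *\<^sub>R (b - a) + (z / (y + z)) *\<^sub>R (c - a)) = a + y *\<^sub>R (b - a) + z *\<^sub>R (c - a)"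
        by (simp add: scaleR_add_right)
      then show ?thesis by (simp add: h(5) x algebra_simps)
    qed
    moreover have "vector [y + z, z / (y + z)] \<in> box (0::real^2) 1"
      using h by (auto simp: mem_box_cart forall_2)
    ultimately show "v \<in> (\<lambda>y::real^2. a + y $ 1 *\<^sub>R ((1 - y $ 2) *\<^sub>R (b - a) + y $ 2 *\<^sub>R (c - a))) ` box 0 1"
      by (intro image_eqI[of _ _ "vector [y + z, z / (y + z)] :: real^2"]) auto
  next
    fix v assume "v \<in> (\<lambda>y::real^2. a + y $ 1 *\<^sub>R ((1 - y $ 2) *\<^sub>R (b - a) + y $ 2 *\<^sub>R (c - a))) ` box 0 1"
    then obtain y :: "real^2" where y: "y \<in> box 0 1" "v = a + y $ 1 *\<^sub>R ((1 - y $ 2) *\<^sub>R (b - a) + y $ 2 *\<^sub>R (c - a))"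
      by blast
    have y': "0 < y $ 1" "y $ 1 < 1" "0 < y $ 2" "y $ 2 < 1" using y(1) by (auto simp: mem_box_cart forall_2)
    have "v = (1 - y $ 1) *\<^sub>R a + (y $ 1 * (1 - y $ 2)) *\<^sub>R b + (y $ 1 * y $ 2) *\<^sub>R c"
      unfolding y(2) by (simp add: algebra_simps)
    moreover have "(1 - y $ 1) + (y $ 1 * (1 - y $ 2)) + (y $ 1 * y $ 2) = 1" by (simp add: algebra_simps)
    moreover have "0 < 1 - y $ 1" "0 < y $ 1 * (1 - y $ 2)" "0 < y $ 1 * y $ 2" using y' by auto
    ultimately show "v \<in> interior (convex hull {a, b, c})" unfolding I by blast
  qed
qed

lemma integral_triangle_polar:
  fixes F :: "real^2 \<Rightarrow> real"
  assumes abc: "\<not> collinear {a, b, c}" and F: "continuous_on UNIV F"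
  shows "integral (convex hull {a, b, c}) F = \<bar>cross2 (b - a) (c - a)\<bar> *
     integral {0..1} (\<lambda>t. integral {0..1} (\<lambda>s. s * F (a + s *\<^sub>R ((1 - t) *\<^sub>R (b - a) + t *\<^sub>R (c - a)))))"
proof -
  let ?K = "convex hull {a, b, c}"
  let ?g = "\<lambda>y::real^2. a + y $ 1 *\<^sub>R ((1 - y $ 2) *\<^sub>R (b - a) + y $ 2 *\<^sub>R (c - a))"
  let ?g' = "\<lambda>y h::real^2. h $ 1 *\<^sub>R ((1 - y $ 2) *\<^sub>R (b - a) + y $ 2 *\<^sub>R (c - a)) + (y $ 1 * h $ 2) *\<^sub>R (c - b)"
  let ?D = "cross2 (b - a) (c - a)"
  have D: "?D \<noteq> 0" by (rule cross2_collinear[OF abc])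
  have der: "(?g has_derivative ?g' y) (at y within box 0 1)" for y
    by (auto intro!: derivative_eq_intros bounded_linear.has_derivative[OF bounded_linear_vec_nth] simp: algebra_simps)
  have det: "det (matrix (?g' y)) = y $ 1 * ?D" for y
    by (simp add: det_2 matrix_def axis_def cross2_def) algebra
  have inj: "inj_on ?g (box 0 1)"
  proof (rule inj_onI)
    fix x y :: "real^2" assume x: "x \<in> box 0 1" and y: "y \<in> box 0 1" and eq: "?g x = ?g y"
    let ?u = "b - a" and ?v = "c - a"
    have x0: "x $ 1 > 0" using x by (auto simp: mem_box_cart forall_2)
    define p q where "p = x $ 1 * (1 - x $ 2) - y $ 1 * (1 - y $ 2)" and "q = x $ 1 * x $ 2 - y $ 1 * y $ 2"
    have "p *\<^sub>R ?u + q *\<^sub>R ?v = ?g x - ?g y" unfolding p_def q_def by (simp add: algebra_simps)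
    then have 0: "p *\<^sub>R ?u + q *\<^sub>R ?v = 0" using eq by simp
    have "p * ?u $ 1 + q * ?v $ 1 = 0" "p * ?u $ 2 + q * ?v $ 2 = 0"
      using arg_cong[OF 0, of "\<lambda>v. v $ 1"] arg_cong[OF 0, of "\<lambda>v. v $ 2"] by simp_all
    then have "p * ?D = 0" "q * ?D = 0" unfolding cross2_def by algebra+
    then have "p = 0" "q = 0" using D by auto
    then have "x $ 1 = y $ 1" "x $ 1 * x $ 2 = y $ 1 * y $ 2" by (auto simp: p_def q_def algebra_simps)
    then show "x = y" using x0 by (auto simp: vec_eq_iff forall_2)
  qed
  have img: "?g ` box 0 1 = interior ?K" by (rule interior_triangle[OF abc, symmetric])
  have gc: "continuous_on UNIV ?g" by (intro continuous_intros)
  let ?H = "\<lambda>y. \<bar>?D\<bar> * (y $ 1 * F (?g y))"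
  have Hc: "continuous_on UNIV ?H"
    by (intro continuous_intros continuous_on_compose2[OF F gc]) auto
  have compK: "compact ?K" by (simp add: compact_convex_hull)
  have "F absolutely_integrable_on ?K"
    by (rule set_integrable_continuous_compact) (use compK in \<open>auto intro: continuous_on_subset[OF F]\<close>)
  then have Fint: "F absolutely_integrable_on interior ?K"
    by (rule set_integrable_subset) (auto simp: interior_subset)
  have neg: "negligible (?K - interior ?K)"
    by (rule negligible_subset[OF negligible_convex_frontier[of ?K]]) (auto simp: frontier_def closure_subset[THEN subsetD])
  have "integral ?K F = integral (interior ?K) F"
    by (rule integral_spike_set[symmetric]; rule negligible_subset[OF neg]) (use interior_subset in auto)
  also have "\<dots> = integral (?g ` box 0 1) F" by (simp only: img)
  also have "\<dots> = integral (box 0 1) (\<lambda>y. \<bar>det (matrix (?g' y))\<bar> * F (?g y))"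
    using integral_change_of_variables[OF _ der inj, of "\<lambda>x. vec (F x) :: real^1"] Fint
    unfolding img[symmetric] integral_on_1_eq absolutely_integrable_on_1_iff
    by (auto simp: vec_eq_iff)
  also have "\<dots> = integral (box 0 1) ?H"
    by (intro integral_cong) (simp add: det abs_mult mem_box_cart abs_of_pos)
  also have "\<dots> = integral (cbox 0 1) ?H"
    by (rule integral_open_interval)
  also have "\<dots> = integral {0..1} (\<lambda>t. integral {0..1} (\<lambda>s. ?H (vector [s, t])))"
    by (rule integral_unit_square[OF Hc])
  also have "\<dots> = \<bar>?D\<bar> * integral {0..1} (\<lambda>t. integral {0..1} (\<lambda>s. s * F (a + s *\<^sub>R ((1 - t) *\<^sub>R (b - a) + t *\<^sub>R (c - a)))))"
    by simp
  finally show ?thesis .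
qed

text \<open>In polar coordinates about \<open>a\<close> the integrand times the Jacobian \<open>s\<close> is the derivative of \<open>s\<^sup>2 F\<close> with
respect to \<open>s\<close>, so each ray contributes the value of \<open>F\<close> at its end. Apart from the factor, this is the
divergence theorem for the field \<open>F (x - a)\<close>.\<close>

lemma cone_divergence_theorem_param:
  fixes F :: "real^2 \<Rightarrow> real"
  assumes abc: "\<not> collinear {a, b, c}"
    and F: "\<And>x. (F has_derivative (\<lambda>h. h \<bullet> G x)) (at x)" and G: "continuous_on UNIV G"
  shows "integral (convex hull {a, b, c}) (\<lambda>x. 2 * F x + (x - a) \<bullet> G x)
       = \<bar>cross2 (b - a) (c - a)\<bar> * integral {0..1} (\<lambda>t. F (linepath b c t))"
proof -
  have Fc: "continuous_on UNIV F"
    using F by (meson continuous_at_imp_continuous_on has_derivative_continuous)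
  have c: "continuous_on UNIV (\<lambda>x. 2 * F x + (x - a) \<bullet> G x)"
    by (intro continuous_intros Fc G)
  have "integral {0..1} (\<lambda>s. s * (2 * F (a + s *\<^sub>R w) + (a + s *\<^sub>R w - a) \<bullet> G (a + s *\<^sub>R w))) = F (a + w)" for w
  proof -
    have "((\<lambda>s. s * (2 * F (a + s *\<^sub>R w) + (a + s *\<^sub>R w - a) \<bullet> G (a + s *\<^sub>R w)))
           has_integral 1\<^sup>2 * F (a + 1 *\<^sub>R w) - 0\<^sup>2 * F (a + 0 *\<^sub>R w)) {0..1}"
    proof (rule fundamental_theorem_of_calculus)
      fix s :: real
      have inner: "((\<lambda>s. a + s *\<^sub>R w) has_derivative (\<lambda>r. r *\<^sub>R w)) (at s within {0..1})"
        by (auto intro!: derivative_eq_intros)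
      have "((\<lambda>s. F (a + s *\<^sub>R w)) has_derivative (\<lambda>r. (r *\<^sub>R w) \<bullet> G (a + s *\<^sub>R w))) (at s within {0..1})"
        by (rule has_derivative_compose[OF inner F])
      then have "((\<lambda>s. F (a + s *\<^sub>R w)) has_real_derivative w \<bullet> G (a + s *\<^sub>R w)) (at s within {0..1})"
        unfolding has_field_derivative_def
        by (rule has_derivative_eq_rhs) (simp add: fun_eq_iff mult.commute)
      then show "((\<lambda>s. s\<^sup>2 * F (a + s *\<^sub>R w)) has_vector_derivative
          s * (2 * F (a + s *\<^sub>R w) + (a + s *\<^sub>R w - a) \<bullet> G (a + s *\<^sub>R w))) (at s within {0..1})"
        unfolding has_real_derivative_iff_has_vector_derivative[symmetric]
        by (auto intro!: derivative_eq_intros simp: power2_eq_square algebra_simps)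
    qed simp
    then show ?thesis by (simp add: integral_unique)
  qed
  moreover have "a + ((1 - t) *\<^sub>R (b - a) + t *\<^sub>R (c - a)) = linepath b c t" for t
    by (simp add: linepath_def algebra_simps)
  ultimately show ?thesis
    unfolding integral_triangle_polar[OF abc c] by simp
qed

section \<open>Edges and normals of the triangles of a mesh\<close>

lemma triangle_simplexE:
  fixes K :: "(real^2) set"
  assumes "2 simplex K"
  obtains a b c where "\<not> collinear {a, b, c}" "K = convex hull {a, b, c}"
proof -
  obtain C where C: "\<not> affine_dependent C" "int (card C) = 2 + 1" "K = convex hull C"
    using assms unfolding simplex_def by blast
  then have "card C = 3" by simp
  then obtain a b c where "C = {a, b, c}" "a \<noteq> b" "b \<noteq> c" "a \<noteq> c"
    by (auto simp: card_3_iff)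
  then show ?thesis using C that[of a b c] collinear_3_eq_affine_dependent[of a b c] by blast
qed

lemma edge_of_triangle_iff:
  fixes a b c :: "real^2"
  assumes "\<not> collinear {a, b, c}"
  shows "e edge_of (convex hull {a, b, c}) \<longleftrightarrow>
         e = closed_segment b c \<or> e = closed_segment c a \<or> e = closed_segment a b"
proof -
  have abc: "a \<noteq> b" "a \<noteq> c" "b \<noteq> c" "\<not> affine_dependent {a, b, c}"
    using assms by (auto simp: collinear_3_eq_affine_dependent)
  have dim: "aff_dim (convex hull C) = int (card C) - 1" if "C \<subseteq> {a, b, c}" for C
    using aff_dim_affine_independent[OF affine_independent_subset[OF abc(4) that]]
    by (simp add: aff_dim_convex_hull)
  have "e edge_of (convex hull {a, b, c}) \<longleftrightarrow> (\<exists>C. C \<subseteq> {a, b, c} \<and> e = convex hull C \<and> aff_dim e = 1)"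
    unfolding edge_of_def face_of_convex_hull_affine_independent[OF abc(4)] by blast
  also have "\<dots> \<longleftrightarrow> (\<exists>C. C \<subseteq> {a, b, c} \<and> e = convex hull C \<and> card C = 2)"
    using dim by (intro ex_cong1) auto
  also have "\<dots> \<longleftrightarrow> (\<exists>C\<in>{{b, c}, {c, a}, {a, b}}. e = convex hull C)"
  proof -
    have "C \<subseteq> {a, b, c} \<and> card C = 2 \<longleftrightarrow> C \<in> {{b, c}, {c, a}, {a, b}}" for C
      using abc(1-3) by (auto simp: card_2_iff)
    then show ?thesis by blast
  qed
  finally show ?thesis by (simp add: segment_convex_hull)
qed

lemma triangle_edgeE:
  fixes K e :: "(real^2) set"
  assumes "2 simplex K" "e edge_of K"
  obtains a b c where "\<not> collinear {a, b, c}" "K = convex hull {a, b, c}" "e = closed_segment b c"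
proof -
  obtain a b c where abc: "\<not> collinear {a, b, c}" "K = convex hull {a, b, c}"
    using triangle_simplexE[OF assms(1)] by blast
  have "{b, c, a} = {a, b, c}" "{c, a, b} = {a, b, c}" by auto
  then show ?thesis
    using assms(2) abc that[of a b c] that[of b c a] that[of c a b]
    unfolding abc(2) edge_of_triangle_iff[OF abc(1)] by auto
qed

lemma sum_triangle_edges:
  fixes a b c :: "real^2"
  assumes "\<not> collinear {a, b, c}"
  shows "(\<Sum>e | e edge_of (convex hull {a, b, c}). F e)
       = F (closed_segment b c) + F (closed_segment c a) + F (closed_segment a b)"
proof -
  have abc: "a \<noteq> b" "a \<noteq> c" "b \<noteq> c"
    using assms by (auto simp: collinear_3_eq_affine_dependent)
  have "{e. e edge_of (convex hull {a, b, c})} = {closed_segment b c, closed_segment c a, closed_segment a b}"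
    using edge_of_triangle_iff[OF assms] by auto
  then show ?thesis using abc by (simp add: doubleton_eq_iff add.assoc)
qed

lemma finite_edges_of_triangle: "2 simplex K \<Longrightarrow> finite {e. e edge_of (K :: (real^2) set)}"
proof -
  assume "2 simplex K"
  then have "polytope K" by (meson simplex_imp_polytope)
  then show ?thesis
    by (intro finite_subset[OF _ finite_polytope_faces[of K]]) (auto simp: edge_of_def)
qed

text \<open>In the plane the conditions leave only \<open>m = n\<close> and \<open>m = - n\<close>; the latter would make \<open>n\<close> orthogonal to
two independent edges.\<close>

lemma outward_normal_unique:
  fixes a b c m n :: "real^2"
  assumes abc: "\<not> collinear {a, b, c}"
    and n: "norm n = 1" "n \<bullet> (c - b) = 0" "n \<bullet> (b - a) \<ge> 0"
    and m: "norm m = 1" "m \<bullet> (c - b) = 0" "m \<bullet> (b - a) \<ge> 0"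
  shows "n = m"
proof -
  have D: "cross2 (b - a) (c - a) \<noteq> 0" by (rule cross2_collinear[OF abc])
  have n1: "n $ 1 * n $ 1 + n $ 2 * n $ 2 = 1" and m1: "m $ 1 * m $ 1 + m $ 2 * m $ 2 = 1"
    using n(1) m(1) by (auto simp: norm_eq_1 inner_2)
  have "c - b \<noteq> 0" using abc by (auto simp: collinear_3_eq_affine_dependent)
  have "(n $ 1 * m $ 2 - n $ 2 * m $ 1) * (c - b) $ 1 = 0" "(n $ 1 * m $ 2 - n $ 2 * m $ 1) * (c - b) $ 2 = 0"
    using n(2) m(2) unfolding inner_2 by algebra+
  then have cr: "n $ 1 * m $ 2 - n $ 2 * m $ 1 = 0"
    using \<open>c - b \<noteq> 0\<close> by (auto simp: vec_eq_iff forall_2)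
  then have "(n \<bullet> m)\<^sup>2 = 1" using n1 m1 unfolding inner_2 by algebra
  then consider "n \<bullet> m = 1" | "n \<bullet> m = -1" by (auto simp: power2_eq_1_iff)
  then show ?thesis
  proof cases
    case 1
    then have "(norm (n - m))\<^sup>2 = 0"
      using n1 m1 by (simp add: power2_norm_eq_inner inner_2 algebra_simps)
    then show ?thesis by simp
  next
    case 2
    then have "(norm (n + m))\<^sup>2 = 0"
      using n1 m1 by (simp add: power2_norm_eq_inner inner_2 algebra_simps)
    then have nm: "n = - m" by (simp add: eq_neg_iff_add_eq_0)
    then have "n \<bullet> (b - a) = 0" using n(3) m(3) by simp
    with n(2) have "n $ 1 * cross2 (b - a) (c - a) = 0" "n $ 2 * cross2 (b - a) (c - a) = 0"
      unfolding inner_2 cross2_def vector_minus_component by algebra+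
    then have "n = 0" using D by (simp add: vec_eq_iff forall_2)
    then show ?thesis using n(1) by simp
  qed
qed

lemma outward_normal_exists:
  fixes a b c :: "real^2"
  assumes abc: "\<not> collinear {a, b, c}"
  shows "\<exists>n. norm n = 1 \<and> n \<bullet> (c - b) = 0 \<and> n \<bullet> (b - a) = \<bar>cross2 (b - a) (c - a)\<bar> / dist b c"
proof -
  let ?D = "cross2 (b - a) (c - a)" and ?w = "c - b"
  \<comment> \<open>the edge vector rotated by a right angle\<close>
  define r :: "real^2" where "r = vector [?w $ 2, - ?w $ 1]"
  have "?w \<noteq> 0" using abc by (auto simp: collinear_3_eq_affine_dependent)
  have D: "?D \<noteq> 0" by (rule cross2_collinear[OF abc])
  have nr: "norm r = dist b c"
    by (simp add: r_def dist_norm norm_minus_commute[of b c] norm_eq_sqrt_inner inner_2 add.commute)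
       (simp add: algebra_simps)
  have rw: "r \<bullet> ?w = 0" by (simp add: r_def inner_2 algebra_simps)
  have rD: "r \<bullet> (b - a) = ?D" by (simp add: r_def inner_2 cross2_def algebra_simps)
  define n where "n = (sgn ?D / dist b c) *\<^sub>R r"
  have "dist b c > 0" using \<open>?w \<noteq> 0\<close> by simp
  then have "norm n = 1" using D by (simp add: n_def nr abs_sgn_eq)
  moreover have "n \<bullet> ?w = 0" using rw by (simp add: n_def)
  moreover have "n \<bullet> (b - a) = \<bar>?D\<bar> / dist b c" by (simp add: n_def rD sgn_mult_self_eq abs_sgn[of ?D] mult.commute)
  ultimately show ?thesis by blast
qed

lemma outward_normal_eqI:
  fixes a b c n :: "real^2"
  assumes abc: "\<not> collinear {a, b, c}"
    and n: "norm n = 1" "n \<bullet> (c - b) = 0" "n \<bullet> (b - a) \<ge> 0"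
  shows "outward_normal (convex hull {a, b, c}) (closed_segment b c) = n"
  unfolding outward_normal_def
proof (rule the_equality)
  have "n \<bullet> (y - x) \<le> 0" if x: "x \<in> closed_segment b c" and y: "y \<in> convex hull {a, b, c}" for x y
  proof -
    obtain t where t: "x = (1 - t) *\<^sub>R b + t *\<^sub>R c" using x by (auto simp: in_segment)
    obtain u v w where y': "0 \<le> u" "u + v + w = 1" "y = u *\<^sub>R a + v *\<^sub>R b + w *\<^sub>R c"
      using y unfolding convex_hull_3 by blast
    have v: "v = 1 - u - w" using y'(2) by simp
    have "y - x = (w - t) *\<^sub>R (c - b) - u *\<^sub>R (b - a)"
      unfolding y'(3) t v by (simp add: algebra_simps)
    then have "n \<bullet> (y - x) = - u * (n \<bullet> (b - a))"
      using n(2) by (simp add: inner_diff_right[of n "_ *\<^sub>R _"])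
    then show ?thesis using y'(1) n(3) by simp
  qed
  then show "norm n = 1 \<and> (\<forall>x\<in>closed_segment b c. \<forall>y\<in>convex hull {a, b, c}. n \<bullet> (y - x) \<le> 0)"
    using n(1) by blast
next
  fix m assume m: "norm m = 1 \<and> (\<forall>x\<in>closed_segment b c. \<forall>y\<in>convex hull {a, b, c}. m \<bullet> (y - x) \<le> 0)"
  have in_hull: "a \<in> convex hull {a, b, c}" "b \<in> convex hull {a, b, c}" "c \<in> convex hull {a, b, c}"
    by (auto intro: hull_inc)
  have "m \<bullet> (c - b) \<le> 0" "m \<bullet> (b - c) \<le> 0" "m \<bullet> (a - b) \<le> 0" using m in_hull by auto
  then have "m \<bullet> (c - b) = 0" "m \<bullet> (b - a) \<ge> 0"
    by (auto simp: inner_diff_right)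
  then show "m = n" using outward_normal_unique[OF abc _ _ _ n] m by blast
qed

text \<open>The third equation identifies the inner product as the height over the edge: twice the area divided by
the length of the base.\<close>

lemma outward_normal:
  fixes a b c :: "real^2"
  assumes abc: "\<not> collinear {a, b, c}"
  defines "n \<equiv> outward_normal (convex hull {a, b, c}) (closed_segment b c)"
  shows "norm n = 1" "n \<bullet> (c - b) = 0" "n \<bullet> (b - a) = \<bar>cross2 (b - a) (c - a)\<bar> / dist b c"
    "n \<bullet> (b - a) > 0"
proof -
  obtain m where m: "norm m = 1" "m \<bullet> (c - b) = 0" "m \<bullet> (b - a) = \<bar>cross2 (b - a) (c - a)\<bar> / dist b c"
    using outward_normal_exists[OF abc] by blast
  have "n = m" unfolding n_def by (rule outward_normal_eqI[OF abc m(1,2)]) (simp add: m(3))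
  with m show "norm n = 1" "n \<bullet> (c - b) = 0" and *: "n \<bullet> (b - a) = \<bar>cross2 (b - a) (c - a)\<bar> / dist b c"
    by auto
  have "b \<noteq> c" using abc by (auto simp: collinear_3_eq_affine_dependent)
  then show "n \<bullet> (b - a) > 0"
    unfolding * using cross2_collinear[OF abc] by simp
qed

text \<open>The barycentric coordinates of \<open>x\<close> are the ratios of signed areas of the triangles that \<open>x\<close> forms with
the edges.\<close>

lemma barycentric_coordinates:
  fixes a b c x :: "real^2"
  assumes "\<not> collinear {a, b, c}"
  defines "D \<equiv> cross2 (b - a) (c - a)"
  shows "cross2 (b - x) (c - x) / D + cross2 (c - x) (a - x) / D + cross2 (a - x) (b - x) / D = 1"
    and "(cross2 (b - x) (c - x) / D) *\<^sub>R a + (cross2 (c - x) (a - x) / D) *\<^sub>R b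
       + (cross2 (a - x) (b - x) / D) *\<^sub>R c = x"
proof -
  have D: "D \<noteq> 0" using cross2_collinear assms by auto
  let ?p = "cross2 (b - x) (c - x)" and ?q = "cross2 (c - x) (a - x)" and ?r = "cross2 (a - x) (b - x)"
  have s: "?p + ?q + ?r = D"
    unfolding D_def cross2_def by (simp add: algebra_simps)
  then show "?p / D + ?q / D + ?r / D = 1"
    using D by (simp add: add_divide_distrib[symmetric])
  have "?p * a $ i + ?q * b $ i + ?r * c $ i = D * x $ i" for i
    using exhaust_2[of i] unfolding D_def cross2_def by (auto simp: algebra_simps)
  then have "(?p / D) * a $ i + (?q / D) * b $ i + (?r / D) * c $ i = x $ i" for i
    using D by (simp add: field_simps)
  then show "(?p / D) *\<^sub>R a + (?q / D) *\<^sub>R b + (?r / D) *\<^sub>R c = x"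
    by (simp add: vec_eq_iff)
qed

lemma face_of_triangle_containing_edge:
  fixes a b c :: "real^2"
  assumes abc: "\<not> collinear {a, b, c}" and F: "F face_of (convex hull {a, b, c})" and bc: "b \<in> F" "c \<in> F"
  shows "F = closed_segment b c \<or> F = convex hull {a, b, c}"
proof -
  have aff: "\<not> affine_dependent {a, b, c}"
    using abc by (auto simp: collinear_3_eq_affine_dependent)
  obtain C where C: "C \<subseteq> {a, b, c}" "F = convex hull C"
    using F unfolding face_of_convex_hull_affine_independent[OF aff] by blast
  have "b \<in> C"
  proof (rule ccontr)
    assume "b \<notin> C"
    then have "F \<subseteq> closed_segment a c"
      unfolding C(2) segment_convex_hull using C(1) by (intro hull_mono) auto
    then obtain t where "b = (1 - t) *\<^sub>R a + t *\<^sub>R c" using bc(1) in_segment(1)[of b a c] by blast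
    then have "b = (1 - t) *\<^sub>R a + (1 - (1 - t)) *\<^sub>R c" by simp
    then show False using abc unfolding collinear_3_expand by blast
  qed
  moreover have "c \<in> C"
  proof (rule ccontr)
    assume "c \<notin> C"
    then have "F \<subseteq> closed_segment a b"
      unfolding C(2) segment_convex_hull using C(1) by (intro hull_mono) auto
    then obtain t where "c = (1 - t) *\<^sub>R a + t *\<^sub>R b" using bc(2) in_segment(1)[of c a b] by blast
    then have "c = (1 - t) *\<^sub>R a + (1 - (1 - t)) *\<^sub>R b" by simp
    then have "collinear {a, c, b}" unfolding collinear_3_expand by blast
    then show False using abc by (simp add: insert_commute)
  qed
  ultimately have "C = {b, c} \<or> C = {a, b, c}" using C(1) by blast
  then show ?thesis unfolding C(2) segment_convex_hull by blast
qed

text \<open>If \<open>a'\<close> lay on the same side of the common edge as \<open>a\<close>, then moving the midpoint of the edge slightly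
towards \<open>a'\<close> would give a point of both triangles that is not on the edge.\<close>

lemma triangles_on_opposite_sides:
  fixes a a' b c n :: "real^2"
  assumes abc: "\<not> collinear {a, b, c}"
    and meet: "convex hull {a, b, c} \<inter> convex hull {a', b, c} = closed_segment b c"
    and n: "n \<bullet> (c - b) = 0" "n \<bullet> (b - a) > 0"
  shows "n \<bullet> (b - a') \<le> 0"
proof (rule ccontr)
  assume pos: "\<not> n \<bullet> (b - a') \<le> 0"
  define D where "D = cross2 (b - a) (c - a)"
  define \<alpha> \<beta> \<gamma> where "\<alpha> = cross2 (b - a') (c - a') / D" and "\<beta> = cross2 (c - a') (a - a') / D"
    and "\<gamma> = cross2 (a - a') (b - a') / D"
  have s: "\<alpha> + \<beta> + \<gamma> = 1" and a': "\<alpha> *\<^sub>R a + \<beta> *\<^sub>R b + \<gamma> *\<^sub>R c = a'"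
    using barycentric_coordinates[OF abc, of a'] by (simp_all add: \<alpha>_def \<beta>_def \<gamma>_def D_def)
  have \<beta>: "\<beta> = 1 - \<alpha> - \<gamma>" using s by simp
  have "b - a' = \<alpha> *\<^sub>R (b - a) - \<gamma> *\<^sub>R (c - b)"
    unfolding a'[symmetric] \<beta> by (simp add: algebra_simps)
  then have na': "n \<bullet> (b - a') = \<alpha> * (n \<bullet> (b - a))"
    using n(1) by (simp add: inner_diff_right[of n "_ *\<^sub>R _"])
  then have "\<alpha> > 0" using pos n(2) by (simp add: not_le zero_less_mult_iff)
  \<comment> \<open>so small that the coordinates of \<open>x\<close> belonging to \<open>b\<close> and \<open>c\<close> stay nonnegative\<close>
  define \<epsilon> where "\<epsilon> = 1 / (1 + 2 * \<bar>\<beta>\<bar> + 2 * \<bar>\<gamma>\<bar>)"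
  have \<epsilon>: "0 < \<epsilon>" "\<epsilon> \<le> 1" "\<epsilon> * (1 + 2 * \<bar>\<beta>\<bar> + 2 * \<bar>\<gamma>\<bar>) = 1"
    by (auto simp: \<epsilon>_def add_pos_nonneg)
  define x where "x = \<epsilon> *\<^sub>R a' + ((1 - \<epsilon>) / 2) *\<^sub>R b + ((1 - \<epsilon>) / 2) *\<^sub>R c"
  have "x \<in> convex hull {a', b, c}"
    unfolding convex_hull_3 x_def using \<epsilon>
    by (intro CollectI exI[of _ \<epsilon>] exI[of _ "(1 - \<epsilon>) / 2"]) auto
  moreover have "x \<in> convex hull {a, b, c}"
  proof -
    have 1: "x = (\<epsilon> * \<alpha>) *\<^sub>R a + ((1 - \<epsilon>) / 2 + \<epsilon> * \<beta>) *\<^sub>R b + ((1 - \<epsilon>) / 2 + \<epsilon> * \<gamma>) *\<^sub>R c"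
      unfolding x_def a'[symmetric] by (simp add: algebra_simps)
    have 2: "\<epsilon> * \<alpha> + ((1 - \<epsilon>) / 2 + \<epsilon> * \<beta>) + ((1 - \<epsilon>) / 2 + \<epsilon> * \<gamma>) = 1"
      unfolding \<beta> by (simp add: field_simps)
    have 3: "0 \<le> \<epsilon> * \<alpha>" using \<epsilon> \<open>\<alpha> > 0\<close> by simp
    have abs: "- (\<epsilon> * z) \<le> \<epsilon> * \<bar>z\<bar>" "0 \<le> \<epsilon> * \<bar>z\<bar>" for z
      using \<epsilon>(1) by (auto simp: abs_if)
    have half: "(1 - \<epsilon>) / 2 = \<epsilon> * \<bar>\<beta>\<bar> + \<epsilon> * \<bar>\<gamma>\<bar>"
      using \<epsilon>(3) by (simp add: algebra_simps)
    have 4: "0 \<le> (1 - \<epsilon>) / 2 + \<epsilon> * \<beta>" "0 \<le> (1 - \<epsilon>) / 2 + \<epsilon> * \<gamma>"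
      unfolding half using abs[of \<beta>] abs[of \<gamma>] by linarith+
    show ?thesis unfolding convex_hull_3 using 1 2 3 4 by blast
  qed
  ultimately have "x \<in> closed_segment b c" using meet by blast
  then obtain t where t: "x = (1 - t) *\<^sub>R b + t *\<^sub>R c" by (auto simp: in_segment)
  have "b - x = - t *\<^sub>R (c - b)" unfolding t by (simp add: algebra_simps)
  then have "n \<bullet> (b - x) = 0" using n(1) by simp
  moreover have "b - x = \<epsilon> *\<^sub>R (b - a') - ((1 - \<epsilon>) / 2) *\<^sub>R (c - b)"
  proof -
    have "b = \<epsilon> *\<^sub>R b + ((1 - \<epsilon>) / 2) *\<^sub>R b + ((1 - \<epsilon>) / 2) *\<^sub>R b"
      unfolding scaleR_add_left[symmetric] by simp
    then have "b - x = \<epsilon> *\<^sub>R b + ((1 - \<epsilon>) / 2) *\<^sub>R b + ((1 - \<epsilon>) / 2) *\<^sub>R b - x" by simp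
    then show ?thesis unfolding x_def by (simp add: algebra_simps)
  qed
  ultimately have "\<epsilon> * (n \<bullet> (b - a')) = 0"
    using n(1) by (simp add: inner_diff_right[of n "_ *\<^sub>R _"])
  then show False using \<epsilon>(1) pos by simp
qed

lemma neighbours_have_opposite_normals:
  fixes K K' :: "(real^2) set"
  assumes K: "2 simplex K" "2 simplex K'" "e edge_of K" "e edge_of K'" "K \<noteq> K'"
    and face: "(K \<inter> K') face_of K" "(K \<inter> K') face_of K'"
  shows "outward_normal K' e = - outward_normal K e"
proof -
  obtain a b c where abc: "\<not> collinear {a, b, c}" "K = convex hull {a, b, c}" "e = closed_segment b c"
    using triangle_edgeE[OF K(1,3)] by blast
  obtain a' b' c' where abc': "\<not> collinear {a', b', c'}" "K' = convex hull {a', b', c'}" "e = closed_segment b' c'"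
    using triangle_edgeE[OF K(2,4)] by blast
  have "{b', c'} = {b, c}" using abc(3) abc'(3) by simp
  then have eq: "{a', b', c'} = {a', b, c}" by auto
  have tri': "\<not> collinear {a', b, c}" "K' = convex hull {a', b, c}"
    using abc' unfolding eq by auto
  have bc: "b \<in> K \<inter> K'" "c \<in> K \<inter> K'"
    unfolding abc(2) tri'(2) by (auto intro: hull_inc)
  have meet: "K \<inter> K' = closed_segment b c"
    using face_of_triangle_containing_edge[OF abc(1) face(1)[unfolded abc(2)]]
      face_of_triangle_containing_edge[OF tri'(1) face(2)[unfolded tri'(2)]] bc K(5)
    unfolding abc(2) tri'(2) by blast
  let ?n = "outward_normal K e"
  have n: "norm ?n = 1" "?n \<bullet> (c - b) = 0" "?n \<bullet> (b - a) > 0"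
    using outward_normal[OF abc(1)] unfolding abc(2,3) by auto
  have "?n \<bullet> (b - a') \<le> 0"
    using triangles_on_opposite_sides[OF abc(1) _ n(2,3)] meet unfolding abc(2) tri'(2) by blast
  then show ?thesis
    unfolding tri'(2) abc(3) using n by (intro outward_normal_eqI[OF tri'(1)]) (auto simp: abc(2,3))
qed

lemma triangle_face_eq:
  fixes K K' :: "(real^2) set"
  assumes "2 simplex K" "2 simplex K'" "K face_of K'"
  shows "K = K'"
proof (rule ccontr)
  assume "K \<noteq> K'"
  then have "aff_dim K < aff_dim K'"
    using assms by (intro face_of_aff_dim_lt) (auto simp: polytope_imp_convex simplex_imp_polytope)
  then show False using aff_dim_simplex[OF assms(1)] aff_dim_simplex[OF assms(2)] by simp
qed

context
  fixes T :: "(real^2) set set" and \<Omega> :: "(real^2) set"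
  assumes T: "triangulation_of T \<Omega>"
begin

lemma mesh_simplex: "K \<in> T \<Longrightarrow> 2 simplex K"
  using T by (simp add: triangulation_of_def)

lemma finite_mesh: "finite T"
  using T by (simp add: triangulation_of_def triangulation_def)

lemma mesh_Union: "\<Union>T = closure \<Omega>"
  using T by (simp add: triangulation_of_def)

lemma mesh_face: "K \<in> T \<Longrightarrow> K' \<in> T \<Longrightarrow> (K \<inter> K') face_of K"
  using T unfolding triangulation_of_def triangulation_def by blast

lemma mesh_face': "K \<in> T \<Longrightarrow> K' \<in> T \<Longrightarrow> (K \<inter> K') face_of K'"
  using mesh_face[of K' K] by (simp add: Int_commute)

lemma mesh_interiors_disjoint:
  assumes "K \<in> T" "K' \<in> T" "K \<noteq> K'"
  shows "interior K \<inter> K' = {}"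
proof -
  have "K \<inter> K' \<noteq> K"
    using mesh_face'[OF assms(1,2)] triangle_face_eq mesh_simplex assms by metis
  then show ?thesis
    using face_of_disjoint_interior[OF mesh_face[OF assms(1,2)]] interior_subset by blast
qed

text \<open>Some relative interior point \<open>x\<close> of the edge lies in the open set \<open>\<Omega>\<close>. It is not interior to \<open>K\<close>, so
another triangle must contain it. By conformity the two triangles meet in a face of \<open>K\<close>, and a face that
contains \<open>x\<close> contains the whole edge.\<close>

lemma interior_edge_neighbour:
  assumes poly: "polygonal_domain \<Omega>" and K: "K \<in> T" "e edge_of K" and e: "\<not> e \<subseteq> frontier \<Omega>"
  shows "\<exists>K'\<in>T. K' \<noteq> K \<and> e edge_of K'"
proof -
  have op: "open \<Omega>" using poly by (simp add: polygonal_domain_def)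
  obtain a b c where abc: "\<not> collinear {a, b, c}" "K = convex hull {a, b, c}" "e = closed_segment b c"
    using triangle_edgeE[OF mesh_simplex[OF K(1)] K(2)] by blast
  have "b \<noteq> c" using abc(1) by (auto simp: collinear_3_eq_affine_dependent)
  have "\<not> open_segment b c \<subseteq> frontier \<Omega>"
  proof
    assume "open_segment b c \<subseteq> frontier \<Omega>"
    then have "closure (open_segment b c) \<subseteq> frontier \<Omega>"
      by (rule closure_minimal) simp
    then show False using e abc(3) \<open>b \<noteq> c\<close> by simp
  qed
  then obtain x where x: "x \<in> open_segment b c" "x \<notin> frontier \<Omega>" by blast
  have bcK: "b \<in> K" "c \<in> K" unfolding abc(2) by (auto intro: hull_inc)
  have "x \<in> e" using x(1) abc(3) open_closed_segment by blast
  have eK: "e \<subseteq> K" "e face_of K" "e \<noteq> K"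
  proof -
    show "e \<subseteq> K" using K(2) by (rule edge_of_imp_subset)
    show "e face_of K" using K(2) by (simp add: edge_of_def)
    show "e \<noteq> K" using K(2) aff_dim_simplex[OF mesh_simplex[OF K(1)]] by (auto simp: edge_of_def)
  qed
  have "x \<notin> interior K"
    using face_of_disjoint_interior[OF eK(2,3)] \<open>x \<in> e\<close> by blast
  have "x \<in> closure \<Omega>" using \<open>x \<in> e\<close> eK(1) K(1) mesh_Union by blast
  then have "x \<in> \<Omega>" using x(2) op by (auto simp: frontier_def interior_open)
  have "\<exists>K'\<in>T - {K}. x \<in> K'"
  proof (rule ccontr)
    assume none: "\<not> (\<exists>K'\<in>T - {K}. x \<in> K')"
    have "closed (\<Union>(T - {K}))"
      using finite_mesh mesh_simplex by (intro closed_Union) (auto intro: compact_simplex compact_imp_closed)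
    then have "open (\<Omega> - \<Union>(T - {K}))" using op by (simp add: open_Diff)
    moreover have "\<Omega> - \<Union>(T - {K}) \<subseteq> K"
      using mesh_Union closure_subset[of \<Omega>] by blast
    ultimately have "x \<in> interior K"
      using none \<open>x \<in> \<Omega>\<close> by (intro interiorI[of "\<Omega> - \<Union>(T - {K})"]) auto
    then show False using \<open>x \<notin> interior K\<close> by simp
  qed
  then obtain K' where K': "K' \<in> T" "K' \<noteq> K" "x \<in> K'" by blast
  have "x \<in> K \<inter> K'" using K'(3) \<open>x \<in> e\<close> eK(1) by blast
  then have bcF: "b \<in> K \<inter> K'" "c \<in> K \<inter> K'"
    using face_ofD[OF mesh_face[OF K(1) K'(1)] x(1)] bcK by auto
  then have "K \<inter> K' = e \<or> K \<inter> K' = K"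
    using face_of_triangle_containing_edge[OF abc(1) mesh_face[OF K(1) K'(1), unfolded abc(2)]]
    unfolding abc(2,3) by blast
  moreover have "K \<inter> K' \<noteq> K"
    using mesh_face'[OF K(1) K'(1)] triangle_face_eq mesh_simplex K(1) K'(1,2) by metis
  ultimately have "K \<inter> K' = e" by blast
  then have "e edge_of K'"
    using mesh_face'[OF K(1) K'(1)] K(2) by (simp add: edge_of_def)
  then show ?thesis using K' by blast
qed

text \<open>The normals of any two triangles at a common edge are opposite. For three triangles this is impossible,
as a normal is not its own opposite.\<close>

lemma interior_edge_two_triangles:
  assumes poly: "polygonal_domain \<Omega>" and e: "e \<in> edges T" "\<not> e \<subseteq> frontier \<Omega>"
  shows "\<exists>K1 K2. K1 \<noteq> K2 \<and> {K\<in>T. e edge_of K} = {K1, K2} \<and> outward_normal K2 e = - outward_normal K1 e"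
proof -
  have opp: "outward_normal K' e = - outward_normal K e"
    if "K \<in> T" "K' \<in> T" "e edge_of K" "e edge_of K'" "K \<noteq> K'" for K K'
    using that by (intro neighbours_have_opposite_normals) (auto simp: mesh_simplex mesh_face mesh_face')
  obtain K1 where K1: "K1 \<in> T" "e edge_of K1" using e(1) by (auto simp: edges_def)
  obtain K2 where K2: "K2 \<in> T" "K2 \<noteq> K1" "e edge_of K2"
    using interior_edge_neighbour[OF poly K1 e(2)] by blast
  have ne: "outward_normal K1 e \<noteq> 0"
  proof -
    obtain a b c where "\<not> collinear {a, b, c}" "K1 = convex hull {a, b, c}" "e = closed_segment b c"
      using triangle_edgeE[OF mesh_simplex[OF K1(1)] K1(2)] by blast
    then show ?thesis using outward_normal(1)[of a b c] by auto
  qed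
  have "K = K1 \<or> K = K2" if "K \<in> T" "e edge_of K" for K
  proof (rule ccontr)
    assume "\<not> (K = K1 \<or> K = K2)"
    then have "outward_normal K e = - outward_normal K1 e" "outward_normal K e = - outward_normal K2 e"
      "outward_normal K2 e = - outward_normal K1 e"
      using opp[of K1 K] opp[of K2 K] opp[of K1 K2] K1 K2 that by auto
    then have "2 *\<^sub>R outward_normal K1 e = 0" by (simp add: scaleR_2)
    then show False using ne by simp
  qed
  then have "{K\<in>T. e edge_of K} = {K1, K2}" using K1 K2 by blast
  then show ?thesis using opp[of K1 K2] K1 K2 by blast
qed

end

section \<open>Integrals over edges\<close>

text \<open>The choice in \<^const>\<open>edge_integral\<close> fixes the endpoints only up to their order.\<close>

lemma edge_integral_parametrization:
  fixes b c :: "real^2"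
  obtains b' c' where "{b', c'} = {b, c}"
    and "\<And>g. edge_integral (closed_segment b c) g = dist b c * (LINT t:{0..1}|lebesgue. g (linepath b' c' t))"
proof -
  let ?P = "\<lambda>(x, y). closed_segment b c = closed_segment x (y::real^2)"
  obtain b' c' where bc: "Eps ?P = (b', c')" by (cases "Eps ?P")
  have "?P (Eps ?P)" by (rule someI[of ?P "(b, c)"]) simp
  then have "closed_segment b c = closed_segment b' c'" using bc by simp
  then have eq: "{b', c'} = {b, c}" by auto
  then have "dist b' c' = dist b c" by (auto simp: doubleton_eq_iff dist_commute)
  then have "edge_integral (closed_segment b c) g = dist b c * (LINT t:{0..1}|lebesgue. g (linepath b' c' t))" for g
    unfolding edge_integral_def bc by simp
  with eq show ?thesis by (rule that)
qed

lemma linepath_integral: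
  fixes g :: "real^2 \<Rightarrow> real"
  assumes "continuous_on (closed_segment b c) g"
  shows "set_integrable lebesgue {0..1} (\<lambda>t. g (linepath b c t))"
    and "(LINT t:{0..1}|lebesgue. g (linepath b c t)) = integral {0..1} (\<lambda>t. g (linepath b c t))"
    and "(\<lambda>t. g (linepath b c t)) integrable_on {0..1}"
    and "continuous_on {0..1} (\<lambda>t. g (linepath b c t))"
proof -
  show c: "continuous_on {0..1} (\<lambda>t. g (linepath b c t))"
    by (rule continuous_on_compose2[OF assms continuous_on_linepath]) (auto simp: linepath_image_01[symmetric])
  show 1: "set_integrable lebesgue {0..1} (\<lambda>t. g (linepath b c t))"
    by (rule set_integrable_continuous_compact[OF _ c]) simp
  show "(LINT t:{0..1}|lebesgue. g (linepath b c t)) = integral {0..1} (\<lambda>t. g (linepath b c t))"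
    by (rule set_lebesgue_integral_eq_integral(2)[OF 1])
  show "(\<lambda>t. g (linepath b c t)) integrable_on {0..1}"
    by (rule set_lebesgue_integral_eq_integral(1)[OF 1])
qed

lemma edge_integral_cong:
  assumes "\<And>x. x \<in> closed_segment b c \<Longrightarrow> f x = g x"
  shows "edge_integral (closed_segment b c) f = edge_integral (closed_segment b c) g"
proof -
  obtain b' c' where bc: "{b', c'} = {b, c}"
    "\<And>g. edge_integral (closed_segment b c) g = dist b c * (LINT t:{0..1}|lebesgue. g (linepath b' c' t))"
    using edge_integral_parametrization by blast
  have seg: "closed_segment b' c' = closed_segment b c" using bc(1) by simp
  have "f (linepath b' c' t) = g (linepath b' c' t)" if "t \<in> {0..1}" for t
    by (rule assms[OF linepath_in_path[OF that, of b' c', unfolded seg]])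
  then have "(LINT t:{0..1}|lebesgue. f (linepath b' c' t)) = (LINT t:{0..1}|lebesgue. g (linepath b' c' t))"
    by (intro set_lebesgue_integral_cong) auto
  then show ?thesis by (simp add: bc(2))
qed

lemma set_integral_scale: "(LINT x:S|M. k * f x) = k * (LINT x:S|M. f x :: real)"
proof -
  have "(LINT x:S|M. k * f x) = (LINT x|M. k * (indicator S x *\<^sub>R f x))"
    unfolding set_lebesgue_integral_def
    by (rule Bochner_Integration.integral_cong) (auto simp: mult.left_commute)
  also have "\<dots> = k * (LINT x:S|M. f x)"
    unfolding set_lebesgue_integral_def by (rule integral_mult_right_zero)
  finally show ?thesis .
qed

lemma edge_integral_scale:
  "edge_integral (closed_segment b c) (\<lambda>x. k * f x) = k * edge_integral (closed_segment b c) f"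
proof -
  obtain b' c' where bc: "{b', c'} = {b, c}"
    "\<And>g. edge_integral (closed_segment b c) g = dist b c * (LINT t:{0..1}|lebesgue. g (linepath b' c' t))"
    using edge_integral_parametrization by blast
  show ?thesis unfolding bc(2) set_integral_scale by (rule mult.left_commute)
qed

lemma edge_integral_add:
  assumes "continuous_on (closed_segment b c) f" "continuous_on (closed_segment b c) g"
  shows "edge_integral (closed_segment b c) (\<lambda>x. f x + g x)
       = edge_integral (closed_segment b c) f + edge_integral (closed_segment b c) g"
proof -
  obtain b' c' where bc: "{b', c'} = {b, c}"
    "\<And>g. edge_integral (closed_segment b c) g = dist b c * (LINT t:{0..1}|lebesgue. g (linepath b' c' t))"
    using edge_integral_parametrization by blast
  have "closed_segment b' c' = closed_segment b c" using bc(1) by simp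
  then have "set_integrable lebesgue {0..1} (\<lambda>t. f (linepath b' c' t))"
    "set_integrable lebesgue {0..1} (\<lambda>t. g (linepath b' c' t))"
    using assms linepath_integral(1) by metis+
  then show ?thesis by (simp add: bc(2) set_integral_add distrib_left)
qed

lemma edge_integral_nonneg:
  assumes "\<And>x. x \<in> closed_segment b c \<Longrightarrow> f x \<ge> 0"
  shows "edge_integral (closed_segment b c) f \<ge> 0"
proof -
  obtain b' c' where bc: "{b', c'} = {b, c}"
    "\<And>g. edge_integral (closed_segment b c) g = dist b c * (LINT t:{0..1}|lebesgue. g (linepath b' c' t))"
    using edge_integral_parametrization by blast
  have seg: "closed_segment b' c' = closed_segment b c" using bc(1) by simp
  have "f (linepath b' c' t) \<ge> 0" if "t \<in> {0..1}" for t
    by (rule assms[OF linepath_in_path[OF that, of b' c', unfolded seg]])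
  then have "(LINT t:{0..1}|lebesgue. f (linepath b' c' t)) \<ge> 0"
    unfolding set_lebesgue_integral_def by (intro Bochner_Integration.integral_nonneg) (auto simp: indicator_def)
  then show ?thesis by (simp add: bc(2))
qed

lemma edge_integral_eq_0_imp:
  assumes c: "continuous_on (closed_segment b c) f" and nn: "\<And>x. x \<in> closed_segment b c \<Longrightarrow> f x \<ge> 0"
    and 0: "edge_integral (closed_segment b c) f = 0" and "b \<noteq> c" and x: "x \<in> closed_segment b c"
  shows "f x = 0"
proof -
  obtain b' c' where bc: "{b', c'} = {b, c}"
    "\<And>g. edge_integral (closed_segment b c) g = dist b c * (LINT t:{0..1}|lebesgue. g (linepath b' c' t))"
    using edge_integral_parametrization by blast
  have seg: "closed_segment b' c' = closed_segment b c" using bc(1) by simp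
  have c': "continuous_on (closed_segment b' c') f" unfolding seg by (rule c)
  have "integral (cbox 0 1) (\<lambda>t. f (linepath b' c' t)) = 0"
    using 0 \<open>b \<noteq> c\<close> unfolding bc(2) linepath_integral(2)[OF c'] by simp
  moreover have "f (linepath b' c' t) \<ge> 0" if "t \<in> {0..1}" for t
    by (rule nn[OF linepath_in_path[OF that, of b' c', unfolded seg]])
  ultimately have "\<forall>t\<in>cbox 0 1. f (linepath b' c' t) = 0"
    using linepath_integral(4)[OF c'] by (subst (asm) integral_cbox_eq_0_iff) auto
  moreover have "x \<in> linepath b' c' ` {0..1}"
    unfolding linepath_image_01 seg by (rule x)
  then obtain t where "t \<in> {0..1}" "x = linepath b' c' t" by blast
  ultimately show ?thesis by simp
qed

text \<open>The factor is the height of the triangle over the edge. The left-hand side is symmetric in \<open>b\<close> and \<open>c\<close>,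
so it does not matter in which order \<^const>\<open>edge_integral\<close> takes the endpoints.\<close>

lemma cone_divergence_theorem:
  fixes F :: "real^2 \<Rightarrow> real"
  assumes abc: "\<not> collinear {a, b, c}"
    and F: "\<And>x. (F has_derivative (\<lambda>h. h \<bullet> G x)) (at x)" and G: "continuous_on UNIV G"
  shows "integral (convex hull {a, b, c}) (\<lambda>x. 2 * F x + (x - a) \<bullet> G x)
       = \<bar>cross2 (b - a) (c - a)\<bar> / dist b c * edge_integral (closed_segment b c) F"
proof -
  obtain b' c' where bc: "{b', c'} = {b, c}"
    "\<And>g. edge_integral (closed_segment b c) g = dist b c * (LINT t:{0..1}|lebesgue. g (linepath b' c' t))"
    using edge_integral_parametrization by blast
  have eq: "{a, b', c'} = {a, b, c}" using bc(1) by auto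
  have "b \<noteq> c" using abc by (auto simp: collinear_3_eq_affine_dependent)
  have "continuous_on (closed_segment b' c') F"
    using F by (meson continuous_at_imp_continuous_on has_derivative_continuous)
  then have e: "edge_integral (closed_segment b c) F = dist b c * integral {0..1} (\<lambda>t. F (linepath b' c' t))"
    unfolding bc(2) by (simp add: linepath_integral(2))
  have "\<bar>cross2 (b' - a) (c' - a)\<bar> = \<bar>cross2 (b - a) (c - a)\<bar>"
    using bc(1) by (auto simp: doubleton_eq_iff cross2_def abs_minus_commute algebra_simps)
  then show ?thesis
    using cone_divergence_theorem_param[of a b' c' F G, OF _ F G] abc \<open>b \<noteq> c\<close>
    unfolding eq e by simp
qed

section \<open>Integrals and square-integrable functions on triangles\<close>

lemma triangle_compact: "2 simplex K \<Longrightarrow> compact (K :: (real^2) set)"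
  by (rule compact_simplex)

lemma triangle_convex: "2 simplex K \<Longrightarrow> convex (K :: (real^2) set)"
  by (simp add: polytope_imp_convex simplex_imp_polytope)

lemma triangle_interior_nonempty:
  fixes K :: "(real^2) set"
  assumes "2 simplex K"
  shows "interior K \<noteq> {}"
proof -
  obtain a b c where abc: "\<not> collinear {a, b, c}" "K = convex hull {a, b, c}"
    using triangle_simplexE[OF assms] by blast
  have "vector [1/2, 1/2] \<in> box (0::real^2) 1" by (auto simp: mem_box_cart forall_2)
  then show ?thesis unfolding abc(2) interior_triangle[OF abc(1)] by blast
qed

lemma triangle_closure_interior:
  fixes K :: "(real^2) set"
  assumes "2 simplex K"
  shows "closure (interior K) = K"
  using convex_closure_interior[OF triangle_convex[OF assms] triangle_interior_nonempty[OF assms]]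
    triangle_compact[OF assms] by (simp add: compact_imp_closed)

lemma triangle_negligible_boundary:
  fixes K :: "(real^2) set"
  assumes "2 simplex K"
  shows "negligible (K - interior K)"
  by (rule negligible_subset[OF negligible_convex_frontier[OF triangle_convex[OF assms]]])
     (auto simp: frontier_def closure_subset[THEN subsetD])

lemma zero_on_triangle:
  fixes K :: "(real^2) set" and H :: "real^2 \<Rightarrow> 'b::real_normed_vector"
  assumes "2 simplex K" "continuous_on UNIV H" "\<And>x. x \<in> interior K \<Longrightarrow> H x = 0" "x \<in> K"
  shows "H x = 0"
proof -
  have "closure (interior K) \<subseteq> {x. H x = 0}"
    by (rule closure_minimal) (use assms in \<open>auto intro: closed_Collect_eq\<close>)
  then show ?thesis using triangle_closure_interior[OF assms(1)] assms(4) by blast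
qed

text \<open>The elements of the finite element spaces are polynomial only in the interior of a triangle; the
boundary is a null set and does not influence integrals.\<close>

lemma triangle_integral:
  fixes K :: "(real^2) set" and h H :: "real^2 \<Rightarrow> 'b::euclidean_space"
  assumes K: "2 simplex K" and H: "continuous_on UNIV H" and eq: "\<And>x. x \<in> interior K \<Longrightarrow> h x = H x"
  shows "set_integrable lebesgue K h" and "(LINT x:K|lebesgue. h x) = integral K H"
proof -
  have "set_integrable lebesgue K H"
    by (rule set_integrable_continuous_compact[OF triangle_compact[OF K] continuous_on_subset[OF H subset_UNIV]])
  then show 1: "set_integrable lebesgue K h"
    by (rule absolutely_integrable_spike[OF _ triangle_negligible_boundary[OF K]]) (use eq in auto)
  have "(LINT x:K|lebesgue. h x) = integral K h"
    by (rule set_lebesgue_integral_eq_integral(2)[OF 1])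
  also have "\<dots> = integral K H"
    by (rule integral_spike[OF triangle_negligible_boundary[OF K]]) (use eq in auto)
  finally show "(LINT x:K|lebesgue. h x) = integral K H" .
qed

lemma L2_inner_triangle:
  fixes K :: "(real^2) set"
  assumes "2 simplex K" "continuous_on UNIV F" "continuous_on UNIV G"
    "\<And>x. x \<in> interior K \<Longrightarrow> f x = F x" "\<And>x. x \<in> interior K \<Longrightarrow> g x = G x"
  shows "L2_inner K f g = integral K (\<lambda>x. F x \<bullet> G x)"
  unfolding L2_inner_def
  by (rule triangle_integral(2)[OF assms(1)]) (use assms in \<open>auto intro!: continuous_intros\<close>)

lemma integrable_on_triangle:
  fixes K :: "(real^2) set" and H :: "real^2 \<Rightarrow> 'b::euclidean_space"
  assumes "2 simplex K" "continuous_on UNIV H"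
  shows "H integrable_on K"
  using triangle_integral(1)[OF assms, of H] set_lebesgue_integral_eq_integral(1) by blast

lemma integral_zero_imp_zero_on_open:
  fixes h H :: "real^2 \<Rightarrow> real"
  assumes int: "h integrable_on S" and nn: "\<And>x. x \<in> S \<Longrightarrow> h x \<ge> 0" and 0: "integral S h = 0"
    and U: "open U" "U \<subseteq> S" and H: "continuous_on UNIV H" "\<And>x. x \<in> U \<Longrightarrow> h x = H x"
    and x: "x \<in> U"
  shows "H x = 0"
proof -
  obtain u v where uv: "cbox u v \<subseteq> U" "x \<in> box u v"
    using U(1) x by (metis open_contains_cbox)
  have hc: "continuous_on (cbox u v) h"
    using continuous_on_subset[OF H(1) subset_UNIV, of "cbox u v"] uv(1) H(2)
    by (subst continuous_on_cong[OF refl, of _ h H]) auto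
  then have int': "h integrable_on cbox u v" by (rule integrable_continuous)
  have nn': "h y \<ge> 0" if "y \<in> cbox u v" for y using that uv(1) U(2) nn by blast
  have "integral (cbox u v) h \<le> integral S h"
    by (rule integral_subset_le) (use uv(1) U(2) int int' nn in auto)
  moreover have "integral (cbox u v) h \<ge> 0"
    by (rule Henstock_Kurzweil_Integration.integral_nonneg[OF int' nn'])
  ultimately have "integral (cbox u v) h = 0" using 0 by simp
  then have "h x = 0"
    using uv(2) box_subset_cbox[of u v] by (subst (asm) integral_cbox_eq_0_iff[OF hc]) (use nn' in auto)
  then show ?thesis using H(2)[OF x] by simp
qed

lemma triangle_integral_zero_imp:
  fixes K :: "(real^2) set" and H :: "real^2 \<Rightarrow> real"
  assumes K: "2 simplex K" and H: "continuous_on UNIV H" and nn: "\<And>x. x \<in> K \<Longrightarrow> H x \<ge> 0"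
    and 0: "integral K H = 0" and x: "x \<in> K"
  shows "H x = 0"
  by (rule zero_on_triangle[OF K H _ x],
      rule integral_zero_imp_zero_on_open[OF integrable_on_triangle[OF K H] nn 0 open_interior interior_subset H])
     auto

lemma L2_iff:
  assumes "D \<in> sets lebesgue"
  shows "f \<in> L2 D \<longleftrightarrow> set_borel_measurable lebesgue D f \<and> set_integrable lebesgue D (\<lambda>x. (norm (f x))\<^sup>2)"
  using assms
  by (simp add: L2_def set_integrable_def set_borel_measurable_def integrable_restrict_space
      borel_measurable_restrict_space_iff)

lemma L2_I:
  fixes f :: "real^2 \<Rightarrow> 'a::euclidean_space"
  assumes "D \<in> sets lebesgue" "set_integrable lebesgue D f" "set_integrable lebesgue D (\<lambda>x. (norm (f x))\<^sup>2)"
  shows "f \<in> L2 D"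
  using assms unfolding L2_iff[OF assms(1)]
  by (auto simp: set_integrable_def set_borel_measurable_def dest: borel_measurable_integrable)

lemma L2_integrable_inner:
  fixes f g :: "real^2 \<Rightarrow> 'a::euclidean_space"
  assumes D: "D \<in> sets lebesgue" and f: "f \<in> L2 D" and g: "g \<in> L2 D"
  shows "set_integrable lebesgue D (\<lambda>x. f x \<bullet> g x)"
proof -
  have m: "f \<in> borel_measurable (lebesgue_on D)" "g \<in> borel_measurable (lebesgue_on D)"
    and i: "integrable (lebesgue_on D) (\<lambda>x. (norm (f x))\<^sup>2)" "integrable (lebesgue_on D) (\<lambda>x. (norm (g x))\<^sup>2)"
    using f g by (auto simp: L2_def)
  have "integrable (lebesgue_on D) (\<lambda>x. f x \<bullet> g x)"
  proof (rule Bochner_Integration.integrable_bound[OF Bochner_Integration.integrable_add[OF i]])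
    show "(\<lambda>x. f x \<bullet> g x) \<in> borel_measurable (lebesgue_on D)" using m by measurable
    have "\<bar>f x \<bullet> g x\<bar> \<le> (norm (f x))\<^sup>2 + (norm (g x))\<^sup>2" for x
    proof -
      have "\<bar>f x \<bullet> g x\<bar> \<le> norm (f x) * norm (g x)" by (rule Cauchy_Schwarz_ineq2)
      also have "\<dots> \<le> (norm (f x))\<^sup>2 + (norm (g x))\<^sup>2"
        using sum_squares_bound[of "norm (f x)" "norm (g x)"]
          mult_nonneg_nonneg[OF norm_ge_zero norm_ge_zero, of "f x" "g x"] by linarith
      finally show ?thesis .
    qed
    then show "AE x in lebesgue_on D. norm (f x \<bullet> g x) \<le> norm ((norm (f x))\<^sup>2 + (norm (g x))\<^sup>2)"
      by simp
  qed
  then show ?thesis using D by (simp add: set_integrable_def integrable_restrict_space)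
qed

lemma L2_inner_commute: "L2_inner D f g = L2_inner D g f"
  by (simp add: L2_inner_def inner_commute)

lemma L2_inner_add_left:
  assumes "D \<in> sets lebesgue" "f \<in> L2 D" "g \<in> L2 D" "h \<in> L2 D"
  shows "L2_inner D (\<lambda>x. f x + g x) h = L2_inner D f h + L2_inner D g h"
  unfolding L2_inner_def inner_add_left
  by (intro set_integral_add L2_integrable_inner assms)

lemma L2_inner_scale_left: "L2_inner D (\<lambda>x. c *\<^sub>R f x) h = c * L2_inner D f h"
  unfolding L2_inner_def inner_scaleR_left by (rule set_integral_scale)

lemma L2_triangle:
  fixes K :: "(real^2) set" and h H :: "real^2 \<Rightarrow> 'b::euclidean_space"
  assumes K: "2 simplex K" and H: "continuous_on UNIV H" and eq: "\<And>x. x \<in> interior K \<Longrightarrow> h x = H x"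
  shows "h \<in> L2 K"
proof (rule L2_I)
  show "K \<in> sets lebesgue"
    using triangle_compact[OF K] by (simp add: lmeasurable_compact fmeasurableD)
  show "set_integrable lebesgue K h" by (rule triangle_integral(1)[OF K H eq])
  show "set_integrable lebesgue K (\<lambda>x. (norm (h x))\<^sup>2)"
    by (rule triangle_integral(1)[OF K, of "\<lambda>x. (norm (H x))\<^sup>2"]) (use eq H in \<open>auto intro!: continuous_intros\<close>)
qed

lemma L2_piecewise_on_mesh:
  fixes h :: "real^2 \<Rightarrow> 'b::euclidean_space"
  assumes T: "triangulation_of T \<Omega>" and \<Omega>: "open \<Omega>"
    and pw: "\<And>K. K \<in> T \<Longrightarrow> \<exists>H. continuous_on UNIV H \<and> (\<forall>x\<in>interior K. h x = H x)"
  shows "h \<in> L2 \<Omega>"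
proof -
  have meas: "\<Omega> \<in> sets lebesgue" using \<Omega> by auto
  have glue: "set_integrable lebesgue \<Omega> k"
    if "\<And>K. K \<in> T \<Longrightarrow> set_integrable lebesgue K k" for k :: "real^2 \<Rightarrow> 'c::euclidean_space"
  proof -
    have "set_integrable lebesgue (\<Union>K\<in>T. K) k"
      using finite_mesh[OF T] that mesh_simplex[OF T]
      by (intro set_integrable_UN) (auto intro!: fmeasurableD lmeasurable_compact triangle_compact)
    then show ?thesis
      by (rule set_integrable_subset) (use meas mesh_Union[OF T] closure_subset in auto)
  qed
  show ?thesis
  proof (rule L2_I[OF meas glue glue])
    fix K assume K: "K \<in> T"
    then obtain H where H: "continuous_on UNIV H" "\<And>x. x \<in> interior K \<Longrightarrow> h x = H x" using pw by blast
    show "set_integrable lebesgue K h" by (rule triangle_integral(1)[OF mesh_simplex[OF T K] H])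
    show "set_integrable lebesgue K (\<lambda>x. (norm (h x))\<^sup>2)"
      by (rule triangle_integral(1)[OF mesh_simplex[OF T K], of "\<lambda>x. (norm (H x))\<^sup>2"])
         (use H in \<open>auto intro!: continuous_intros\<close>)
  qed
qed

section \<open>The discrete weak gradient\<close>

lemma RT_extends_continuously:
  assumes "q \<in> RT j D"
  obtains Q where "continuous_on UNIV Q" "\<And>x. x \<in> D \<Longrightarrow> q x = Q x"
proof (rule RT_components[OF assms])
  fix Q assume "\<And>i. (\<lambda>x. Q x $ i) \<in> polys (Suc j)" "\<And>x. x \<in> D \<Longrightarrow> q x = Q x"
  then show thesis using that[of Q] continuous_on_polys_vec[of Q "Suc j" UNIV] by blast
qed

lemma P_extends_continuously:
  assumes "p \<in> P j D"
  obtains Q where "continuous_on UNIV Q" "\<And>x. x \<in> D \<Longrightarrow> p x = Q x"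
proof (rule P_globalE[OF assms])
  fix Q assume "Q \<in> polys j" "\<And>x. x \<in> D \<Longrightarrow> p x = Q x"
  then show thesis using that[of Q] polys_continuous[of Q j UNIV] by blast
qed

lemma P_continuous:
  assumes "p \<in> P j D"
  shows "continuous_on D p"
proof (rule P_extends_continuously[OF assms])
  fix Q assume Q: "continuous_on UNIV Q" "\<And>x. x \<in> D \<Longrightarrow> p x = Q x"
  show ?thesis
    by (rule continuous_on_eq[OF continuous_on_subset[OF Q(1) subset_UNIV]]) (simp add: Q(2))
qed

lemma RT_continuous:
  assumes "q \<in> RT j D"
  shows "continuous_on D q"
proof (rule RT_extends_continuously[OF assms])
  fix Q assume Q: "continuous_on UNIV Q" "\<And>x. x \<in> D \<Longrightarrow> q x = Q x"
  show ?thesis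
    by (rule continuous_on_eq[OF continuous_on_subset[OF Q(1) subset_UNIV]]) (simp add: Q(2))
qed

lemma triangle_edge_segmentE:
  fixes K e :: "(real^2) set"
  assumes "2 simplex K" "e edge_of K"
  obtains b c where "e = closed_segment b c" "b \<noteq> c"
proof (rule triangle_edgeE[OF assms])
  fix a b c assume "\<not> collinear {a, b, c}" "e = closed_segment b c"
  then show thesis using that[of b c] by (auto simp: collinear_3_eq_affine_dependent)
qed

lemma bd_inner_cong:
  assumes "2 simplex K" "\<And>e x. e edge_of K \<Longrightarrow> x \<in> e \<Longrightarrow> f e x * g e x = f' e x * g' e x"
  shows "bd_inner K f g = bd_inner K f' g'"
  unfolding bd_inner_def
proof (rule sum.cong[OF refl])
  fix e assume "e \<in> {e. e edge_of K}"
  then have e: "e edge_of K" by simp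
  obtain b c where bc: "e = closed_segment b c" by (rule triangle_edge_segmentE[OF assms(1) e])
  show "edge_integral e (\<lambda>x. f e x * g e x) = edge_integral e (\<lambda>x. f' e x * g' e x)"
    unfolding bc by (rule edge_integral_cong) (use assms(2)[OF e] bc in simp)
qed

lemma bd_inner_commute: "bd_inner K f g = bd_inner K g f"
  by (simp add: bd_inner_def mult.commute)

lemma bd_inner_add_left:
  assumes "2 simplex K"
    and "\<And>e. e edge_of K \<Longrightarrow> continuous_on e (f e)" "\<And>e. e edge_of K \<Longrightarrow> continuous_on e (f' e)"
    and "\<And>e. e edge_of K \<Longrightarrow> continuous_on e (g e)"
  shows "bd_inner K (\<lambda>e x. f e x + f' e x) g = bd_inner K f g + bd_inner K f' g"
  unfolding bd_inner_def sum.distrib[symmetric]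
proof (rule sum.cong[OF refl])
  fix e assume "e \<in> {e. e edge_of K}"
  then have e: "e edge_of K" by simp
  obtain b c where bc: "e = closed_segment b c" by (rule triangle_edge_segmentE[OF assms(1) e])
  have "edge_integral e (\<lambda>x. f e x * g e x + f' e x * g e x)
      = edge_integral e (\<lambda>x. f e x * g e x) + edge_integral e (\<lambda>x. f' e x * g e x)"
    unfolding bc
    by (rule edge_integral_add) (use assms(2-4)[OF e] in \<open>auto simp: bc intro!: continuous_intros\<close>)
  then show "edge_integral e (\<lambda>x. (f e x + f' e x) * g e x)
      = edge_integral e (\<lambda>x. f e x * g e x) + edge_integral e (\<lambda>x. f' e x * g e x)"
    by (simp add: distrib_right)
qed

lemma bd_inner_scale_left:
  assumes "2 simplex K"
  shows "bd_inner K (\<lambda>e x. k * f e x) g = k * bd_inner K f g"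
  unfolding bd_inner_def sum_distrib_left
proof (rule sum.cong[OF refl])
  fix e assume "e \<in> {e. e edge_of K}"
  then have e: "e edge_of K" by simp
  obtain b c where bc: "e = closed_segment b c" by (rule triangle_edge_segmentE[OF assms(1) e])
  show "edge_integral e (\<lambda>x. k * f e x * g e x) = k * edge_integral e (\<lambda>x. f e x * g e x)"
    unfolding bc mult.assoc by (rule edge_integral_scale)
qed

text \<open>The part of the condition for \<open>V\<^sub>h\<close> that concerns a single triangle.\<close>

definition weak_on :: "nat \<Rightarrow> (real^2) set \<Rightarrow> weak_fun set" where
  "weak_on j K = {v. fst v \<in> P j (interior K) \<and> (\<forall>e. e edge_of K \<longrightarrow> snd v e \<in> P j e)}"

text \<open>As a functional of \<open>q\<close>, the right-hand side of the equation that defines the weak gradient on \<open>K\<close>. That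
the weak gradient of \<open>v\<close> vanishes on \<open>K\<close> means that this functional is zero on the Raviart-Thomas
space.\<close>

definition weak_grad_rhs :: "(real^2) set \<Rightarrow> weak_fun \<Rightarrow> (real^2 \<Rightarrow> real^2) \<Rightarrow> real" where
  "weak_grad_rhs K v q = - L2_inner K (fst v) (divergence q)
     + bd_inner K (snd v) (\<lambda>e x. q x \<bullet> outward_normal K e)"

lemma weak_grad_rhs_linear_field:
  assumes K: "2 simplex K" and v: "v \<in> weak_on j K"
  shows "linear_on (RT j K) (weak_grad_rhs K v)"
proof (rule linear_onI)
  obtain U where U: "continuous_on UNIV U" "\<And>x. x \<in> interior K \<Longrightarrow> fst v x = U x"
    using v by (auto simp: weak_on_def elim: P_extends_continuously)
  have vb: "continuous_on e (snd v e)" if "e edge_of K" for e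
    using v that P_continuous unfolding weak_on_def by blast
  have qn: "continuous_on e (\<lambda>x. q x \<bullet> n)" if "q \<in> RT j K" "e edge_of K" for q e n
    by (intro continuous_intros continuous_on_subset[OF RT_continuous[OF that(1)] edge_of_imp_subset[OF that(2)]])
  {
    fix q r assume q: "q \<in> RT j K" and r: "r \<in> RT j K"
    obtain d where d: "d \<in> polys j" "\<And>x. x \<in> interior K \<Longrightarrow> divergence q x = d x"
      using RT_divergence(2)[OF q] by blast
    obtain d' where d': "d' \<in> polys j" "\<And>x. x \<in> interior K \<Longrightarrow> divergence r x = d' x"
      using RT_divergence(2)[OF r] by blast
    have c: "continuous_on UNIV d" "continuous_on UNIV d'" using d d' polys_continuous by blast+
    have dd: "divergence (q + r) x = d x + d' x" if "x \<in> interior K" for x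
      using divergence_add[OF RT_divergence(1)[OF q that] RT_divergence(1)[OF r that]] d(2) d'(2) that by simp
    have "L2_inner K (fst v) (divergence (q + r)) = integral K (\<lambda>x. U x \<bullet> (d x + d' x))"
      by (rule L2_inner_triangle[OF K U(1) _ U(2) dd]) (use c in \<open>auto intro!: continuous_intros\<close>)
    also have "\<dots> = integral K (\<lambda>x. U x \<bullet> d x) + integral K (\<lambda>x. U x \<bullet> d' x)"
      unfolding inner_add_right
      by (rule Henstock_Kurzweil_Integration.integral_add; rule integrable_on_triangle[OF K])
         (use c U in \<open>auto intro!: continuous_intros\<close>)
    also have "\<dots> = L2_inner K (fst v) (divergence q) + L2_inner K (fst v) (divergence r)"
      using L2_inner_triangle[OF K U(1) c(1) U(2) d(2)] L2_inner_triangle[OF K U(1) c(2) U(2) d'(2)] by simp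
    finally have 1: "L2_inner K (fst v) (divergence (q + r)) = \<dots>" .
    have "bd_inner K (\<lambda>e x. q x \<bullet> outward_normal K e + r x \<bullet> outward_normal K e) (snd v)
        = bd_inner K (\<lambda>e x. q x \<bullet> outward_normal K e) (snd v) + bd_inner K (\<lambda>e x. r x \<bullet> outward_normal K e) (snd v)"
      by (rule bd_inner_add_left[OF K]) (auto intro: qn q r vb)
    then show "weak_grad_rhs K v (q + r) = weak_grad_rhs K v q + weak_grad_rhs K v r"
      unfolding weak_grad_rhs_def 1 by (simp add: bd_inner_commute[of K "snd v"] inner_add_left)
  }
  {
    fix k q assume q: "q \<in> RT j K"
    obtain d where d: "d \<in> polys j" "\<And>x. x \<in> interior K \<Longrightarrow> divergence q x = d x"
      using RT_divergence(2)[OF q] by blast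
    have c: "continuous_on UNIV d" using d polys_continuous by blast
    have dd: "divergence (k *\<^sub>R q) x = k * d x" if "x \<in> interior K" for x
      using divergence_scale[OF RT_divergence(1)[OF q that]] d(2) that by simp
    have "L2_inner K (fst v) (divergence (k *\<^sub>R q)) = integral K (\<lambda>x. U x \<bullet> (k * d x))"
      by (rule L2_inner_triangle[OF K U(1) _ U(2) dd]) (use c in \<open>auto intro!: continuous_intros\<close>)
    also have "\<dots> = k * integral K (\<lambda>x. U x \<bullet> d x)"
      by (subst Henstock_Kurzweil_Integration.integral_mult_right[symmetric]) (simp add: mult.left_commute)
    also have "\<dots> = k * L2_inner K (fst v) (divergence q)"
      using L2_inner_triangle[OF K U(1) c(1) U(2) d(2)] by simp
    finally have 1: "L2_inner K (fst v) (divergence (k *\<^sub>R q)) = \<dots>" .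
    have "bd_inner K (\<lambda>e x. k * (q x \<bullet> outward_normal K e)) (snd v)
        = k * bd_inner K (\<lambda>e x. q x \<bullet> outward_normal K e) (snd v)"
      by (rule bd_inner_scale_left[OF K])
    then show "weak_grad_rhs K v (k *\<^sub>R q) = k * weak_grad_rhs K v q"
      unfolding weak_grad_rhs_def 1 by (simp add: bd_inner_commute[of K "snd v"] algebra_simps)
  }
qed

lemma divergence_cong_RT:
  assumes "q \<in> RT j K" "\<And>x. x \<in> K \<Longrightarrow> q x = r x" "x \<in> interior K"
  shows "divergence r x = divergence q x"
proof (rule divergence_cong(1)[OF open_interior assms(3)])
  show "r y = q y" if "y \<in> interior K" for y
    by (rule assms(2)[OF subsetD[OF interior_subset that], symmetric])
qed (rule RT_divergence(1)[OF assms(1,3)])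

lemma weak_grad_rhs_linear_weak:
  assumes K: "2 simplex K" and q: "q \<in> RT j K"
  shows "linear_on (weak_on j K) (\<lambda>v. weak_grad_rhs K v q)"
proof (rule linear_onI)
  obtain d where d: "d \<in> polys j" "\<And>x. x \<in> interior K \<Longrightarrow> divergence q x = d x"
    using RT_divergence(2)[OF q] by blast
  have dL2: "divergence q \<in> L2 K" by (rule L2_triangle[OF K polys_continuous[OF d(1)] d(2)])
  have meas: "K \<in> sets lebesgue"
    using triangle_compact[OF K] by (simp add: lmeasurable_compact fmeasurableD)
  have vL2: "fst v \<in> L2 K" if v: "v \<in> weak_on j K" for v
  proof -
    obtain U where "continuous_on UNIV U" "\<And>x. x \<in> interior K \<Longrightarrow> fst v x = U x"
      using v by (auto simp: weak_on_def elim: P_extends_continuously)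
    then show ?thesis by (rule L2_triangle[OF K])
  qed
  have vb: "continuous_on e (snd v e)" if "v \<in> weak_on j K" "e edge_of K" for e v
    using that P_continuous unfolding weak_on_def by blast
  have qn: "continuous_on e (\<lambda>x. q x \<bullet> n)" if "e edge_of K" for e n
    by (intro continuous_intros continuous_on_subset[OF RT_continuous[OF q] edge_of_imp_subset[OF that]])
  show "weak_grad_rhs K (v + w) q = weak_grad_rhs K v q + weak_grad_rhs K w q" if "v \<in> weak_on j K" "w \<in> weak_on j K" for v w
    using L2_inner_add_left[OF meas vL2[OF that(1)] vL2[OF that(2)] dL2]
      bd_inner_add_left[OF K vb[OF that(1)] vb[OF that(2)] qn]
    unfolding weak_grad_rhs_def by (simp add: plus_fun_def)
  show "weak_grad_rhs K (k *\<^sub>R v) q = k * weak_grad_rhs K v q" for k v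
    using L2_inner_scale_left[of K k "fst v" "divergence q"]
      bd_inner_scale_left[OF K, of k "snd v"]
    unfolding weak_grad_rhs_def by (simp add: scaleR_fun_def algebra_simps)
qed

lemma weak_grad_rhs_cong_field:
  assumes K: "2 simplex K" and v: "v \<in> weak_on j K" and q: "q \<in> RT j K" and qr: "\<And>x. x \<in> K \<Longrightarrow> q x = r x"
  shows "weak_grad_rhs K v q = weak_grad_rhs K v r"
proof -
  obtain U where U: "continuous_on UNIV U" "\<And>x. x \<in> interior K \<Longrightarrow> fst v x = U x"
    using v by (auto simp: weak_on_def elim: P_extends_continuously)
  obtain d where d: "d \<in> polys j" "\<And>x. x \<in> interior K \<Longrightarrow> divergence q x = d x"
    using RT_divergence(2)[OF q] by blast
  have d': "divergence r x = d x" if "x \<in> interior K" for x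
    using divergence_cong_RT[OF q qr that] d(2)[OF that] by simp
  have "L2_inner K (fst v) (divergence q) = L2_inner K (fst v) (divergence r)"
    using L2_inner_triangle[OF K U(1) polys_continuous[OF d(1)] U(2) d(2)]
      L2_inner_triangle[OF K U(1) polys_continuous[OF d(1)] U(2) d'] by simp
  moreover have "bd_inner K (snd v) (\<lambda>e x. q x \<bullet> outward_normal K e)
      = bd_inner K (snd v) (\<lambda>e x. r x \<bullet> outward_normal K e)"
    by (rule bd_inner_cong[OF K]) (use qr edge_of_imp_subset in force)
  ultimately show ?thesis by (simp add: weak_grad_rhs_def)
qed

definition zero_extend :: "'a set \<Rightarrow> ('a \<Rightarrow> 'b::real_vector) \<Rightarrow> 'a \<Rightarrow> 'b" where
  "zero_extend S h x = (if x \<in> S then h x else 0)"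

lemma linear_zero_extend_scaleR:
  "linear (\<lambda>p. zero_extend S (\<lambda>x. p x *\<^sub>R w x))"
proof (rule linearI)
  show "zero_extend S (\<lambda>x. (p + q) x *\<^sub>R w x)
      = zero_extend S (\<lambda>x. p x *\<^sub>R w x) + zero_extend S (\<lambda>x. q x *\<^sub>R w x)" for p q
    by (rule ext) (simp add: zero_extend_def scaleR_add_left)
  show "zero_extend S (\<lambda>x. (c *\<^sub>R p) x *\<^sub>R w x) = c *\<^sub>R zero_extend S (\<lambda>x. p x *\<^sub>R w x)" for c p
    by (rule ext) (simp add: zero_extend_def)
qed

lemma zero_extend_span:
  assumes "p \<in> polys j"
  shows "zero_extend S (\<lambda>x. p x *\<^sub>R w x) \<in> span ((\<lambda>p. zero_extend S (\<lambda>x. p x *\<^sub>R w x)) ` monomials j)"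
  using assms unfolding linear_span_image[OF linear_zero_extend_scaleR] polys_eq_span by blast

text \<open>Prescribing the value \<open>0\<close> outside \<open>K\<close> singles out one representative of each field on \<open>K\<close>; the space of
all representatives has infinite dimension.\<close>

lemma RT_finite_dimensional:
  "\<exists>B. finite B \<and> {q \<in> RT j K. \<forall>x. x \<notin> K \<longrightarrow> q x = 0} \<subseteq> span B"
proof -
  define L where "L w = (\<lambda>p. zero_extend K (\<lambda>x. p x *\<^sub>R w x))" for w :: "real^2 \<Rightarrow> real^2"
  define B where "B = L (\<lambda>x. axis 1 1) ` monomials j \<union> L (\<lambda>x. axis 2 1) ` monomials j \<union> L (\<lambda>x. x) ` monomials j"
  have "q \<in> span B" if q: "q \<in> RT j K" and 0: "\<And>x. x \<notin> K \<Longrightarrow> q x = 0" for q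
  proof -
    obtain p r where h: "\<And>i. (\<lambda>x. p x $ i) \<in> polys j" "r \<in> polys j" "\<And>x. x \<in> K \<Longrightarrow> q x = p x + r x *\<^sub>R x"
      using RT_global[OF q] by blast
    have "p x = p x $ 1 *\<^sub>R axis 1 1 + p x $ 2 *\<^sub>R axis 2 1" for x
      by (simp add: vec_eq_iff forall_2 axis_def)
    then have "q = L (\<lambda>x. axis 1 1) (\<lambda>x. p x $ 1) + L (\<lambda>x. axis 2 1) (\<lambda>x. p x $ 2) + L (\<lambda>x. x) r"
      using h(3) 0 by (auto simp: fun_eq_iff L_def zero_extend_def)
    moreover have "L w p \<in> span B" if "p \<in> polys j" "w \<in> {\<lambda>x. axis 1 1, \<lambda>x. axis 2 1, \<lambda>x. x}" for w p
    proof -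
      have "L w p \<in> span (L w ` monomials j)" unfolding L_def by (rule zero_extend_span[OF that(1)])
      moreover have "span (L w ` monomials j) \<subseteq> span B"
        by (rule span_mono) (use that(2) in \<open>auto simp: B_def\<close>)
      ultimately show ?thesis by blast
    qed
    ultimately show ?thesis using h(1)[of 1] h(1)[of 2] h(2) by (auto intro!: span_add)
  qed
  moreover have "finite B" by (simp add: B_def finite_monomials)
  ultimately show ?thesis by blast
qed

lemma RT_L2:
  assumes "2 simplex K" "q \<in> RT j (interior K)"
  shows "q \<in> L2 K"
  using RT_extends_continuously[OF assms(2)] L2_triangle[OF assms(1)] by metis

lemma L2_inner_self_zero:
  fixes q :: "real^2 \<Rightarrow> real^2"
  assumes K: "2 simplex K" and Q: "continuous_on UNIV Q" "\<And>x. x \<in> interior K \<Longrightarrow> q x = Q x"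
    and 0: "L2_inner K q q = 0" and x: "x \<in> K"
  shows "Q x = 0"
proof -
  have "integral K (\<lambda>x. Q x \<bullet> Q x) = 0"
    using 0 L2_inner_triangle[OF K Q(1) Q(1) Q(2) Q(2)] by simp
  then have "Q x \<bullet> Q x = 0"
    using triangle_integral_zero_imp[OF K, of "\<lambda>x. Q x \<bullet> Q x" x] x Q(1) by (auto intro!: continuous_intros)
  then show ?thesis by simp
qed

lemma L2_inner_linear_left:
  assumes "D \<in> sets lebesgue" "h \<in> L2 D" "S \<subseteq> L2 D"
  shows "linear_on S (\<lambda>f. L2_inner D f h)"
  using L2_inner_add_left[OF assms(1) _ _ assms(2)] assms(3) L2_inner_scale_left[of D]
  by (intro linear_onI) (auto simp: plus_fun_def scaleR_fun_def subset_iff)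

lemma L2_inner_linear_right:
  assumes "D \<in> sets lebesgue" "h \<in> L2 D" "S \<subseteq> L2 D"
  shows "linear_on S (L2_inner D h)"
proof -
  have "L2_inner D h = (\<lambda>f. L2_inner D f h)" by (rule ext) (rule L2_inner_commute)
  then show ?thesis using L2_inner_linear_left[OF assms] by metis
qed

text \<open>Riesz representation on the Raviart-Thomas space. Both sides of the equation depend only on the values of
\<open>q\<close> on \<open>K\<close>, so it is enough to treat fields that vanish outside \<open>K\<close>.\<close>

lemma local_weak_gradient_exists:
  assumes K: "2 simplex K" and v: "v \<in> weak_on j K"
  shows "\<exists>g\<in>RT j K. \<forall>q\<in>RT j K. L2_inner K g q = weak_grad_rhs K v q"
proof -
  define X where "X = {q \<in> RT j K. \<forall>x. x \<notin> K \<longrightarrow> q x = 0}"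
  have X: "subspace X"
    using subspace_RT[of j K] by (auto simp: X_def subspace_def)
  obtain B where B: "finite B" "X \<subseteq> span B" using RT_finite_dimensional unfolding X_def by blast
  have meas: "K \<in> sets lebesgue"
    using triangle_compact[OF K] by (simp add: lmeasurable_compact fmeasurableD)
  have XL2: "X \<subseteq> L2 K"
  proof
    fix x assume "x \<in> X"
    then have "x \<in> RT j K" by (simp add: X_def)
    then show "x \<in> L2 K" using RT_L2[OF K] RT_subset[OF _ interior_subset] by metis
  qed
  have "\<exists>g\<in>X. \<forall>q\<in>X. L2_inner K g q = weak_grad_rhs K v q"
  proof (rule nondegenerate_form_represents_functional[OF X B])
    show "linear_on X (\<lambda>x. L2_inner K x y)" "linear_on X (L2_inner K y)" if "y \<in> X" for y
      using L2_inner_linear_left[OF meas _ XL2] L2_inner_linear_right[OF meas _ XL2] XL2 that by blast+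
    show "linear_on X (weak_grad_rhs K v)"
      by (rule linear_on_subset[OF weak_grad_rhs_linear_field[OF K v]]) (auto simp: X_def)
    show "y = 0" if y: "y \<in> X" and 0: "\<And>x. x \<in> X \<Longrightarrow> L2_inner K x y = 0" for y
    proof -
      have "y \<in> RT j K" using y by (simp add: X_def)
      then obtain Q where Q: "continuous_on UNIV Q" "\<And>x. x \<in> K \<Longrightarrow> y x = Q x"
        by (rule RT_extends_continuously) auto
      have "Q x = 0" if "x \<in> K" for x
        by (rule L2_inner_self_zero[OF K Q(1) _ 0[OF y] that]) (use Q(2) interior_subset in blast)
      then show ?thesis using Q(2) y by (auto simp: X_def fun_eq_iff)
    qed
  qed
  then obtain g where g: "g \<in> X" "\<And>q. q \<in> X \<Longrightarrow> L2_inner K g q = weak_grad_rhs K v q" by blast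
  have "L2_inner K g q = weak_grad_rhs K v q" if q: "q \<in> RT j K" for q
  proof -
    have zq: "zero_extend K q \<in> RT j K" by (rule RT_cong[OF q]) (simp add: zero_extend_def)
    then have "L2_inner K g (zero_extend K q) = weak_grad_rhs K v (zero_extend K q)"
      using g(2) by (simp add: X_def zero_extend_def)
    moreover have "L2_inner K g (zero_extend K q) = L2_inner K g q"
      unfolding L2_inner_def by (rule set_lebesgue_integral_cong) (auto simp: meas zero_extend_def)
    moreover have "weak_grad_rhs K v q = weak_grad_rhs K v (zero_extend K q)"
      by (rule weak_grad_rhs_cong_field[OF K v q]) (simp add: zero_extend_def)
    ultimately show ?thesis by simp
  qed
  then show ?thesis using g(1) by (auto simp: X_def)
qed

context
  fixes T :: "(real^2) set set" and \<Omega> :: "(real^2) set" and j :: nat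
  assumes T: "triangulation_of T \<Omega>" and \<Omega>: "polygonal_domain \<Omega>"
begin

lemma open_domain: "open \<Omega>"
  using \<Omega> by (simp add: polygonal_domain_def)

lemma interior_mesh_subset: "K \<in> T \<Longrightarrow> interior K \<subseteq> \<Omega>"
proof -
  assume "K \<in> T"
  then have "K \<subseteq> closure \<Omega>" using mesh_Union[OF T] by blast
  then have "interior K \<subseteq> interior (closure \<Omega>)" by (rule interior_mono)
  then show ?thesis using \<Omega> by (simp add: polygonal_domain_def)
qed

lemma V_weak_on: "v \<in> V_space j T \<Longrightarrow> K \<in> T \<Longrightarrow> v \<in> weak_on j K"
  by (auto simp: V_space_def weak_on_def edges_def)

lemma Sigma_spaceI:
  assumes "\<And>K. K \<in> T \<Longrightarrow> q \<in> RT j (interior K)" "\<And>x. x \<notin> (\<Union>K\<in>T. interior K) \<Longrightarrow> q x = 0"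
  shows "q \<in> Sigma_space j \<Omega> T"
proof -
  have "q \<in> L2 \<Omega>"
  proof (rule L2_piecewise_on_mesh[OF T open_domain])
    fix K assume "K \<in> T"
    from assms(1)[OF this] show "\<exists>Q. continuous_on UNIV Q \<and> (\<forall>x\<in>interior K. q x = Q x)"
      by (rule RT_extends_continuously) blast
  qed
  with assms show ?thesis by (auto simp: Sigma_space_def)
qed

lemma subspace_Sigma: "subspace (Sigma_space j \<Omega> T)"
proof -
  have "Sigma_space j \<Omega> T = {q. (\<forall>K\<in>T. q \<in> RT j (interior K)) \<and> (\<forall>x. x \<notin> (\<Union>K\<in>T. interior K) \<longrightarrow> q x = 0)}"
    using Sigma_spaceI by (auto simp: Sigma_space_def)
  then show ?thesis
    using subspace_RT[of j] by (simp add: subspace_def)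
qed

text \<open>On each triangle the difference of the two fields agrees with a Raviart-Thomas field, which can serve as
the test field.\<close>

lemma Sigma_eqI:
  assumes g: "g \<in> Sigma_space j \<Omega> T" "g' \<in> Sigma_space j \<Omega> T"
    and eq: "\<And>K q. K \<in> T \<Longrightarrow> q \<in> RT j K \<Longrightarrow> L2_inner K g q = L2_inner K g' q"
  shows "g = g'"
proof
  fix x
  define d where "d = g - g'"
  have d: "d \<in> Sigma_space j \<Omega> T" unfolding d_def by (rule subspace_diff[OF subspace_Sigma g])
  have "d x = 0"
  proof (cases "x \<in> (\<Union>K\<in>T. interior K)")
    case True
    then obtain K where K: "K \<in> T" "x \<in> interior K" by blast
    note s = mesh_simplex[OF T K(1)]
    have meas: "K \<in> sets lebesgue"
      using triangle_compact[OF s] by (simp add: lmeasurable_compact fmeasurableD)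
    have rt: "g \<in> RT j (interior K)" "g' \<in> RT j (interior K)" "d \<in> RT j (interior K)"
      using g d K(1) by (auto simp: Sigma_space_def)
    obtain p r where pr: "\<And>i. (\<lambda>x. p x $ i) \<in> polys j" "r \<in> polys j"
        "\<And>x. x \<in> interior K \<Longrightarrow> d x = p x + r x *\<^sub>R x"
      using RT_global[OF rt(3)] by blast
    define Q where "Q x = p x + r x *\<^sub>R x" for x
    have Q: "Q \<in> RT j S" for S
      unfolding RT_def Q_def using pr(1,2) P_subset[OF _ subset_UNIV] by blast
    have Qc: "continuous_on UNIV Q" by (rule RT_continuous[OF Q])
    have "linear_on (L2 K) (\<lambda>f. L2_inner K f Q)"
      by (rule L2_inner_linear_left[OF meas RT_L2[OF s Q] order_refl])
    then have "L2_inner K d Q = 0"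
      unfolding d_def using eq[OF K(1) Q] RT_L2[OF s rt(1)] RT_L2[OF s rt(2)] RT_L2[OF s rt(3)]
      by (smt (verit) d_def diff_add_cancel linear_on_def)
    moreover have "L2_inner K d Q = L2_inner K d d"
      using L2_inner_triangle[OF s Qc Qc, of d Q] L2_inner_triangle[OF s Qc Qc, of d d] pr(3) by (simp add: Q_def)
    ultimately have "Q x = 0"
      using L2_inner_self_zero[OF s Qc, of d x] pr(3) K(2) interior_subset by (auto simp: Q_def)
    then show ?thesis using pr(3)[OF K(2)] by (simp add: Q_def)
  qed (use d in \<open>auto simp: Sigma_space_def\<close>)
  then show "g x = g' x" by (simp add: d_def)
qed

text \<open>The local weak gradients are glued; since the interiors of the triangles are disjoint, the sum of their
restrictions to the interiors agrees with each of them on its triangle.\<close>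

lemma weak_grad_ex1:
  assumes v: "v \<in> V_space j T"
  shows "\<exists>!g. g \<in> Sigma_space j \<Omega> T \<and> (\<forall>K\<in>T. \<forall>q\<in>RT j K. L2_inner K g q = weak_grad_rhs K v q)"
proof (rule ex_ex1I)
  have "\<exists>g\<in>RT j K. \<forall>q\<in>RT j K. L2_inner K g q = weak_grad_rhs K v q" if "K \<in> T" for K
    by (rule local_weak_gradient_exists[OF mesh_simplex[OF T that] V_weak_on[OF v that]])
  then obtain g where g: "\<And>K. K \<in> T \<Longrightarrow> g K \<in> RT j K"
    "\<And>K q. K \<in> T \<Longrightarrow> q \<in> RT j K \<Longrightarrow> L2_inner K (g K) q = weak_grad_rhs K v q" by metis
  define G where "G x = (\<Sum>K\<in>T. zero_extend (interior K) (g K) x)" for x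
  have G: "G x = g K x" if K: "K \<in> T" and x: "x \<in> interior K" for K x
  proof -
    have "zero_extend (interior K') (g K') x = (if K' = K then g K x else 0)" if "K' \<in> T" for K'
      using mesh_interiors_disjoint[OF T that K] x interior_subset[of K] by (auto simp: zero_extend_def)
    then show ?thesis using K finite_mesh[OF T] by (simp add: G_def)
  qed
  have "G \<in> Sigma_space j \<Omega> T"
  proof (rule Sigma_spaceI)
    show "G \<in> RT j (interior K)" if "K \<in> T" for K
      by (rule RT_cong[OF RT_subset[OF g(1)[OF that] interior_subset]]) (rule G[OF that, symmetric])
    show "G x = 0" if "x \<notin> (\<Union>K\<in>T. interior K)" for x
      using that by (auto simp: G_def zero_extend_def)
  qed
  moreover have "L2_inner K G q = weak_grad_rhs K v q" if K: "K \<in> T" and q: "q \<in> RT j K" for K q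
  proof -
    note s = mesh_simplex[OF T K]
    obtain H where H: "continuous_on UNIV H" "\<And>x. x \<in> K \<Longrightarrow> g K x = H x"
      using RT_extends_continuously[OF g(1)[OF K]] by blast
    obtain Q where Q: "continuous_on UNIV Q" "\<And>x. x \<in> K \<Longrightarrow> q x = Q x"
      using RT_extends_continuously[OF q] by blast
    have "L2_inner K G q = L2_inner K (g K) q"
      using L2_inner_triangle[OF s H(1) Q(1), of G q] L2_inner_triangle[OF s H(1) Q(1), of "g K" q]
        G[OF K] H(2) Q(2) interior_subset[of K] by (auto simp: subset_iff)
    then show ?thesis using g(2)[OF K q] by simp
  qed
  ultimately show "\<exists>g. g \<in> Sigma_space j \<Omega> T \<and> (\<forall>K\<in>T. \<forall>q\<in>RT j K. L2_inner K g q = weak_grad_rhs K v q)"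
    by blast
qed (use Sigma_eqI in auto)

lemma weak_grad:
  assumes "v \<in> V_space j T"
  shows "weak_grad j \<Omega> T v \<in> Sigma_space j \<Omega> T"
    and "\<And>K q. K \<in> T \<Longrightarrow> q \<in> RT j K \<Longrightarrow> L2_inner K (weak_grad j \<Omega> T v) q = weak_grad_rhs K v q"
  using theI'[OF weak_grad_ex1[OF assms]] unfolding weak_grad_def weak_grad_rhs_def by blast+

lemma Sigma_L2:
  assumes "g \<in> Sigma_space j \<Omega> T"
  shows "g \<in> L2 \<Omega>" "K \<in> T \<Longrightarrow> g \<in> L2 K"
  using assms RT_L2[OF mesh_simplex[OF T]] by (auto simp: Sigma_space_def)

lemma mesh_measurable: "K \<in> T \<Longrightarrow> K \<in> sets lebesgue"
  using triangle_compact[OF mesh_simplex[OF T]] by (simp add: lmeasurable_compact fmeasurableD)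

lemma subspace_V: "subspace (V_space j T)"
proof -
  note P = subspace_add[OF subspace_P] subspace_scale[OF subspace_P] subspace_0[OF subspace_P]
  show ?thesis
    unfolding subspace_def V_space_def by (auto simp: zero_prod_def intro: P)
qed

lemma subspace_V0: "subspace (V0_space j \<Omega> T)"
  using subspace_V unfolding subspace_def V0_space_def by auto

lemma V0_subset_V: "V0_space j \<Omega> T \<subseteq> V_space j T"
  by (auto simp: V0_space_def)

lemma weak_grad_add:
  assumes "u \<in> V_space j T" "v \<in> V_space j T"
  shows "weak_grad j \<Omega> T (u + v) = weak_grad j \<Omega> T u + weak_grad j \<Omega> T v"
proof (rule Sigma_eqI)
  note uv = subspace_add[OF subspace_V assms]
  note gr = weak_grad[OF assms(1)] weak_grad[OF assms(2)] weak_grad[OF uv]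
  show "weak_grad j \<Omega> T (u + v) \<in> Sigma_space j \<Omega> T" by (rule gr)
  show "weak_grad j \<Omega> T u + weak_grad j \<Omega> T v \<in> Sigma_space j \<Omega> T"
    by (rule subspace_add[OF subspace_Sigma gr(1,3)])
  fix K q assume K: "K \<in> T" and q: "q \<in> RT j K"
  have qL: "q \<in> L2 K" by (rule RT_L2[OF mesh_simplex[OF T K] RT_subset[OF q interior_subset]])
  have "weak_grad_rhs K (u + v) q = weak_grad_rhs K u q + weak_grad_rhs K v q"
    using weak_grad_rhs_linear_weak[OF mesh_simplex[OF T K] q] V_weak_on[OF _ K] assms unfolding linear_on_def by blast
  then show "L2_inner K (weak_grad j \<Omega> T (u + v)) q = L2_inner K (weak_grad j \<Omega> T u + weak_grad j \<Omega> T v) q"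
    using L2_inner_add_left[OF mesh_measurable[OF K] Sigma_L2(2)[OF gr(1) K] Sigma_L2(2)[OF gr(3) K] qL]
    by (simp add: gr(2,4,6) K q plus_fun_def)
qed

lemma weak_grad_scale:
  assumes "u \<in> V_space j T"
  shows "weak_grad j \<Omega> T (c *\<^sub>R u) = c *\<^sub>R weak_grad j \<Omega> T u"
proof (rule Sigma_eqI)
  note cu = subspace_scale[OF subspace_V assms, of c]
  note gr = weak_grad[OF assms(1)] weak_grad[OF cu]
  show "weak_grad j \<Omega> T (c *\<^sub>R u) \<in> Sigma_space j \<Omega> T" by (rule gr)
  show "c *\<^sub>R weak_grad j \<Omega> T u \<in> Sigma_space j \<Omega> T"
    by (rule subspace_scale[OF subspace_Sigma gr(1)])
  fix K q assume K: "K \<in> T" and q: "q \<in> RT j K"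
  have "weak_grad_rhs K (c *\<^sub>R u) q = c * weak_grad_rhs K u q"
    using weak_grad_rhs_linear_weak[OF mesh_simplex[OF T K] q] V_weak_on[OF _ K] assms unfolding linear_on_def by blast
  then show "L2_inner K (weak_grad j \<Omega> T (c *\<^sub>R u)) q = L2_inner K (c *\<^sub>R weak_grad j \<Omega> T u) q"
    using L2_inner_scale_left[of K c "weak_grad j \<Omega> T u" q]
    by (simp add: gr(2,4) K q scaleR_fun_def)
qed

end

section \<open>Functions with vanishing weak gradient on a triangle\<close>

text \<open>Differentiation lowers the degree by one, which leaves room for an affine factor such as a barycentric
coordinate. For \<open>j = 0\<close> the gradient is zero.\<close>

lemma polys_gradient_times_affine:
  assumes "p \<in> polys j"
  obtains G where "\<And>x. (p has_derivative (\<lambda>h. h \<bullet> G x)) (at x)" "continuous_on UNIV G"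
    "\<And>i \<alpha> \<beta> \<gamma>. (\<lambda>x. (\<alpha> + \<beta> * x $ 1 + \<gamma> * x $ 2) * G x $ i) \<in> polys j"
proof (cases j)
  case 0
  then obtain c where "p = (\<lambda>x. c)" using assms polys_0_const by blast
  then show ?thesis by (intro that[of "\<lambda>x. 0"]) (auto simp: polys_zero)
next
  case (Suc i)
  then obtain G where G: "\<And>k. (\<lambda>x. G x $ k) \<in> polys i" "\<And>x. (p has_derivative (\<lambda>h. h \<bullet> G x)) (at x)"
    using polys_gradient assms by blast
  show ?thesis
  proof (rule that)
    show "(p has_derivative (\<lambda>h. h \<bullet> G x)) (at x)" for x by (rule G(2))
    show "continuous_on UNIV G" by (rule continuous_on_polys_vec[OF G(1)])
    show "(\<lambda>x. (\<alpha> + \<beta> * x $ 1 + \<gamma> * x $ 2) * G x $ k) \<in> polys j" for k \<alpha> \<beta> \<gamma>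
      unfolding Suc by (rule polys_mult_affine[OF G(1)])
  qed
qed

text \<open>Integration by parts against \<open>p (x - a)\<close>. The normal component of this field vanishes on the two edges at
\<open>a\<close>, and on the opposite edge it is \<open>p\<close> times the height.\<close>

lemma weak_grad_rhs_cone_field:
  fixes a b c :: "real^2"
  assumes abc: "\<not> collinear {a, b, c}"
    and v: "v \<in> weak_on j (convex hull {a, b, c})"
    and U: "U \<in> polys j" "\<And>x. x \<in> interior (convex hull {a, b, c}) \<Longrightarrow> fst v x = U x"
    and G: "\<And>x. (U has_derivative (\<lambda>h. h \<bullet> G x)) (at x)" "continuous_on UNIV G"
    and p: "p \<in> polys j"
  shows "weak_grad_rhs (convex hull {a, b, c}) v (\<lambda>x. p x *\<^sub>R (x - a))
    = integral (convex hull {a, b, c}) (\<lambda>x. p x * ((x - a) \<bullet> G x))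
      - \<bar>cross2 (b - a) (c - a)\<bar> / dist b c *
        edge_integral (closed_segment b c) (\<lambda>x. (U x - snd v (closed_segment b c) x) * p x)"
proof -
  let ?K = "convex hull {a, b, c}" and ?h = "\<bar>cross2 (b - a) (c - a)\<bar> / dist b c"
  let ?e = "closed_segment b c"
  have aff: "\<not> affine_dependent {a, b, c}" and ne: "a \<noteq> b" "a \<noteq> c" "b \<noteq> c"
    using abc by (auto simp: collinear_3_eq_affine_dependent)
  have K: "2 simplex ?K"
    by (rule simplex_convex_hull) (use aff ne in auto)
  have e: "?e edge_of ?K" "closed_segment c a edge_of ?K" "closed_segment a b edge_of ?K"
    by (auto simp: edge_of_triangle_iff[OF abc])
  obtain H where H: "\<And>x. (p has_derivative (\<lambda>h. h \<bullet> H x)) (at x)" "continuous_on UNIV H"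
    using polys_gradient_times_affine[OF p] by metis
  have cont: "continuous_on UNIV U" "continuous_on UNIV p"
    using U(1) p polys_continuous by blast+
  let ?q = "\<lambda>x. p x *\<^sub>R (x - a)"
  have L: "L2_inner ?K (fst v) (divergence ?q) = integral ?K (\<lambda>x. U x \<bullet> (2 * p x + (x - a) \<bullet> H x))"
    by (rule L2_inner_triangle[OF K cont(1) _ U(2) divergence_cone_field[OF H(1)]])
       (use cont H(2) in \<open>auto intro!: continuous_intros\<close>)
  have "((\<lambda>x. U x * p x) has_derivative (\<lambda>h. h \<bullet> (U x *\<^sub>R H x + p x *\<^sub>R G x))) (at x)" for x
    using has_derivative_mult[OF G(1) H(1), of x]
    by (rule has_derivative_eq_rhs) (simp add: fun_eq_iff inner_add_right mult.commute)
  moreover have "continuous_on UNIV (\<lambda>x. U x *\<^sub>R H x + p x *\<^sub>R G x)"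
    using cont H(2) G(2) by (intro continuous_intros)
  ultimately have cone: "integral ?K (\<lambda>x. 2 * (U x * p x) + (x - a) \<bullet> (U x *\<^sub>R H x + p x *\<^sub>R G x))
      = ?h * edge_integral ?e (\<lambda>x. U x * p x)"
    by (rule cone_divergence_theorem[OF abc])
  have "integral ?K (\<lambda>x. 2 * (U x * p x) + (x - a) \<bullet> (U x *\<^sub>R H x + p x *\<^sub>R G x))
      = integral ?K (\<lambda>x. U x \<bullet> (2 * p x + (x - a) \<bullet> H x) + p x * ((x - a) \<bullet> G x))"
    by (rule arg_cong[of _ _ "integral ?K"]) (simp add: fun_eq_iff inner_add_right algebra_simps)
  also have "\<dots> = integral ?K (\<lambda>x. U x \<bullet> (2 * p x + (x - a) \<bullet> H x)) + integral ?K (\<lambda>x. p x * ((x - a) \<bullet> G x))"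
    by (rule Henstock_Kurzweil_Integration.integral_add; rule integrable_on_triangle[OF K])
       (use cont H(2) G(2) in \<open>auto intro!: continuous_intros\<close>)
  finally have parts: "?h * edge_integral ?e (\<lambda>x. U x * p x)
      = L2_inner ?K (fst v) (divergence ?q) + integral ?K (\<lambda>x. p x * ((x - a) \<bullet> G x))"
    unfolding cone L .
  have vb: "continuous_on ?e (snd v ?e)"
    using v e(1) P_continuous unfolding weak_on_def by blast
  let ?n = "outward_normal ?K"
  have "edge_integral ?e (\<lambda>x. snd v ?e x * (?q x \<bullet> ?n ?e))
      = edge_integral ?e (\<lambda>x. ?h * (snd v ?e x * p x))"
  proof (rule edge_integral_cong)
    fix x assume "x \<in> ?e"
    then obtain t where "x = (1 - t) *\<^sub>R b + t *\<^sub>R c" by (auto simp: in_segment)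
    then have "x - a = (b - a) + t *\<^sub>R (c - b)" by (simp add: algebra_simps)
    then have "?n ?e \<bullet> (x - a) = ?n ?e \<bullet> (b - a) + t * (?n ?e \<bullet> (c - b))"
      by (simp only: inner_add_right inner_scaleR_right)
    then have "(x - a) \<bullet> ?n ?e = ?h"
      unfolding outward_normal(2,3)[OF abc] inner_commute[of "x - a"] by simp
    then show "snd v ?e x * (?q x \<bullet> ?n ?e) = ?h * (snd v ?e x * p x)" by simp
  qed
  moreover have "edge_integral (closed_segment c a) (\<lambda>x. snd v (closed_segment c a) x * (?q x \<bullet> ?n (closed_segment c a)))
      = edge_integral (closed_segment c a) (\<lambda>x. 0 * 0)"
  proof (rule edge_integral_cong)
    fix x assume "x \<in> closed_segment c a"
    then obtain t where "x = (1 - t) *\<^sub>R c + t *\<^sub>R a" by (auto simp: in_segment)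
    then have "x - a = - (1 - t) *\<^sub>R (a - c)" by (simp add: algebra_simps)
    moreover have "?n (closed_segment c a) \<bullet> (a - c) = 0"
      using outward_normal(2)[of b c a] abc by (simp add: insert_commute)
    ultimately have "(x - a) \<bullet> ?n (closed_segment c a) = 0" by (simp add: inner_commute)
    then show "snd v (closed_segment c a) x * (?q x \<bullet> ?n (closed_segment c a)) = 0 * 0" by simp
  qed
  moreover have "edge_integral (closed_segment a b) (\<lambda>x. snd v (closed_segment a b) x * (?q x \<bullet> ?n (closed_segment a b)))
      = edge_integral (closed_segment a b) (\<lambda>x. 0 * 0)"
  proof (rule edge_integral_cong)
    fix x assume "x \<in> closed_segment a b"
    then obtain t where "x = (1 - t) *\<^sub>R a + t *\<^sub>R b" by (auto simp: in_segment)
    then have "x - a = t *\<^sub>R (b - a)" by (simp add: algebra_simps)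
    moreover have "?n (closed_segment a b) \<bullet> (b - a) = 0"
      using outward_normal(2)[of c a b] abc by (simp add: insert_commute)
    ultimately have "(x - a) \<bullet> ?n (closed_segment a b) = 0" by (simp add: inner_commute)
    then show "snd v (closed_segment a b) x * (?q x \<bullet> ?n (closed_segment a b)) = 0 * 0" by simp
  qed
  ultimately have bd: "bd_inner ?K (snd v) (\<lambda>e x. ?q x \<bullet> ?n e) = ?h * edge_integral ?e (\<lambda>x. snd v ?e x * p x)"
    unfolding bd_inner_def sum_triangle_edges[OF abc] edge_integral_scale by simp
  have "edge_integral ?e (\<lambda>x. (U x - snd v ?e x) * p x + snd v ?e x * p x)
      = edge_integral ?e (\<lambda>x. (U x - snd v ?e x) * p x) + edge_integral ?e (\<lambda>x. snd v ?e x * p x)"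
    by (rule edge_integral_add)
       (use vb cont continuous_on_subset[OF _ subset_UNIV] in \<open>auto intro!: continuous_intros\<close>)
  then have "edge_integral ?e (\<lambda>x. U x * p x)
      = edge_integral ?e (\<lambda>x. (U x - snd v ?e x) * p x) + edge_integral ?e (\<lambda>x. snd v ?e x * p x)"
    by (simp add: algebra_simps)
  then show ?thesis
    unfolding weak_grad_rhs_def bd using parts by (simp add: algebra_simps)
qed

text \<open>The first factor is, up to a constant, the barycentric coordinate of \<open>a\<close>. It vanishes on the edge opposite
to \<open>a\<close>, which removes the edge term of \<open>weak_grad_rhs_cone_field\<close>.\<close>

lemma vertex_bubble_test:
  fixes a b c :: "real^2"
  assumes abc: "\<not> collinear {a, b, c}"
    and v: "v \<in> weak_on j (convex hull {a, b, c})"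
    and U: "U \<in> polys j" "\<And>x. x \<in> interior (convex hull {a, b, c}) \<Longrightarrow> fst v x = U x"
    and G: "\<And>x. (U has_derivative (\<lambda>h. h \<bullet> G x)) (at x)" "continuous_on UNIV G"
      "\<And>i \<alpha> \<beta> \<gamma>. (\<lambda>x. (\<alpha> + \<beta> * x $ 1 + \<gamma> * x $ 2) * G x $ i) \<in> polys j"
    and weak_grad_rhs: "\<And>q. q \<in> RT j (convex hull {a, b, c}) \<Longrightarrow> weak_grad_rhs (convex hull {a, b, c}) v q = 0"
  shows "integral (convex hull {a, b, c}) (\<lambda>x. cross2 (b - x) (c - x) * (a \<bullet> G x) * ((x - a) \<bullet> G x)) = 0"
proof -
  let ?K = "convex hull {a, b, c}" and ?e = "closed_segment b c"
  define p where "p x = cross2 (b - x) (c - x) * (a \<bullet> G x)" for x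
  define l where "l x = (b $ 1 * c $ 2 - b $ 2 * c $ 1) + (b $ 2 - c $ 2) * x $ 1 + (c $ 1 - b $ 1) * x $ 2" for x :: "real^2"
  have l: "cross2 (b - x) (c - x) = l x" for x
    by (simp add: cross2_def l_def algebra_simps)
  have "(\<lambda>x. a $ 1 * (l x * G x $ 1) + a $ 2 * (l x * G x $ 2)) \<in> polys j"
    unfolding l_def by (intro polys_add polys_scale G(3))
  then have p: "p \<in> polys j"
    by (simp add: p_def[abs_def] l inner_2 algebra_simps)
  have "edge_integral ?e (\<lambda>x. (U x - snd v ?e x) * p x) = edge_integral ?e (\<lambda>x. 0 * 0)"
  proof (rule edge_integral_cong)
    fix x assume "x \<in> ?e"
    then obtain t where t: "x = (1 - t) *\<^sub>R b + t *\<^sub>R c" by (auto simp: in_segment)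
    have "cross2 (b - x) (c - x) = 0" unfolding t cross2_def by (simp add: algebra_simps)
    then show "(U x - snd v ?e x) * p x = 0 * 0" by (simp add: p_def)
  qed
  then show ?thesis
    using weak_grad_rhs_cone_field[OF abc v U G(1,2) p] weak_grad_rhs[OF polys_cone_field_in_RT[OF p]]
    unfolding edge_integral_scale by (simp add: p_def)
qed

lemma in_triangleE:
  assumes "x \<in> convex hull {a, b, c}"
  obtains u v w where "0 \<le> u" "0 \<le> v" "0 \<le> w" "u + v + w = 1" "x = u *\<^sub>R a + v *\<^sub>R b + w *\<^sub>R c"
proof -
  have "\<exists>u v w. 0 \<le> u \<and> 0 \<le> v \<and> 0 \<le> w \<and> u + v + w = 1 \<and> x = u *\<^sub>R a + v *\<^sub>R b + w *\<^sub>R c"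
    using assms unfolding convex_hull_3 by auto
  then show ?thesis using that by metis
qed

lemma in_interior_triangleE:
  fixes a b c :: "real^2"
  assumes "\<not> collinear {a, b, c}" "x \<in> interior (convex hull {a, b, c})"
  obtains u v w where "0 < u" "0 < v" "0 < w" "u + v + w = 1" "x = u *\<^sub>R a + v *\<^sub>R b + w *\<^sub>R c"
proof -
  have "\<exists>u v w. 0 < u \<and> 0 < v \<and> 0 < w \<and> u + v + w = 1 \<and> x = u *\<^sub>R a + v *\<^sub>R b + w *\<^sub>R c"
    using assms(2) unfolding interior_convex_hull_3_minimal[OF assms(1), simplified] by auto
  then show ?thesis using that by metis
qed

lemma barycentric_of_combination:
  fixes a b c :: "real^2"
  assumes "u + v + w = 1" "x = u *\<^sub>R a + v *\<^sub>R b + w *\<^sub>R c"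
  shows "cross2 (b - x) (c - x) = u * cross2 (b - a) (c - a)"
    and "cross2 (c - x) (a - x) = v * cross2 (b - a) (c - a)"
    and "cross2 (a - x) (b - x) = w * cross2 (b - a) (c - a)"
proof -
  have u: "u = 1 - v - w" using assms(1) by simp
  show "cross2 (b - x) (c - x) = u * cross2 (b - a) (c - a)"
    "cross2 (c - x) (a - x) = v * cross2 (b - a) (c - a)"
    "cross2 (a - x) (b - x) = w * cross2 (b - a) (c - a)"
    unfolding assms(2) u cross2_def by (simp_all add: algebra_simps)
qed

text \<open>Let \<open>\<lambda>\<^sub>a\<close> be the barycentric coordinates and \<open>g\<^sub>a = (x - a) \<bullet> G x\<close>. As \<open>\<Sum> \<lambda>\<^sub>a (x - a) = 0\<close>, the terms
\<open>a \<bullet> G x = x \<bullet> G x - g\<^sub>a\<close> satisfy \<open>\<Sum> \<lambda>\<^sub>a (a \<bullet> G x) g\<^sub>a = - \<Sum> \<lambda>\<^sub>a g\<^sub>a\<^sup>2\<close>. By \<open>vertex_bubble_test\<close> for the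
three vertices the integral of the left-hand side is zero, so the continuous nonnegative function
\<open>\<Sum> \<lambda>\<^sub>a g\<^sub>a\<^sup>2\<close> vanishes on the triangle. In the interior all \<open>\<lambda>\<^sub>a\<close> are positive, and \<open>G x\<close> is orthogonal to
all edges.\<close>

lemma zero_weak_grad_rhs_imp_gradient_zero:
  fixes a b c :: "real^2"
  assumes abc: "\<not> collinear {a, b, c}"
    and v: "v \<in> weak_on j (convex hull {a, b, c})"
    and U: "U \<in> polys j" "\<And>x. x \<in> interior (convex hull {a, b, c}) \<Longrightarrow> fst v x = U x"
    and G: "\<And>x. (U has_derivative (\<lambda>h. h \<bullet> G x)) (at x)" "continuous_on UNIV G"
      "\<And>i \<alpha> \<beta> \<gamma>. (\<lambda>x. (\<alpha> + \<beta> * x $ 1 + \<gamma> * x $ 2) * G x $ i) \<in> polys j"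
    and weak_grad_rhs: "\<And>q. q \<in> RT j (convex hull {a, b, c}) \<Longrightarrow> weak_grad_rhs (convex hull {a, b, c}) v q = 0"
    and x: "x \<in> interior (convex hull {a, b, c})"
  shows "G x = 0"
proof -
  let ?K = "convex hull {a, b, c}" and ?D = "cross2 (b - a) (c - a)"
  have aff: "\<not> affine_dependent {a, b, c}" and ne: "a \<noteq> b" "a \<noteq> c" "b \<noteq> c"
    using abc by (auto simp: collinear_3_eq_affine_dependent)
  have K: "2 simplex ?K"
    by (rule simplex_convex_hull) (use aff ne in auto)
  have D: "?D \<noteq> 0" by (rule cross2_collinear[OF abc])
  have perm: "{b, c, a} = {a, b, c}" "{c, a, b} = {a, b, c}" by auto
  define A where "A a b c x = cross2 (b - x) (c - x) * (a \<bullet> G x) * ((x - a) \<bullet> G x)" for a b c x :: "real^2"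
  have crossc: "continuous_on UNIV (\<lambda>x. cross2 (p - x) (q - x))" for p q
    unfolding cross2_def by (intro continuous_intros)
  have Ac: "continuous_on UNIV (A a b c)" for a b c
    unfolding A_def[abs_def] by (intro continuous_intros crossc G(2))
  have "integral ?K (A a b c) = 0"
    using vertex_bubble_test[OF abc v U G weak_grad_rhs] unfolding A_def .
  moreover have "integral ?K (A b c a) = 0"
    using vertex_bubble_test[of b c a v j U G, unfolded perm, OF abc v U G weak_grad_rhs] unfolding A_def .
  moreover have "integral ?K (A c a b) = 0"
    using vertex_bubble_test[of c a b v j U G, unfolded perm, OF abc v U G weak_grad_rhs] unfolding A_def .
  ultimately have int0: "integral ?K (\<lambda>x. A a b c x + A b c a x + A c a b x) = 0"
    using integrable_on_triangle[OF K Ac] by (simp add: Henstock_Kurzweil_Integration.integral_add integrable_add)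
  define H where "H x = cross2 (b - x) (c - x) / ?D * ((x - a) \<bullet> G x)\<^sup>2
     + cross2 (c - x) (a - x) / ?D * ((x - b) \<bullet> G x)\<^sup>2
     + cross2 (a - x) (b - x) / ?D * ((x - c) \<bullet> G x)\<^sup>2" for x
  have AH: "A a b c x + A b c a x + A c a b x = - ?D * H x" for x
  proof -
    define p q r where "p = cross2 (b - x) (c - x)" and "q = cross2 (c - x) (a - x)" and "r = cross2 (a - x) (b - x)"
    have s: "p + q + r = ?D" and comb: "(p / ?D) *\<^sub>R a + (q / ?D) *\<^sub>R b + (r / ?D) *\<^sub>R c = x"
      using barycentric_coordinates[OF abc, of x] D by (simp_all add: p_def q_def r_def add_divide_distrib[symmetric])
    define \<alpha> \<beta> \<gamma> \<xi> where "\<alpha> = a \<bullet> G x" and "\<beta> = b \<bullet> G x" and "\<gamma> = c \<bullet> G x" and "\<xi> = x \<bullet> G x"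
    have "p / ?D * \<alpha> + q / ?D * \<beta> + r / ?D * \<gamma> = \<xi>"
      unfolding \<alpha>_def \<beta>_def \<gamma>_def \<xi>_def by (subst (4) comb[symmetric]) (simp add: inner_add_left)
    then have comb': "p * \<alpha> + q * \<beta> + r * \<gamma> = \<xi> * ?D" using D by (simp add: field_simps)
    have "A a b c x + A b c a x + A c a b x = p * \<alpha> * (\<xi> - \<alpha>) + q * \<beta> * (\<xi> - \<beta>) + r * \<gamma> * (\<xi> - \<gamma>)"
      by (simp add: A_def p_def q_def r_def \<alpha>_def \<beta>_def \<gamma>_def \<xi>_def inner_diff_left)
    also have "\<dots> = - (p * (\<xi> - \<alpha>)\<^sup>2 + q * (\<xi> - \<beta>)\<^sup>2 + r * (\<xi> - \<gamma>)\<^sup>2)"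
    proof -
      have "p * \<alpha> * (\<xi> - \<alpha>) + q * \<beta> * (\<xi> - \<beta>) + r * \<gamma> * (\<xi> - \<gamma>)
          + (p * (\<xi> - \<alpha>)\<^sup>2 + q * (\<xi> - \<beta>)\<^sup>2 + r * (\<xi> - \<gamma>)\<^sup>2)
          = \<xi> * (\<xi> * (p + q + r) - (p * \<alpha> + q * \<beta> + r * \<gamma>))"
        by (simp add: power2_eq_square algebra_simps)
      also have "\<dots> = 0" unfolding s comb' by simp
      finally show ?thesis by linarith
    qed
    also have "\<dots> = - ?D * H x"
      using D by (simp add: H_def p_def q_def r_def \<alpha>_def \<beta>_def \<gamma>_def \<xi>_def inner_diff_left field_simps)
    finally show ?thesis .
  qed
  have Hc: "continuous_on UNIV H"
    unfolding H_def[abs_def] using D by (intro continuous_intros crossc G(2)) auto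
  have "- ?D * integral ?K H = 0"
    using int0 unfolding AH by simp
  then have H0: "integral ?K H = 0" using D by simp
  have Hcomb: "H y = u * ((y - a) \<bullet> G y)\<^sup>2 + v * ((y - b) \<bullet> G y)\<^sup>2 + w * ((y - c) \<bullet> G y)\<^sup>2"
    if "u + v + w = 1" "y = u *\<^sub>R a + v *\<^sub>R b + w *\<^sub>R c" for u v w y
  proof -
    note bary = barycentric_of_combination[OF that]
    have "cross2 (b - y) (c - y) / ?D = u" "cross2 (c - y) (a - y) / ?D = v" "cross2 (a - y) (b - y) / ?D = w"
      unfolding bary by (rule nonzero_mult_div_cancel_right[OF D])+
    then show ?thesis by (simp only: H_def)
  qed
  have Hnn: "H y \<ge> 0" if "y \<in> ?K" for y
  proof -
    obtain u v w where y: "0 \<le> u" "0 \<le> v" "0 \<le> w" "u + v + w = 1" "y = u *\<^sub>R a + v *\<^sub>R b + w *\<^sub>R c"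
      using \<open>y \<in> ?K\<close> by (rule in_triangleE)
    show ?thesis
      unfolding Hcomb[OF y(4,5)] using y(1-3) by (intro add_nonneg_nonneg mult_nonneg_nonneg) auto
  qed
  have "x \<in> ?K" using x interior_subset by blast
  then have Hx: "H x = 0" using triangle_integral_zero_imp[OF K Hc Hnn H0] by blast
  obtain u v w where y: "0 < u" "0 < v" "0 < w" "u + v + w = 1" "x = u *\<^sub>R a + v *\<^sub>R b + w *\<^sub>R c"
    using abc x by (rule in_interior_triangleE)
  have "u * ((x - a) \<bullet> G x)\<^sup>2 + v * ((x - b) \<bullet> G x)\<^sup>2 + w * ((x - c) \<bullet> G x)\<^sup>2 = 0"
    using Hx unfolding Hcomb[OF y(4,5)] .
  moreover have "u * ((x - a) \<bullet> G x)\<^sup>2 \<ge> 0" "v * ((x - b) \<bullet> G x)\<^sup>2 \<ge> 0" "w * ((x - c) \<bullet> G x)\<^sup>2 \<ge> 0"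
    using y by auto
  ultimately have "u * ((x - a) \<bullet> G x)\<^sup>2 = 0" "v * ((x - b) \<bullet> G x)\<^sup>2 = 0" "w * ((x - c) \<bullet> G x)\<^sup>2 = 0"
    by linarith+
  then have "(x - a) \<bullet> G x = 0" "(x - b) \<bullet> G x = 0" "(x - c) \<bullet> G x = 0" using y by auto
  then have "(b - a) \<bullet> G x = 0" "(c - a) \<bullet> G x = 0" by (auto simp: inner_diff_left)
  then have "G x $ 1 * ?D = 0" "G x $ 2 * ?D = 0" unfolding inner_2 cross2_def by algebra+
  then show ?thesis using D by (simp add: vec_eq_iff forall_2)
qed

text \<open>Once the gradient is zero, \<open>weak_grad_rhs_cone_field\<close> reduces to \<open>\<langle>U - v\<^sub>b, p\<rangle> = 0\<close> on each edge, and \<open>p\<close>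
may be chosen as a polynomial that agrees with \<open>U - v\<^sub>b\<close> on the edge.\<close>

lemma zero_weak_grad_rhs_imp_constant:
  assumes K: "2 simplex K" and v: "v \<in> weak_on j K"
    and weak_grad_rhs: "\<And>q. q \<in> RT j K \<Longrightarrow> weak_grad_rhs K v q = 0"
  shows "\<exists>k. (\<forall>x\<in>interior K. fst v x = k) \<and> (\<forall>e x. e edge_of K \<longrightarrow> x \<in> e \<longrightarrow> snd v e x = k)"
proof -
  obtain U where U: "U \<in> polys j" "\<And>x. x \<in> interior K \<Longrightarrow> fst v x = U x"
    using v by (auto simp: weak_on_def elim: P_globalE)
  obtain G where G: "\<And>x. (U has_derivative (\<lambda>h. h \<bullet> G x)) (at x)" "continuous_on UNIV G"
      "\<And>i \<alpha> \<beta> \<gamma>. (\<lambda>x. (\<alpha> + \<beta> * x $ 1 + \<gamma> * x $ 2) * G x $ i) \<in> polys j"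
    using polys_gradient_times_affine[OF U(1)] by blast
  have "G x = 0" if "x \<in> interior K" for x
  proof (rule triangle_simplexE[OF K])
    fix a b c assume abc: "\<not> collinear {a, b, c}" "K = convex hull {a, b, c}"
    show ?thesis
      by (rule zero_weak_grad_rhs_imp_gradient_zero[OF abc(1) v[unfolded abc(2)] U[unfolded abc(2)] G
          weak_grad_rhs[unfolded abc(2)] that[unfolded abc(2)]])
  qed
  then have G0: "G x = 0" if "x \<in> K" for x
    using zero_on_triangle[OF K G(2) _ that] by blast
  have "(U has_derivative (\<lambda>h. 0)) (at x within K)" if "x \<in> K" for x
    using has_derivative_at_withinI[OF G(1)[of x], of K] G0[OF that] by simp
  then obtain k where k: "\<And>x. x \<in> K \<Longrightarrow> U x = k"
    using has_derivative_zero_constant[OF triangle_convex[OF K]] by blast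
  have "snd v e x = k" if e: "e edge_of K" and x: "x \<in> e" for e x
  proof (rule triangle_edgeE[OF K e])
    fix a b c assume abc: "\<not> collinear {a, b, c}" "K = convex hull {a, b, c}" "e = closed_segment b c"
    have "b \<noteq> c" using abc(1) by (auto simp: collinear_3_eq_affine_dependent)
    obtain B where B: "B \<in> polys j" "\<And>x. x \<in> e \<Longrightarrow> snd v e x = B x"
      using v e by (auto simp: weak_on_def elim: P_globalE)
    define p where "p x = U x + (-1) * B x" for x
    have p: "p \<in> polys j" unfolding p_def[abs_def] by (intro polys_add polys_scale U B)
    have "integral K (\<lambda>x. p x * ((x - a) \<bullet> G x)) = integral K (\<lambda>x. 0)"
      by (rule Henstock_Kurzweil_Integration.integral_cong) (simp add: G0)
    then have "\<bar>cross2 (b - a) (c - a)\<bar> / dist b c * edge_integral e (\<lambda>x. (U x - snd v e x) * p x) = 0"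
      using weak_grad_rhs_cone_field[OF abc(1) v[unfolded abc(2)] U[unfolded abc(2)] G(1,2) p]
        weak_grad_rhs[OF polys_cone_field_in_RT[OF p], of a] unfolding abc(2,3) by simp
    then have "edge_integral e (\<lambda>x. (U x - snd v e x) * p x) = 0"
      using cross2_collinear[OF abc(1)] \<open>b \<noteq> c\<close> by simp
    moreover have "edge_integral e (\<lambda>x. (U x - snd v e x) * p x) = edge_integral e (\<lambda>x. p x * p x)"
      unfolding abc(3) by (rule edge_integral_cong) (use B(2) abc(3) in \<open>simp add: p_def\<close>)
    ultimately have "edge_integral (closed_segment b c) (\<lambda>x. p x * p x) = 0" by (simp add: abc(3))
    moreover have "continuous_on (closed_segment b c) (\<lambda>x. p x * p x)"
      by (intro continuous_intros polys_continuous[OF p])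
    ultimately have "p x * p x = 0"
      using edge_integral_eq_0_imp[of b c "\<lambda>x. p x * p x" x] \<open>b \<noteq> c\<close> x abc(3) by simp
    then show ?thesis
      using B(2)[OF x] k edge_of_imp_subset[OF e] x by (auto simp: p_def)
  qed
  moreover have "fst v x = k" if "x \<in> interior K" for x
    unfolding U(2)[OF that] by (rule k[OF subsetD[OF interior_subset that]])
  ultimately show ?thesis by (intro exI[of _ k] conjI ballI allI impI) assumption+
qed

section \<open>The inner product of weak functions\<close>

lemma inner_trace_eq:
  assumes K: "2 simplex K" and U: "continuous_on UNIV U" "\<And>x. x \<in> interior K \<Longrightarrow> v0 x = U x" and x: "x \<in> K"
  shows "inner_trace K v0 x = U x"
proof -
  have "x \<in> closure (interior K)" using x triangle_closure_interior[OF K] by simp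
  then have nt: "at x within interior K \<noteq> bot"
    using interior_limit_point[of x "interior K"]
    by (auto simp: trivial_limit_within closure_def)
  have "(U \<longlongrightarrow> U x) (at x within interior K)"
    using U(1) continuous_on_subset[OF U(1) subset_UNIV, of "insert x (interior K)"]
    by (meson UNIV_I continuous_on_eq_continuous_within continuous_within tendsto_within_subset subset_UNIV)
  then have "(v0 \<longlongrightarrow> U x) (at x within interior K)"
    by (rule Lim_transform_eventually) (use U(2) in \<open>auto simp: eventually_at_filter\<close>)
  then show ?thesis unfolding inner_trace_def by (rule tendsto_Lim[OF nt])
qed

text \<open>The difference across the boundary that enters the second sum of \<^const>\<open>V_inner\<close>. A named function
keeps the linearity of the trace, which holds only on \<open>K\<close>, apart from that of the boundary integral.\<close>

definition jump :: "(real^2) set \<Rightarrow> weak_fun \<Rightarrow> (real^2) set \<Rightarrow> real^2 \<Rightarrow> real" where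
  "jump K v e x = inner_trace K (fst v) x - snd v e x"

lemma jump_properties:
  assumes K: "2 simplex K" and v: "v \<in> weak_on j K" and w: "w \<in> weak_on j K"
  shows "\<And>e. e edge_of K \<Longrightarrow> continuous_on e (jump K v e)"
    and "\<And>e x. x \<in> K \<Longrightarrow> jump K (v + w) e x = jump K v e x + jump K w e x"
    and "\<And>e x c. x \<in> K \<Longrightarrow> jump K (c *\<^sub>R v) e x = c * jump K v e x"
proof -
  obtain U where U: "continuous_on UNIV U" "\<And>x. x \<in> interior K \<Longrightarrow> fst v x = U x"
    using v by (auto simp: weak_on_def elim: P_extends_continuously)
  obtain W where W: "continuous_on UNIV W" "\<And>x. x \<in> interior K \<Longrightarrow> fst w x = W x"
    using w by (auto simp: weak_on_def elim: P_extends_continuously)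
  show "continuous_on e (jump K v e)" if e: "e edge_of K" for e
  proof (rule continuous_on_eq)
    show "continuous_on e (\<lambda>x. U x - snd v e x)"
      using v e by (intro continuous_intros continuous_on_subset[OF U(1)]) (auto simp: weak_on_def P_continuous)
    show "U x - snd v e x = jump K v e x" if "x \<in> e" for x
      using inner_trace_eq[OF K U, of x] edge_of_imp_subset[OF e] that by (auto simp: jump_def)
  qed
  show "jump K (v + w) e x = jump K v e x + jump K w e x" if "x \<in> K" for e x
  proof -
    have "inner_trace K (fst (v + w)) x = U x + W x"
      by (rule inner_trace_eq[OF K _ _ that]) (use U W in \<open>auto intro!: continuous_intros\<close>)
    then show ?thesis
      using inner_trace_eq[OF K U that] inner_trace_eq[OF K W that] by (simp add: jump_def)
  qed
  show "jump K (c *\<^sub>R v) e x = c * jump K v e x" if "x \<in> K" for e x c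
  proof -
    have "inner_trace K (fst (c *\<^sub>R v)) x = c * U x"
      by (rule inner_trace_eq[OF K _ _ that]) (use U in \<open>auto intro!: continuous_intros\<close>)
    then show ?thesis
      using inner_trace_eq[OF K U that] by (simp add: jump_def algebra_simps)
  qed
qed

lemma V_inner_jump:
  "V_inner T v \<phi> = (\<Sum>K\<in>T. L2_inner K (fst v) (fst \<phi>) + diameter K * bd_inner K (jump K v) (jump K \<phi>))"
proof -
  have "(\<lambda>e x. inner_trace K (fst v) x - snd v e x) = jump K v" for K v
    by (intro ext) (simp add: jump_def)
  then show ?thesis unfolding V_inner_def sum.distrib by simp
qed

lemma V_inner_commute: "V_inner T v w = V_inner T w v"
  unfolding V_inner_jump by (simp add: L2_inner_commute bd_inner_commute)

lemma weak_on_L2: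
  assumes "2 simplex K" "v \<in> weak_on j K"
  shows "fst v \<in> L2 K"
proof -
  obtain U where "continuous_on UNIV U" "\<And>x. x \<in> interior K \<Longrightarrow> fst v x = U x"
    using assms(2) by (auto simp: weak_on_def elim: P_extends_continuously)
  then show ?thesis by (rule L2_triangle[OF assms(1)])
qed

context
  fixes T :: "(real^2) set set" and \<Omega> :: "(real^2) set" and j :: nat
  assumes T: "triangulation_of T \<Omega>" and \<Omega>: "polygonal_domain \<Omega>"
begin

lemma V_inner_linear_left:
  assumes \<phi>: "\<phi> \<in> V_space j T"
  shows "linear_on (V_space j T) (\<lambda>v. V_inner T v \<phi>)"
proof (rule linear_onI)
  note W = V_weak_on[OF T \<Omega>]
  show "V_inner T (v + w) \<phi> = V_inner T v \<phi> + V_inner T w \<phi>"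
    if v: "v \<in> V_space j T" and w: "w \<in> V_space j T" for v w
    unfolding V_inner_jump sum.distrib[symmetric]
  proof (rule sum.cong[OF refl])
    fix K assume K: "K \<in> T"
    note s = mesh_simplex[OF T K]
    note J = jump_properties[OF s W[OF v K] W[OF w K]]
    have "L2_inner K (\<lambda>x. fst v x + fst w x) (fst \<phi>) = L2_inner K (fst v) (fst \<phi>) + L2_inner K (fst w) (fst \<phi>)"
      by (rule L2_inner_add_left[OF mesh_measurable[OF T \<Omega> K]]; rule weak_on_L2[OF s W[OF _ K]]) (rule v w \<phi>)+
    moreover have "bd_inner K (jump K (v + w)) (jump K \<phi>)
        = bd_inner K (\<lambda>e x. jump K v e x + jump K w e x) (jump K \<phi>)"
    proof (rule bd_inner_cong[OF s])
      fix e x assume "e edge_of K" "x \<in> e"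
      then have "x \<in> K" using edge_of_imp_subset by blast
      then show "jump K (v + w) e x * jump K \<phi> e x = (jump K v e x + jump K w e x) * jump K \<phi> e x"
        by (simp add: J(2))
    qed
    moreover have "\<dots> = bd_inner K (jump K v) (jump K \<phi>) + bd_inner K (jump K w) (jump K \<phi>)"
      by (rule bd_inner_add_left[OF s])
         (auto intro: jump_properties(1)[OF s W[OF v K] W[OF v K]] jump_properties(1)[OF s W[OF w K] W[OF w K]]
            jump_properties(1)[OF s W[OF \<phi> K] W[OF \<phi> K]])
    ultimately show "L2_inner K (fst (v + w)) (fst \<phi>) + diameter K * bd_inner K (jump K (v + w)) (jump K \<phi>)
      = (L2_inner K (fst v) (fst \<phi>) + diameter K * bd_inner K (jump K v) (jump K \<phi>))
      + (L2_inner K (fst w) (fst \<phi>) + diameter K * bd_inner K (jump K w) (jump K \<phi>))"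
      by (simp add: plus_fun_def algebra_simps)
  qed
  show "V_inner T (c *\<^sub>R v) \<phi> = c * V_inner T v \<phi>" if v: "v \<in> V_space j T" for c v
    unfolding V_inner_jump sum_distrib_left
  proof (rule sum.cong[OF refl])
    fix K assume K: "K \<in> T"
    note s = mesh_simplex[OF T K]
    have "bd_inner K (jump K (c *\<^sub>R v)) (jump K \<phi>) = bd_inner K (\<lambda>e x. c * jump K v e x) (jump K \<phi>)"
    proof (rule bd_inner_cong[OF s])
      fix e x assume "e edge_of K" "x \<in> e"
      then have "x \<in> K" using edge_of_imp_subset by blast
      then show "jump K (c *\<^sub>R v) e x * jump K \<phi> e x = c * jump K v e x * jump K \<phi> e x"
        by (simp add: jump_properties(3)[OF s W[OF v K] W[OF v K]])
    qed
    also have "\<dots> = c * bd_inner K (jump K v) (jump K \<phi>)" by (rule bd_inner_scale_left[OF s])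
    finally show "L2_inner K (fst (c *\<^sub>R v)) (fst \<phi>) + diameter K * bd_inner K (jump K (c *\<^sub>R v)) (jump K \<phi>)
      = c * (L2_inner K (fst v) (fst \<phi>) + diameter K * bd_inner K (jump K v) (jump K \<phi>))"
      using L2_inner_scale_left[of K c "fst v" "fst \<phi>"] by (simp add: scaleR_fun_def algebra_simps)
  qed
qed

lemma V_eq_zeroI:
  assumes v: "v \<in> V_space j T"
    and int: "\<And>K x. K \<in> T \<Longrightarrow> x \<in> interior K \<Longrightarrow> fst v x = 0"
    and bd: "\<And>K e x. K \<in> T \<Longrightarrow> e edge_of K \<Longrightarrow> x \<in> e \<Longrightarrow> snd v e x = 0"
  shows "v = 0"
proof -
  have "fst v x = 0" for x
    using v int by (cases "x \<in> (\<Union>K\<in>T. interior K)") (auto simp: V_space_def)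
  moreover have "snd v e x = 0" for e x
    using v bd by (cases "e \<in> edges T \<and> x \<in> e") (auto simp: V_space_def edges_def)
  ultimately show ?thesis by (simp add: prod_eq_iff fun_eq_iff)
qed

lemma V_inner_definite:
  assumes v: "v \<in> V_space j T" and 0: "V_inner T v v = 0"
  shows "v = 0"
proof (rule V_eq_zeroI[OF v])
  note W = V_weak_on[OF T \<Omega> v]
  have nnL: "L2_inner K (fst v) (fst v) \<ge> 0" for K
    unfolding L2_inner_def set_lebesgue_integral_def
    by (rule Bochner_Integration.integral_nonneg) (auto simp: indicator_def)
  have nnE: "edge_integral e (\<lambda>x. jump K v e x * jump K v e x) \<ge> 0" if "K \<in> T" "e edge_of K" for e K
  proof (rule triangle_edge_segmentE[OF mesh_simplex[OF T that(1)] that(2)])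
    fix b c assume "e = closed_segment b c"
    then show ?thesis using edge_integral_nonneg[of b c "\<lambda>x. jump K v e x * jump K v e x"] by simp
  qed
  have nnB: "bd_inner K (jump K v) (jump K v) \<ge> 0" if "K \<in> T" for K
    unfolding bd_inner_def by (rule sum_nonneg) (use nnE[OF that] in auto)
  have bK: "bounded K" if "K \<in> T" for K
    using triangle_compact[OF mesh_simplex[OF T that]] compact_imp_bounded by blast
  have dK: "diameter K \<ge> 0" if "K \<in> T" for K by (rule diameter_ge_0[OF bK[OF that]])
  have terms: "L2_inner K (fst v) (fst v) = 0" "diameter K * bd_inner K (jump K v) (jump K v) = 0" if K: "K \<in> T" for K
  proof -
    have "L2_inner K (fst v) (fst v) + diameter K * bd_inner K (jump K v) (jump K v) = 0"
      using 0 sum_nonneg_eq_0_iff[OF finite_mesh[OF T],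
          of "\<lambda>K. L2_inner K (fst v) (fst v) + diameter K * bd_inner K (jump K v) (jump K v)"]
        nnL nnB dK K unfolding V_inner_jump by auto
    moreover have "diameter K * bd_inner K (jump K v) (jump K v) \<ge> 0" using nnB[OF K] dK[OF K] by simp
    ultimately show "L2_inner K (fst v) (fst v) = 0" "diameter K * bd_inner K (jump K v) (jump K v) = 0"
      using nnL[of K] by linarith+
  qed
  {
    fix K x assume K: "K \<in> T"
    note s = mesh_simplex[OF T K]
    obtain U where U: "continuous_on UNIV U" "\<And>x. x \<in> interior K \<Longrightarrow> fst v x = U x"
      using W[OF K] by (auto simp: weak_on_def elim: P_extends_continuously)
    have "integral K (\<lambda>x. U x \<bullet> U x) = 0"
      using terms(1)[OF K] L2_inner_triangle[OF s U(1) U(1) U(2) U(2)] by simp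
    then have U0: "U x = 0" if "x \<in> K" for x
      using triangle_integral_zero_imp[OF s, of "\<lambda>x. U x \<bullet> U x" x] U(1) that by (auto intro!: continuous_intros)
    show "fst v x = 0" if "x \<in> interior K" using U(2)[OF that] U0 that interior_subset by auto
    show "snd v e x = 0" if e: "e edge_of K" and x: "x \<in> e" for e
    proof (rule triangle_edge_segmentE[OF s e])
      fix b c assume bc: "e = closed_segment b c" "b \<noteq> c"
      have "b \<in> K" "c \<in> K" using edge_of_imp_subset[OF e] bc(1) by auto
      then have "dist b c \<le> diameter K" using diameter_bounded_bound[OF bK[OF K]] by blast
      then have "diameter K > 0" using bc(2) zero_less_dist_iff[of b c] by linarith
      then have "bd_inner K (jump K v) (jump K v) = 0" using terms(2)[OF K] by simp
      then have "edge_integral e (\<lambda>x. jump K v e x * jump K v e x) = 0"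
        unfolding bd_inner_def
        using sum_nonneg_eq_0_iff[OF finite_edges_of_triangle[OF s], of "\<lambda>e. edge_integral e (\<lambda>x. jump K v e x * jump K v e x)"]
          nnE[OF K] e by auto
      moreover have "continuous_on e (jump K v e)"
        by (rule jump_properties(1)[OF s W[OF K] W[OF K] e])
      ultimately have "jump K v e x * jump K v e x = 0"
        using edge_integral_eq_0_imp[of b c "\<lambda>x. jump K v e x * jump K v e x" x] bc x
        by (auto intro!: continuous_intros)
      moreover have "x \<in> K" using edge_of_imp_subset[OF e] x by blast
      ultimately show ?thesis
        using inner_trace_eq[OF s U \<open>x \<in> K\<close>] U0 by (simp add: jump_def)
    qed
  }
qed

section \<open>Injectivity of the weak gradient under the boundary condition\<close>

lemma finite_mesh_edges: "finite (edges T)"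
proof -
  have "edges T = (\<Union>K\<in>T. {e. e edge_of K})" by (auto simp: edges_def)
  then show ?thesis
    using finite_mesh[OF T] finite_edges_of_triangle mesh_simplex[OF T] by auto
qed

text \<open>On each triangle \<open>u\<close> is a constant \<open>k K\<close>. The field \<open>q = x\<close> belongs to the Raviart-Thomas space and has
divergence \<open>2\<close>; testing with it and multiplying by \<open>k K\<close> expresses \<open>2 (k K)\<^sup>2 |K|\<close> by integrals of
\<open>u\<^sub>b\<^sup>2 x \<bullet> n\<close> over the edges. As \<open>u\<^sub>b\<close> is single-valued, these cancel in pairs at the edges inside \<open>\<Omega>\<close>.\<close>

lemma weak_grad_zero_imp_zero:
  assumes u: "u \<in> V0_space j \<Omega> T" and 0: "weak_grad j \<Omega> T u = 0"
  shows "u = 0"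
proof -
  have uV: "u \<in> V_space j T" using u by (simp add: V0_space_def)
  have weak_grad_rhs: "weak_grad_rhs K u q = 0" if "K \<in> T" "q \<in> RT j K" for K q
    using weak_grad(2)[OF T \<Omega> uV that] by (simp add: 0 L2_inner_def)
  have "\<exists>k. (\<forall>x\<in>interior K. fst u x = k) \<and> (\<forall>e x. e edge_of K \<longrightarrow> x \<in> e \<longrightarrow> snd u e x = k)" if "K \<in> T" for K
    by (rule zero_weak_grad_rhs_imp_constant[OF mesh_simplex[OF T that] V_weak_on[OF T \<Omega> uV that] weak_grad_rhs[OF that]])
  then obtain k where k: "\<And>K x. K \<in> T \<Longrightarrow> x \<in> interior K \<Longrightarrow> fst u x = k K"
    "\<And>K e x. K \<in> T \<Longrightarrow> e edge_of K \<Longrightarrow> x \<in> e \<Longrightarrow> snd u e x = k K" by metis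
  define I where "I K e = edge_integral e (\<lambda>x. (snd u e x * snd u e x) * (x \<bullet> outward_normal K e))" for K e
  have local: "integral K (\<lambda>x. 2 * (k K)\<^sup>2) = (\<Sum>e | e edge_of K. I K e)" if K: "K \<in> T" for K
  proof -
    note s = mesh_simplex[OF T K]
    have "(\<lambda>x. x) \<in> RT j K"
      using polys_cone_field_in_RT[OF polys_const, of 1 0 j K] by simp
    then have "weak_grad_rhs K u (\<lambda>x. x) = 0" by (rule weak_grad_rhs[OF K])
    then have id: "L2_inner K (fst u) (divergence (\<lambda>x. x))
        = bd_inner K (snd u) (\<lambda>e x. x \<bullet> outward_normal K e)"
      by (simp add: weak_grad_rhs_def)
    have div: "divergence (\<lambda>x. x) x = 2" for x
      using divergence_cone_field[of "\<lambda>x. 1" 0 x 0] by simp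
    have "L2_inner K (fst u) (divergence (\<lambda>x. x)) = integral K (\<lambda>x. k K \<bullet> 2)"
      by (rule L2_inner_triangle[OF s]) (auto simp: div k(1)[OF K])
    then have "integral K (\<lambda>x. 2 * (k K)\<^sup>2) = k K * bd_inner K (snd u) (\<lambda>e x. x \<bullet> outward_normal K e)"
      using id Henstock_Kurzweil_Integration.integral_mult_right[of K "k K" "\<lambda>x. k K * 2"]
      by (simp add: power2_eq_square mult.commute mult.left_commute)
    also have "\<dots> = (\<Sum>e | e edge_of K. I K e)"
      unfolding bd_inner_def sum_distrib_left
    proof (rule sum.cong[OF refl])
      fix e assume "e \<in> {e. e edge_of K}"
      then have e: "e edge_of K" by simp
      obtain b c where bc: "e = closed_segment b c" by (rule triangle_edge_segmentE[OF s e])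
      show "k K * edge_integral e (\<lambda>x. snd u e x * (x \<bullet> outward_normal K e)) = I K e"
        unfolding I_def bc edge_integral_scale[symmetric]
        by (rule edge_integral_cong) (use k(2)[OF K e] bc in simp)
    qed
    finally show ?thesis .
  qed
  have edge0: "(\<Sum>K | K \<in> T \<and> e edge_of K. I K e) = 0" if e: "e \<in> edges T" for e
  proof -
    obtain K0 where K0: "K0 \<in> T" "e edge_of K0" using e by (auto simp: edges_def)
    obtain b c where bc: "e = closed_segment b c" by (rule triangle_edge_segmentE[OF mesh_simplex[OF T K0(1)] K0(2)])
    show ?thesis
    proof (cases "e \<subseteq> frontier \<Omega>")
      case True
      then have z: "snd u e x = 0" if "x \<in> e" for x using u e that by (auto simp: V0_space_def)
      have "I K e = edge_integral e (\<lambda>x. 0 * 0)" for K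
        unfolding I_def bc by (rule edge_integral_cong) (use z bc in simp)
      then have "I K e = 0" for K unfolding bc edge_integral_scale by simp
      then show ?thesis by simp
    next
      case False
      then obtain K1 K2 where K12: "K1 \<noteq> K2" "{K\<in>T. e edge_of K} = {K1, K2}"
        "outward_normal K2 e = - outward_normal K1 e"
        using interior_edge_two_triangles[OF T \<Omega> e] by blast
      have "I K2 e = edge_integral e (\<lambda>x. (-1) * ((snd u e x * snd u e x) * (x \<bullet> outward_normal K1 e)))"
        unfolding I_def K12(3) by simp
      also have "\<dots> = - I K1 e" unfolding I_def bc edge_integral_scale by simp
      finally show ?thesis using K12(1) by (simp add: K12(2))
    qed
  qed
  have "(\<Sum>K\<in>T. integral K (\<lambda>x. 2 * (k K)\<^sup>2)) = (\<Sum>K\<in>T. \<Sum>e | e \<in> edges T \<and> e edge_of K. I K e)"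
  proof (rule sum.cong[OF refl])
    fix K assume K: "K \<in> T"
    then have eq: "{e. e edge_of K} = {e. e \<in> edges T \<and> e edge_of K}" by (auto simp: edges_def)
    show "integral K (\<lambda>x. 2 * (k K)\<^sup>2) = (\<Sum>e | e \<in> edges T \<and> e edge_of K. I K e)"
      unfolding local[OF K] eq ..
  qed
  also have "\<dots> = (\<Sum>e\<in>edges T. \<Sum>K | K \<in> T \<and> e edge_of K. I K e)"
    by (rule sum.swap_restrict[OF finite_mesh[OF T] finite_mesh_edges])
  also have "\<dots> = 0" by (simp add: edge0)
  finally have sum0: "(\<Sum>K\<in>T. integral K (\<lambda>x. 2 * (k K)\<^sup>2)) = 0" .
  have nn: "integral K (\<lambda>x::real^2. 2 * (k K)\<^sup>2) \<ge> 0" if "K \<in> T" for K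
    by (rule Henstock_Kurzweil_Integration.integral_nonneg) (auto intro: integrable_on_triangle mesh_simplex[OF T that])
  have k0: "k K = 0" if K: "K \<in> T" for K
  proof -
    note s = mesh_simplex[OF T K]
    have "\<forall>K\<in>T. integral K (\<lambda>x. 2 * (k K)\<^sup>2) = 0"
      by (rule iffD1[OF sum_nonneg_eq_0_iff[OF finite_mesh[OF T] nn] sum0])
    then have "integral K (\<lambda>x. 2 * (k K)\<^sup>2) = 0" by (rule bspec[OF _ K])
    moreover obtain x where "x \<in> K" using triangle_interior_nonempty[OF s] interior_subset by blast
    ultimately have "2 * (k K)\<^sup>2 = 0"
      using triangle_integral_zero_imp[OF s, of "\<lambda>x. 2 * (k K)\<^sup>2" x] by auto
    then show ?thesis by simp
  qed
  show ?thesis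
    by (rule V_eq_zeroI[OF uV]) (use k k0 in auto)
qed

section \<open>Existence and uniqueness\<close>

lemma V_finite_dimensional: "\<exists>B. finite B \<and> V_space j T \<subseteq> span B"
proof -
  define on_elem :: "(real^2) set \<Rightarrow> (real^2 \<Rightarrow> real) \<Rightarrow> weak_fun"
    where "on_elem K p = (zero_extend (interior K) p, 0)" for K p
  define on_edge :: "(real^2) set \<Rightarrow> (real^2 \<Rightarrow> real) \<Rightarrow> weak_fun"
    where "on_edge e p = (0, \<lambda>e'. if e' = e then zero_extend e p else 0)" for e p
  have lin: "linear (on_elem K)" "linear (on_edge e)" for K e
    by (rule linearI; auto simp: on_elem_def on_edge_def zero_extend_def fun_eq_iff)+
  define B where "B = (\<Union>K\<in>T. on_elem K ` monomials j) \<union> (\<Union>e\<in>edges T. on_edge e ` monomials j)"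
  have inB1: "on_elem K p \<in> span B" if "K \<in> T" "p \<in> polys j" for K p
  proof -
    have "on_elem K p \<in> span (on_elem K ` monomials j)"
      using that(2) unfolding linear_span_image[OF lin(1)] polys_eq_span by blast
    moreover have "span (on_elem K ` monomials j) \<subseteq> span B"
      by (rule span_mono) (use that(1) in \<open>auto simp: B_def\<close>)
    ultimately show ?thesis by blast
  qed
  have inB2: "on_edge e p \<in> span B" if "e \<in> edges T" "p \<in> polys j" for e p
  proof -
    have "on_edge e p \<in> span (on_edge e ` monomials j)"
      using that(2) unfolding linear_span_image[OF lin(2)] polys_eq_span by blast
    moreover have "span (on_edge e ` monomials j) \<subseteq> span B"
      by (rule span_mono) (use that(1) in \<open>auto simp: B_def\<close>)
    ultimately show ?thesis by blast
  qed
  have "v \<in> span B" if v: "v \<in> V_space j T" for v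
  proof -
    have "\<exists>p. p \<in> polys j \<and> (\<forall>x\<in>interior K. fst v x = p x)" if "K \<in> T" for K
    proof -
      have "fst v \<in> P j (interior K)" using V_weak_on[OF T \<Omega> v that] by (simp add: weak_on_def)
      then show ?thesis by (rule P_globalE) auto
    qed
    then obtain p where p: "\<And>K. K \<in> T \<Longrightarrow> p K \<in> polys j" "\<And>K x. K \<in> T \<Longrightarrow> x \<in> interior K \<Longrightarrow> fst v x = p K x"
      by metis
    have "\<exists>q. q \<in> polys j \<and> (\<forall>x\<in>e. snd v e x = q x)" if "e \<in> edges T" for e
    proof -
      have "snd v e \<in> P j e" using v that by (auto simp: V_space_def)
      then show ?thesis by (rule P_globalE) auto
    qed
    then obtain q where q: "\<And>e. e \<in> edges T \<Longrightarrow> q e \<in> polys j" "\<And>e x. e \<in> edges T \<Longrightarrow> x \<in> e \<Longrightarrow> snd v e x = q e x"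
      by metis
    have "fst v x = (\<Sum>K\<in>T. zero_extend (interior K) (p K) x)" for x
    proof (cases "\<exists>K\<in>T. x \<in> interior K")
      case True
      then obtain K where K: "K \<in> T" "x \<in> interior K" by blast
      have "zero_extend (interior K') (p K') x = (if K' = K then fst v x else 0)" if "K' \<in> T" for K'
        using mesh_interiors_disjoint[OF T that K(1)] K interior_subset[of K] p(2)[OF K] by (auto simp: zero_extend_def)
      then show ?thesis using K finite_mesh[OF T] by simp
    next
      case False
      then show ?thesis using v by (auto simp: V_space_def zero_extend_def)
    qed
    then have 1: "fst v = (\<Sum>K\<in>T. zero_extend (interior K) (p K))"
      by (simp add: fun_eq_iff sum_fun_apply)
    have "snd v e x = (\<Sum>e'\<in>edges T. (if e = e' then zero_extend e' (q e') else 0) x)" for e x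
    proof -
      have "(\<Sum>e'\<in>edges T. (if e = e' then zero_extend e' (q e') else 0) x)
          = (\<Sum>e'\<in>edges T. if e = e' then zero_extend e' (q e') x else 0)"
        by (rule sum.cong) auto
      also have "\<dots> = (if e \<in> edges T then zero_extend e (q e) x else 0)"
        using finite_mesh_edges by simp
      also have "\<dots> = snd v e x" using v q by (auto simp: zero_extend_def V_space_def)
      finally show ?thesis by simp
    qed
    then have 2: "snd v = (\<Sum>e'\<in>edges T. (\<lambda>e. if e = e' then zero_extend e' (q e') else 0))"
      by (simp add: fun_eq_iff sum_fun_apply)
    have "v = (\<Sum>K\<in>T. on_elem K (p K)) + (\<Sum>e\<in>edges T. on_edge e (q e))"
      by (simp add: prod_eq_iff fst_sum snd_sum on_elem_def on_edge_def 1 2)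
    also have "\<dots> \<in> span B" by (intro span_add span_sum inB1 inB2 p q)
    finally show ?thesis .
  qed
  moreover have "finite B"
    using finite_mesh[OF T] finite_mesh_edges finite_monomials by (simp add: B_def)
  ultimately show ?thesis by blast
qed

end

lemma span_Times_superset:
  "X \<times> Y \<subseteq> span (A \<times> {0} \<union> {0} \<times> B)" if "X \<subseteq> span A" "Y \<subseteq> span B"
  for A :: "'a::real_vector set" and B :: "'b::real_vector set"
proof
  fix z assume z: "z \<in> X \<times> Y"
  have l: "linear (\<lambda>x::'a. (x, 0::'b))" "linear (\<lambda>y::'b. (0::'a, y))"
    by (auto intro!: linearI)
  have e: "span ((\<lambda>x::'a. (x, 0::'b)) ` A) = (\<lambda>x. (x, 0)) ` span A"
    "span ((\<lambda>y::'b. (0::'a, y)) ` B) = (\<lambda>y. (0, y)) ` span B"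
    by (rule linear_span_image[OF l(1)], rule linear_span_image[OF l(2)])
  have "fst z \<in> span A" "snd z \<in> span B" using z that by auto
  then have "(fst z, 0::'b) \<in> span ((\<lambda>x. (x, 0)) ` A)" "(0::'a, snd z) \<in> span ((\<lambda>y. (0, y)) ` B)"
    unfolding e by blast+
  moreover have "span ((\<lambda>x. (x, 0)) ` A) \<subseteq> span (A \<times> {0::'b} \<union> {0} \<times> B)"
    "span ((\<lambda>y. (0, y)) ` B) \<subseteq> span (A \<times> {0} \<union> {0::'a} \<times> B)"
    by (rule span_mono; auto)+
  ultimately have "(fst z, 0) + (0, snd z) \<in> span (A \<times> {0} \<union> {0} \<times> B)"
    by (intro span_add) blast+
  then show "z \<in> span (A \<times> {0} \<union> {0} \<times> B)" by simp
qed

theorem theorem2p2: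
  fixes \<Omega> :: "(real^2) set" and T :: "(real^2) set set" and f :: "real^2 \<Rightarrow> real"
    and j :: nat and \<sigma> \<tau> :: real
  assumes "polygonal_domain \<Omega>"
    and "f \<in> L2 \<Omega>"
    and "triangulation_of T \<Omega>"
    and "\<sigma> > 0" and "shape_regular \<sigma> T"
    and "\<tau> > 0" and "quasi_uniform \<tau> T"
  shows "\<exists>!(u, w). u \<in> V0_space j \<Omega> T \<and> w \<in> V_space j T \<and>
    (\<forall>\<phi>\<in>V_space j T.
       V_inner T w \<phi> - L2_inner \<Omega> (weak_grad j \<Omega> T u) (weak_grad j \<Omega> T \<phi>) = 0) \<and>
    (\<forall>\<psi>\<in>V0_space j \<Omega> T.
       L2_inner \<Omega> (weak_grad j \<Omega> T w) (weak_grad j \<Omega> T \<psi>) = L2_inner \<Omega> f (fst \<psi>))"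
proof -
  note T = assms(3) and \<Omega> = assms(1)
  let ?V = "V_space j T" and ?Z = "V0_space j \<Omega> T" and ?g = "weak_grad j \<Omega> T"
  define grad where "grad u v = L2_inner \<Omega> (?g u) (?g v)" for u v
  define form where "form z y = V_inner T (snd z) (snd y) - grad (fst z) (snd y) + grad (snd z) (fst y)"
    for z y :: "weak_fun \<times> weak_fun"
  define X where "X = ?Z \<times> ?V"
  note sV = subspace_V[OF T \<Omega>, of j] and sV0 = subspace_V0[OF T \<Omega>, of j] and sub = V0_subset_V[OF T \<Omega>, of j]
  have meas: "\<Omega> \<in> sets lebesgue" using open_domain[OF T \<Omega>] by auto
  have gL: "?g v \<in> L2 \<Omega>" if "v \<in> ?V" for v
    by (rule Sigma_L2(1)[OF T \<Omega> weak_grad(1)[OF T \<Omega> that]])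
  have grad_sym: "grad u v = grad v u" for u v unfolding grad_def by (rule L2_inner_commute)
  have grad_lin: "linear_on ?V (\<lambda>u. grad u v)" if v: "v \<in> ?V" for v
  proof (rule linear_onI)
    show "grad (u + w) v = grad u v + grad w v" if "u \<in> ?V" "w \<in> ?V" for u w
      using L2_inner_add_left[OF meas gL[OF that(1)] gL[OF that(2)] gL[OF v]]
      by (simp add: grad_def weak_grad_add[OF T \<Omega> that] plus_fun_def)
    show "grad (c *\<^sub>R u) v = c * grad u v" if "u \<in> ?V" for c u
      using L2_inner_scale_left[of \<Omega> c "?g u" "?g v"]
      by (simp add: grad_def weak_grad_scale[OF T \<Omega> that] scaleR_fun_def)
  qed
  have grad_lin': "linear_on ?V (grad v)" if v: "v \<in> ?V" for v
  proof -
    have "grad v = (\<lambda>u. grad u v)" by (rule ext) (rule grad_sym)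
    then show ?thesis using grad_lin[OF v] by metis
  qed
  note V_lin = V_inner_linear_left[OF T \<Omega>, of _ j]
  have V_lin': "linear_on ?V (V_inner T v)" if v: "v \<in> ?V" for v
  proof -
    have "V_inner T v = (\<lambda>u. V_inner T u v)" by (rule ext) (rule V_inner_commute)
    then show ?thesis using V_lin[OF v] by metis
  qed
  have sX: "subspace X" unfolding X_def by (rule subspace_Times[OF sV0 sV])
  have form_left: "linear_on X (\<lambda>z. form z y)" if "y \<in> X" for y
  proof -
    have y: "fst y \<in> ?V" "snd y \<in> ?V" using that sub by (auto simp: X_def)
    show ?thesis
    proof (rule linear_onI)
      show "form (z + z') y = form z y + form z' y" if "z \<in> X" "z' \<in> X" for z z'
      proof -
        have "fst z \<in> ?V" "snd z \<in> ?V" "fst z' \<in> ?V" "snd z' \<in> ?V" using that sub by (auto simp: X_def)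
        then show ?thesis
          using V_lin[OF y(2)] grad_lin[OF y(2)] grad_lin[OF y(1)] by (simp add: form_def linear_on_def)
      qed
      show "form (c *\<^sub>R z) y = c * form z y" if "z \<in> X" for c z
      proof -
        have "fst z \<in> ?V" "snd z \<in> ?V" using that sub by (auto simp: X_def)
        then show ?thesis
          using V_lin[OF y(2)] grad_lin[OF y(2)] grad_lin[OF y(1)] by (simp add: form_def linear_on_def algebra_simps)
      qed
    qed
  qed
  have form_right: "linear_on X (form y)" if "y \<in> X" for y
  proof -
    have y: "fst y \<in> ?V" "snd y \<in> ?V" using that sub by (auto simp: X_def)
    show ?thesis
    proof (rule linear_onI)
      show "form y (z + z') = form y z + form y z'" if "z \<in> X" "z' \<in> X" for z z'
      proof -
        have "fst z \<in> ?V" "snd z \<in> ?V" "fst z' \<in> ?V" "snd z' \<in> ?V" using that sub by (auto simp: X_def)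
        then show ?thesis
          using V_lin'[OF y(2)] grad_lin'[OF y(2)] grad_lin'[OF y(1)] by (simp add: form_def linear_on_def)
      qed
      show "form y (c *\<^sub>R z) = c * form y z" if "z \<in> X" for c z
      proof -
        have "fst z \<in> ?V" "snd z \<in> ?V" using that sub by (auto simp: X_def)
        then show ?thesis
          using V_lin'[OF y(2)] grad_lin'[OF y(2)] grad_lin'[OF y(1)] by (simp add: form_def linear_on_def algebra_simps)
      qed
    qed
  qed
  have grad_definite: "u = 0" if u: "u \<in> ?Z" and 0: "grad u u = 0" for u
  proof (rule weak_grad_zero_imp_zero[OF T \<Omega> u])
    have uV: "u \<in> ?V" using u sub by blast
    have S: "?g u \<in> Sigma_space j \<Omega> T" by (rule weak_grad(1)[OF T \<Omega> uV])
    have int: "set_integrable lebesgue \<Omega> (\<lambda>x. ?g u x \<bullet> ?g u x)"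
      by (rule L2_integrable_inner[OF meas gL[OF uV] gL[OF uV]])
    have hk: "(\<lambda>x. ?g u x \<bullet> ?g u x) integrable_on \<Omega>" "integral \<Omega> (\<lambda>x. ?g u x \<bullet> ?g u x) = 0"
      using set_lebesgue_integral_eq_integral[OF int] 0 by (auto simp: grad_def L2_inner_def)
    show "?g u = 0"
    proof
      fix x
      show "?g u x = 0 x"
      proof (cases "\<exists>K\<in>T. x \<in> interior K")
        case True
        then obtain K where K: "K \<in> T" "x \<in> interior K" by blast
        have "?g u \<in> RT j (interior K)" using S K(1) by (auto simp: Sigma_space_def)
        then obtain Q where Q: "continuous_on UNIV Q" "\<And>x. x \<in> interior K \<Longrightarrow> ?g u x = Q x"
          by (rule RT_extends_continuously) blast
        have "Q x \<bullet> Q x = 0"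
          by (rule integral_zero_imp_zero_on_open[OF hk(1) _ hk(2) open_interior interior_mesh_subset[OF T \<Omega> K(1)], of "\<lambda>x. Q x \<bullet> Q x"])
             (use Q K in \<open>auto intro!: continuous_intros\<close>)
        then show ?thesis using Q(2)[OF K(2)] by simp
      next
        case False
        then show ?thesis using S by (auto simp: Sigma_space_def)
      qed
    qed
  qed
  have definite: "z = 0" if z: "z \<in> X" and 0: "form z z = 0" "form (0, fst z) z = 0 \<or> form z (0, fst z) = 0" for z
  proof -
    have u: "fst z \<in> ?Z" "fst z \<in> ?V" and w: "snd z \<in> ?V" using z sub by (auto simp: X_def)
    have "V_inner T (snd z) (snd z) = 0" using 0(1) grad_sym[of "fst z" "snd z"] by (simp add: form_def)
    then have w0: "snd z = 0" by (rule V_inner_definite[OF T \<Omega> w])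
    have "V_inner T 0 (fst z) = 0" "V_inner T (fst z) 0 = 0"
      using linear_on_zero[OF V_lin[OF u(2)] sV] linear_on_zero[OF V_lin'[OF u(2)] sV] by auto
    moreover have "grad 0 v = 0" "grad v 0 = 0" if "v \<in> ?V" for v
      using linear_on_zero[OF grad_lin[OF that] sV] linear_on_zero[OF grad_lin'[OF that] sV] by auto
    moreover have "(0::weak_fun) \<in> ?V" using sV by (rule subspace_0)
    ultimately have "grad (fst z) (fst z) = 0"
      using 0(2) u(2) by (auto simp: form_def w0)
    then have "fst z = 0" by (rule grad_definite[OF u(1)])
    with w0 show ?thesis by (simp add: prod_eq_iff)
  qed
  \<comment> \<open>the pair \<open>(0, u)\<close> tests the first equation with \<open>\<phi> = u\<close>; the zero alternatives in \<open>definite\<close> serve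
      uniqueness (test on the right) and solvability (test on the left)\<close>
  have in_X: "(0, fst z) \<in> X" if "z \<in> X" for z
    using that sub sV0 by (auto simp: X_def subspace_0)
  define l where "l y = L2_inner \<Omega> f (fst (fst y))" for y :: "weak_fun \<times> weak_fun"
  have "linear_on X l"
  proof -
    have L: "fst v \<in> L2 \<Omega>" if v: "v \<in> ?V" for v
    proof (rule L2_piecewise_on_mesh[OF T open_domain[OF T \<Omega>]])
      fix K assume "K \<in> T"
      then have "fst v \<in> P j (interior K)" using V_weak_on[OF T \<Omega> v] by (auto simp: weak_on_def)
      then show "\<exists>H. continuous_on UNIV H \<and> (\<forall>x\<in>interior K. fst v x = H x)"
        by (rule P_extends_continuously) blast
    qed
    have lin: "linear_on (L2 \<Omega>) (L2_inner \<Omega> f)"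
      by (rule L2_inner_linear_right[OF meas assms(2) order_refl])
    show ?thesis
    proof (rule linear_onI)
      show "l (y + z) = l y + l z" if "y \<in> X" "z \<in> X" for y z
      proof -
        have "fst (fst y) \<in> L2 \<Omega>" "fst (fst z) \<in> L2 \<Omega>" using that sub L by (auto simp: X_def)
        then show ?thesis using lin by (simp add: l_def linear_on_def)
      qed
      show "l (c *\<^sub>R y) = c * l y" if "y \<in> X" for c y
      proof -
        have "fst (fst y) \<in> L2 \<Omega>" using that sub L by (auto simp: X_def)
        then show ?thesis using lin by (simp add: l_def linear_on_def)
      qed
    qed
  qed
  obtain B where B: "finite B" "?V \<subseteq> span B" using V_finite_dimensional[OF T \<Omega>] by blast
  have "X \<subseteq> span (B \<times> {0} \<union> {0} \<times> B)"
    unfolding X_def by (rule span_Times_superset) (use B sub in auto)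
  moreover have "finite (B \<times> {0} \<union> {0} \<times> B)" using B by simp
  ultimately have "\<exists>z\<in>X. \<forall>y\<in>X. form z y = l y"
    using definite in_X by (intro nondegenerate_form_represents_functional[OF sX _ _ form_left form_right _ \<open>linear_on X l\<close>]) auto
  then obtain z where z: "z \<in> X" "\<And>y. y \<in> X \<Longrightarrow> form z y = l y" by blast
  let ?S = "\<lambda>u w. u \<in> ?Z \<and> w \<in> ?V \<and> (\<forall>\<phi>\<in>?V. V_inner T w \<phi> - L2_inner \<Omega> (?g u) (?g \<phi>) = 0) \<and>
    (\<forall>\<psi>\<in>?Z. L2_inner \<Omega> (?g w) (?g \<psi>) = L2_inner \<Omega> f (fst \<psi>))"
  have zero_in: "(0::weak_fun) \<in> ?V" "(0::weak_fun) \<in> ?Z" using sV sV0 by (auto intro: subspace_0)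
  have grad0: "grad v 0 = 0" "V_inner T v 0 = 0" if "v \<in> ?V" for v
    using linear_on_zero[OF grad_lin'[OF that] sV] linear_on_zero[OF V_lin'[OF that] sV] by auto
  have iff: "?S u w \<longleftrightarrow> (u, w) \<in> X \<and> (\<forall>y\<in>X. form (u, w) y = l y)" for u w
  proof
    assume "?S u w"
    then show "(u, w) \<in> X \<and> (\<forall>y\<in>X. form (u, w) y = l y)"
      by (auto simp: X_def form_def l_def grad_def)
  next
    assume h: "(u, w) \<in> X \<and> (\<forall>y\<in>X. form (u, w) y = l y)"
    then have u: "u \<in> ?Z" "u \<in> ?V" and w: "w \<in> ?V" using sub by (auto simp: X_def)
    have "V_inner T w \<phi> - grad u \<phi> = 0" if "\<phi> \<in> ?V" for \<phi>
    proof -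
      have "form (u, w) (0, \<phi>) = l (0, \<phi>)" using h that zero_in by (auto simp: X_def)
      then show ?thesis by (simp add: form_def l_def grad0[OF w] L2_inner_def)
    qed
    moreover have "grad w \<psi> = L2_inner \<Omega> f (fst \<psi>)" if "\<psi> \<in> ?Z" for \<psi>
    proof -
      have "form (u, w) (\<psi>, 0) = l (\<psi>, 0)" using h that zero_in by (auto simp: X_def)
      then show ?thesis by (simp add: form_def l_def grad0[OF w] grad0[OF u(2)])
    qed
    ultimately show "?S u w" using u w by (simp add: grad_def)
  qed
  have "\<exists>!p. p \<in> X \<and> (\<forall>y\<in>X. form p y = l y)"
  proof (rule ex1I[of _ z])
    show "z \<in> X \<and> (\<forall>y\<in>X. form z y = l y)" using z by blast
    fix p assume p: "p \<in> X \<and> (\<forall>y\<in>X. form p y = l y)"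
    have pz: "p - z \<in> X" by (rule subspace_diff[OF sX]) (use p z in auto)
    have "form (p - z) y = 0" if "y \<in> X" for y
      using linear_on_diff[OF form_left[OF that] sX, of p z] p z that by simp
    then have "p - z = 0" using definite[OF pz] in_X[OF pz] pz by blast
    then show "p = z" by simp
  qed
  moreover have "(\<lambda>(u, w). (u, w) \<in> X \<and> (\<forall>y\<in>X. form (u, w) y = l y))
      = (\<lambda>p. p \<in> X \<and> (\<forall>y\<in>X. form p y = l y))"
    by (rule ext) (simp add: case_prod_beta)
  ultimately show ?thesis unfolding iff by simp
qed

end
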